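(* Consider the classes $[\mathfrak{C}_T]^{\alpha}_{\beta|\gamma}$ of partial functions on $\mathbb{N}^\mathbb{N}$ for $\alpha,\beta,\gamma\in\mathbb{N}\cup\{<\omega,\omega\}$. This family contains exactly seven monoids under composition of partial functions, namely $[\mathfrak{C}_T]^1_1$, $[\mathfrak{C}_T]^1_{<\omega}$, $[\mathfrak{C}_T]^1_{\omega|<\omega}$, $[\mathfrak{C}_T]^{<\omega}_1$, $[\mathfrak{C}_T]^1_\omega$, $[\mathfrak{C}_T]^{<\omega}_\omega$, and $[\mathfrak{C}_T]^\omega_1$.
   Context: For $g\in\mathbb{N}^\mathbb{N}$, $g\upharpoonright n$ is its initial segment of length $n$. $\{\Phi_e\}_{e\in\mathbb{N}}$ is a fixed effective enumeration of all partial computable functions (Turing functionals) $\subseteq\mathbb{N}^\mathbb{N}\to\mathbb{N}^\mathbb{N}$. $\{\Psi_e\}_{e\in\mathbb{N}}$ is a fixed effective enumeration of total computable functions $\Psi_e:\mathbb{N}^{<\mathbb{N}}\to\mathbb{N}$ ("learners") such that for every partial computable $\Psi:\subseteq\mathbb{N}^{<\mathbb{N}}\to\mathbb{N}$ there is $e$ with: for all $f\in\mathbb{N}^\mathbb{N}$, if $\lim_s\Psi(f\upharpoonright s)$ converges then $\lim_s\Psi_e(f\upharpoonright s)$ converges to the same value. For a learner $\Psi$ and $g\in\mathbb{N}^\mathbb{N}$ let $\mathtt{mcl}_\Psi(g)=\{n:\Psi(g\upharpoonright n+1)\neq\Psi(g\upharpoonright n)\}$ and $\mathtt{indx}_\Psi(g)=\{\Psi(g\upharpoonright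 n):n\in\mathbb{N}\}$. For $D\subseteq\mathbb{N}^\mathbb{N}$ and ordinals $\alpha,\beta,\gamma\le\omega$, a function $\Gamma:D\to\mathbb{N}^\mathbb{N}$ is $(\alpha,\beta|\gamma)$-computable if there is a set $I\subseteq\mathbb{N}$ of cardinality $\alpha$ such that for every $g\in D$ there is $e\in I$ with (i) $\lim_n\Psi_e(g\upharpoonright n)$ converges and $\Phi_{\lim_n\Psi_e(g\upharpoonright n)}(g)=\Gamma(g)$; (ii) $\#\mathtt{mcl}_{\Psi_e}(g)<\beta$; (iii) $\#\mathtt{indx}_{\Psi_e}(g)\le\gamma$. $[\mathfrak{C}_T]^\alpha_{\beta|\gamma}$ is the class of all partial functions $\Gamma:\subseteq\mathbb{N}^\mathbb{N}\to\mathbb{N}^\mathbb{N}$ that are $(\alpha,\beta|\gamma)$-computable on $D=\mathrm{dom}(\Gamma)$, and $[\mathfrak{C}_T]^\alpha_\beta=[\mathfrak{C}_T]^\alpha_{\beta|\omega}$. The symbol $<\omega$ in any position means "some natural number", e.g. $\Gamma\in[\mathfrak{C}_T]^{<\omega}_{\omega|<\omega}$ iff $\Gamma\in[\mathfrak{C}_T]^{a}_{\omega|c}$ for some $a,c\in\mathbb{N}$. Composition $\Gamma_1\circ\Gamma_0$ has domain $\{f\in\mathrm{dom}(\Gamma_0):\Gamma_0(f)\in\mathrm{dom}(\Gamma_1)\}$. *)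

theory Defs
  imports Complex_Main "HOL-Library.Nat_Bijection" "HOL-Library.Extended_Nat" "HOL-Algebra.Group"
begin

section \<open>Partial computable functionals\<close>

text \<open>Codes of unary partial recursive functions relative to an oracle in \<open>\<nat>\<^sup>\<nat>\<close>. Several arguments
  are passed as one number, by means of the Cantor pairing \<^const>\<open>prod_encode\<close>.\<close>

datatype code =
    CZero | CSucc | CFst | CSnd | COracle
  | CPair code code | CComp code code | CPrec code code | CMu code

primrec sem :: "code \<Rightarrow> (nat \<Rightarrow> nat) \<Rightarrow> nat \<Rightarrow> nat option" where
  "sem CZero g x = Some 0"
| "sem CSucc g x = Some (Suc x)"
| "sem CFst g x = Some (fst (prod_decode x))"
| "sem CSnd g x = Some (snd (prod_decode x))"
| "sem COracle g x = Some (g x)"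
| "sem (CPair p q) g x =
     Option.bind (sem p g x) (\<lambda>u. Option.bind (sem q g x) (\<lambda>v. Some (prod_encode (u, v))))"
| "sem (CComp p q) g x = Option.bind (sem q g x) (sem p g)"
| "sem (CPrec p q) g x =
     (let (a, n) = prod_decode x in
      rec_nat (sem p g a)
        (\<lambda>m r. Option.bind r (\<lambda>v. sem q g (prod_encode (a, prod_encode (m, v))))) n)"
| "sem (CMu p) g x =
     (let P = (\<lambda>y. sem p g (prod_encode (x, y)) = Some 0 \<and>
                   (\<forall>z<y. \<exists>v. sem p g (prod_encode (x, z)) = Some (Suc v)))
      in if \<exists>y. P y then Some (LEAST y. P y) else None)"

function decode :: "nat \<Rightarrow> code" where
  "decode n =
    (if n < 5 then [CZero, CSucc, CFst, CSnd, COracle] ! n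
     else let m = (n - 5) div 4; a = fst (prod_decode m); b = snd (prod_decode m) in
       if (n - 5) mod 4 = 0 then CPair (decode a) (decode b)
       else if (n - 5) mod 4 = 1 then CComp (decode a) (decode b)
       else if (n - 5) mod 4 = 2 then CPrec (decode a) (decode b)
       else CMu (decode m))"
  by pat_completeness auto

lemma prod_decode_le: "fst (prod_decode m) \<le> m" "snd (prod_decode m) \<le> m"
  by (metis le_prod_encode_1 le_prod_encode_2 prod.collapse prod_decode_inverse)+

termination decode
proof -
  have m: "(n - 5) div 4 < n" if "\<not> n < 5" for n :: nat using that by linarith
  show ?thesis
    by (relation "measure id") (simp_all add: m le_less_trans[OF prod_decode_le(1) m]
        le_less_trans[OF prod_decode_le(2) m])
qed

declare decode.simps [simp del]

text \<open>The \<open>e\<close>-th functional is defined at \<open>g\<close> iff all values \<open>\<Phi>\<^sub>e(g)(n)\<close> are.\<close>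

definition Phi :: "nat \<Rightarrow> (nat \<Rightarrow> nat) \<rightharpoonup> (nat \<Rightarrow> nat)" where
  "Phi e g = (if \<forall>n. sem (decode e) g n \<noteq> None
              then Some (\<lambda>n. the (sem (decode e) g n)) else None)"

section \<open>Learners\<close>

text \<open>Learners are enumerated as the primitive recursive functions on finite sequences (coded by
  \<^const>\<open>list_encode\<close>); an index that is not the code of a primitive recursive function yields
  the constant learner \<open>0\<close>. This is an effective enumeration of total functions, and every partial
  computable function on finite sequences has the same limits as some member of it: see
  \<open>learner_universal\<close> below.

  The limit property alone does not determine the classes below, since it does not bound the number
  of mind changes (every member of the enumeration might change its mind at least once, say). The
  present choice gives the classes one obtains from all total computable \<open>\<Psi>\<close>: delaying the
  values of \<open>\<Psi>\<close>, starting with \<open>\<Psi>(\<langle>\<rangle>)\<close>, makes it primitive recursive and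
  neither adds mind changes nor new hypotheses.\<close>

primrec primitive :: "code \<Rightarrow> bool" where
  "primitive CZero = True"
| "primitive CSucc = True"
| "primitive CFst = True"
| "primitive CSnd = True"
| "primitive COracle = False"
| "primitive (CPair p q) = (primitive p \<and> primitive q)"
| "primitive (CComp p q) = (primitive p \<and> primitive q)"
| "primitive (CPrec p q) = (primitive p \<and> primitive q)"
| "primitive (CMu p) = False"

definition Psi :: "nat \<Rightarrow> nat list \<Rightarrow> nat" where
  "Psi e \<sigma> = (if primitive (decode e)
              then the (sem (decode e) (\<lambda>_. 0) (list_encode \<sigma>)) else 0)"

definition init_seg :: "(nat \<Rightarrow> nat) \<Rightarrow> nat \<Rightarrow> nat list"  (infixl "\<restriction>" 90) where
  "g \<restriction> n = map g [0..<n]"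

definition mcl :: "(nat list \<Rightarrow> nat) \<Rightarrow> (nat \<Rightarrow> nat) \<Rightarrow> nat set" where
  "mcl \<Psi> g = {n. \<Psi> (g \<restriction> (n + 1)) \<noteq> \<Psi> (g \<restriction> n)}"

definition indx :: "(nat list \<Rightarrow> nat) \<Rightarrow> (nat \<Rightarrow> nat) \<Rightarrow> nat set" where
  "indx \<Psi> g = {\<Psi> (g \<restriction> n) | n. True}"

section \<open>The classes\<close>

text \<open>Ordinals up to \<open>\<omega>\<close> are represented by \<^typ>\<open>enat\<close>, with \<open>\<omega> = \<infinity>\<close>.\<close>

definition ecard :: "nat set \<Rightarrow> enat" where
  "ecard A = (if finite A then enat (card A) else \<infinity>)"

definition learnable ::
    "enat \<Rightarrow> enat \<Rightarrow> enat \<Rightarrow> ((nat \<Rightarrow> nat) \<rightharpoonup> (nat \<Rightarrow> nat)) \<Rightarrow> bool" where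
  "learnable \<alpha> \<beta> \<gamma> \<Gamma> \<longleftrightarrow>
    (\<exists>I :: nat set. ecard I = \<alpha> \<and>
      (\<forall>g \<in> dom \<Gamma>. \<exists>e \<in> I.
         convergent (\<lambda>n. Psi e (g \<restriction> n)) \<and> Phi (lim (\<lambda>n. Psi e (g \<restriction> n))) g = \<Gamma> g \<and>
         ecard (mcl (Psi e) g) < \<beta> \<and>
         ecard (indx (Psi e) g) \<le> \<gamma>))"

datatype bound = Fin nat | LessOmega | Omega

primrec bound_values :: "bound \<Rightarrow> enat set" where
  "bound_values (Fin n) = {enat n}"
| "bound_values LessOmega = range enat"
| "bound_values Omega = {\<infinity>}"

definition CT :: "bound \<Rightarrow> bound \<Rightarrow> bound \<Rightarrow> ((nat \<Rightarrow> nat) \<rightharpoonup> (nat \<Rightarrow> nat)) set" where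
  "CT \<alpha> \<beta> \<gamma> =
    {\<Gamma>. \<exists>a \<in> bound_values \<alpha>. \<exists>b \<in> bound_values \<beta>. \<exists>c \<in> bound_values \<gamma>. learnable a b c \<Gamma>}"

abbreviation CT2 :: "bound \<Rightarrow> bound \<Rightarrow> ((nat \<Rightarrow> nat) \<rightharpoonup> (nat \<Rightarrow> nat)) set" where
  "CT2 \<alpha> \<beta> \<equiv> CT \<alpha> \<beta> Omega"

text \<open>The unit is the identity function of \<open>\<nat>\<^sup>\<nat>\<close>. In particular \<open>{\<emptyset>}\<close>, which is the class
  whenever one of the three bounds is \<open>0\<close>, does not count as a monoid.\<close>

definition composition_monoid ::
    "((nat \<Rightarrow> nat) \<rightharpoonup> (nat \<Rightarrow> nat)) set \<Rightarrow> ((nat \<Rightarrow> nat) \<rightharpoonup> (nat \<Rightarrow> nat)) monoid" where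
  "composition_monoid C = \<lparr>carrier = C, mult = (\<circ>\<^sub>m), one = Some\<rparr>"

section \<open>Adequacy of the enumerations\<close>

primrec encode :: "code \<Rightarrow> nat" where
  "encode CZero = 0"
| "encode CSucc = 1"
| "encode CFst = 2"
| "encode CSnd = 3"
| "encode COracle = 4"
| "encode (CPair p q) = 4 * prod_encode (encode p, encode q) + 5"
| "encode (CComp p q) = 4 * prod_encode (encode p, encode q) + 6"
| "encode (CPrec p q) = 4 * prod_encode (encode p, encode q) + 7"
| "encode (CMu p) = 4 * encode p + 8"

lemma decode_rec:
  assumes "i < 4"
  shows "decode (4 * m + 5 + i) =
    (if i = 0 then CPair (decode (fst (prod_decode m))) (decode (snd (prod_decode m)))
     else if i = 1 then CComp (decode (fst (prod_decode m))) (decode (snd (prod_decode m)))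
     else if i = 2 then CPrec (decode (fst (prod_decode m))) (decode (snd (prod_decode m)))
     else CMu (decode m))"
proof -
  have "\<not> 4 * m + 5 + i < 5" "(4 * m + 5 + i - 5) div 4 = m" "(4 * m + 5 + i - 5) mod 4 = i"
    using assms by simp_all
  then show ?thesis by (simp only: decode.simps[of "4 * m + 5 + i"] if_False Let_def)
qed

lemma decode_base:
  "decode 0 = CZero" "decode 1 = CSucc" "decode 2 = CFst" "decode 3 = CSnd" "decode 4 = COracle"
  by (subst decode.simps, simp only: if_True rel_simps, simp)+

lemma decode_encode: "decode (encode c) = c"
proof (induction c)
  case (CPair p q)
  then show ?case using decode_rec[of 0 "prod_encode (encode p, encode q)"] by simp
next
  case (CComp p q)
  then show ?case using decode_rec[of 1 "prod_encode (encode p, encode q)"]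
    by (simp add: add.commute)
next
  case (CPrec p q)
  then show ?case using decode_rec[of 2 "prod_encode (encode p, encode q)"]
    by (simp add: add.commute)
next
  case (CMu p)
  then show ?case using decode_rec[of 3 "encode p"] by (simp add: add.commute)
qed (simp_all only: encode.simps, simp_all only: decode_base)

lemma primitive_total: "primitive c \<Longrightarrow> \<exists>y. sem c g x = Some y"
proof (induction c arbitrary: x)
  case (CPair p q)
  then obtain u v where "sem p g x = Some u" "sem q g x = Some v" by fastforce
  then show ?case by simp
next
  case (CComp p q)
  then obtain u where "sem q g x = Some u" by fastforce
  with CComp show ?case by simp
next
  case (CPrec p q)
  obtain a n where x: "prod_decode x = (a, n)" by fastforce
  have "\<exists>y. rec_nat (sem p g a)
        (\<lambda>m r. Option.bind r (\<lambda>v. sem q g (prod_encode (a, prod_encode (m, v))))) n = Some y"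
  proof (induction n)
    case 0
    show ?case using CPrec by simp
  next
    case (Suc n)
    then show ?case using CPrec by fastforce
  qed
  then show ?case by (simp add: x)
qed auto

definition prim_rec :: "(nat \<Rightarrow> nat) \<Rightarrow> bool" where
  "prim_rec f \<longleftrightarrow> (\<exists>c. primitive c \<and> (\<forall>g x. sem c g x = Some (f x)))"

abbreviation pr1 :: "nat \<Rightarrow> nat" where "pr1 x \<equiv> fst (prod_decode x)"
abbreviation pr2 :: "nat \<Rightarrow> nat" where "pr2 x \<equiv> snd (prod_decode x)"
abbreviation pair :: "nat \<Rightarrow> nat \<Rightarrow> nat" where "pair x y \<equiv> prod_encode (x, y)"

lemma pr_comp: "prim_rec f \<Longrightarrow> prim_rec h \<Longrightarrow> prim_rec (\<lambda>x. f (h x))"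
  unfolding prim_rec_def by (metis primitive.simps(7) sem.simps(7) Option.bind.bind_lunit)

lemma pr_pair:
  assumes "prim_rec f" "prim_rec h"
  shows "prim_rec (\<lambda>x. pair (f x) (h x))"
proof -
  obtain c d where "primitive c" "\<forall>g x. sem c g x = Some (f x)"
    "primitive d" "\<forall>g x. sem d g x = Some (h x)"
    using assms unfolding prim_rec_def by blast
  then show ?thesis unfolding prim_rec_def by (intro exI[of _ "CPair c d"]) auto
qed

lemma pr_0: "prim_rec (\<lambda>x. 0)"
  unfolding prim_rec_def by (intro exI[of _ CZero]) auto

lemma pr_fst0: "prim_rec pr1"
  unfolding prim_rec_def by (intro exI[of _ CFst]) auto

lemma pr_snd0: "prim_rec pr2"
  unfolding prim_rec_def by (intro exI[of _ CSnd]) auto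

lemma pr_Suc0: "prim_rec Suc"
  unfolding prim_rec_def by (intro exI[of _ CSucc]) auto

lemmas pr_fst = pr_comp[OF pr_fst0] and pr_snd = pr_comp[OF pr_snd0] and pr_Suc = pr_comp[OF pr_Suc0]

lemma pr_id: "prim_rec (\<lambda>x. x)"
  using pr_pair[OF pr_fst0 pr_snd0] by simp

lemma pr_rec:
  assumes b: "prim_rec b" and h: "prim_rec (\<lambda>z. h (pr1 z) (pr1 (pr2 z)) (pr2 (pr2 z)))"
    and n: "prim_rec n"
  shows "prim_rec (\<lambda>x. rec_nat (b x) (h x) (n x))"
proof -
  obtain c where c: "primitive c" "\<And>g x. sem c g x = Some (b x)"
    using b unfolding prim_rec_def by blast
  obtain d where d: "primitive d"
    "\<And>g z. sem d g z = Some (h (pr1 z) (pr1 (pr2 z)) (pr2 (pr2 z)))"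
    using h unfolding prim_rec_def by blast
  have *: "rec_nat (Some (b a)) (\<lambda>m r. Option.bind r (\<lambda>v. Some (h a m v))) k
      = Some (rec_nat (b a) (h a) k)" for a k
    by (induction k) auto
  have "sem (CPrec c d) g z = Some (rec_nat (b (pr1 z)) (h (pr1 z)) (pr2 z))" for g z
    by (simp add: c d * case_prod_beta)
  then have "prim_rec (\<lambda>z. rec_nat (b (pr1 z)) (h (pr1 z)) (pr2 z))"
    unfolding prim_rec_def using c d by (intro exI[of _ "CPrec c d"]) auto
  from pr_comp[OF this pr_pair[OF pr_id n]] show ?thesis by simp
qed

lemma pr_if:
  assumes "prim_rec f" "prim_rec a" "prim_rec b"
  shows "prim_rec (\<lambda>x. if f x = 0 then a x else b x)"
proof -
  have "prim_rec (\<lambda>x. rec_nat (a x) (\<lambda>_ _. b x) (f x))"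
    by (rule pr_rec) (intro assms pr_comp[OF assms(3)] pr_fst0)+
  moreover have "rec_nat (a x) (\<lambda>_ _. b x) (f x) = (if f x = 0 then a x else b x)" for x
    by (cases "f x") auto
  ultimately show ?thesis by simp
qed

lemma pr_pred: "prim_rec f \<Longrightarrow> prim_rec (\<lambda>x. f x - 1)"
proof -
  assume f: "prim_rec f"
  have "prim_rec (\<lambda>x. rec_nat 0 (\<lambda>m _. m) (f x))"
    by (rule pr_rec) (intro f pr_0 pr_fst pr_snd0)+
  moreover have "rec_nat 0 (\<lambda>m _. m) (f x) = f x - 1" for x by (cases "f x") auto
  ultimately show ?thesis by simp
qed

lemmas pr_intros = pr_id pr_0 pr_if pr_pred pr_pair pr_fst pr_snd pr_Suc

text \<open>Evaluation with searches bounded by \<open>t\<close> and oracle constantly \<open>0\<close>; the result \<open>0\<close> means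
  undefined, \<open>Suc y\<close> means value \<open>y\<close>.\<close>

primrec bsem :: "code \<Rightarrow> nat \<Rightarrow> nat \<Rightarrow> nat" where
  "bsem CZero t x = Suc 0"
| "bsem CSucc t x = Suc (Suc x)"
| "bsem CFst t x = Suc (pr1 x)"
| "bsem CSnd t x = Suc (pr2 x)"
| "bsem COracle t x = Suc 0"
| "bsem (CPair p q) t x =
    (if bsem p t x = 0 then 0 else if bsem q t x = 0 then 0
     else Suc (pair (bsem p t x - 1) (bsem q t x - 1)))"
| "bsem (CComp p q) t x = (if bsem q t x = 0 then 0 else bsem p t (bsem q t x - 1))"
| "bsem (CPrec p q) t x =
    rec_nat (bsem p t (pr1 x))
      (\<lambda>m r. if r = 0 then 0 else bsem q t (pair (pr1 x) (pair m (r - 1)))) (pr2 x)"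
| "bsem (CMu p) t x =
    rec_nat 0
      (\<lambda>m r. if r = 0 then
               if bsem p t (pair x m) = 0 then Suc 0
               else if bsem p t (pair x m) - 1 = 0 then Suc (Suc m) else 0
             else r) t - 1"

lemma pr_bsem: "prim_rec T \<Longrightarrow> prim_rec X \<Longrightarrow> prim_rec (\<lambda>x. bsem c (T x) (X x))"
proof (induction c arbitrary: T X)
  case (CPrec p q)
  show ?case unfolding bsem.simps
    by (rule pr_rec) (intro pr_intros CPrec pr_comp[OF CPrec.prems(1)] pr_comp[OF CPrec.prems(2)])+
next
  case (CMu p)
  show ?case unfolding bsem.simps
    by (rule pr_pred, rule pr_rec)
       (intro pr_intros CMu pr_comp[OF CMu.prems(1)] pr_comp[OF CMu.prems(2)])+
next
  case (CPair p q)
  show ?case unfolding bsem.simps by (intro pr_intros CPair)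
next
  case (CComp p q)
  show ?case unfolding bsem.simps by (intro pr_intros CComp)
qed (simp_all only: bsem.simps, (intro pr_intros; assumption)+)

lemma bsem_sound: "bsem c t x = Suc y \<Longrightarrow> sem c (\<lambda>_. 0) x = Some y"
proof (induction c arbitrary: x y)
  case (CPair p q)
  then obtain u v where "bsem p t x = Suc u" "bsem q t x = Suc v"
    by (metis bsem.simps(6) not0_implies_Suc old.nat.distinct(2))
  with CPair show ?case by (auto dest!: CPair.IH)
next
  case (CComp p q)
  then obtain u where "bsem q t x = Suc u"
    by (metis bsem.simps(7) not0_implies_Suc old.nat.distinct(2))
  with CComp show ?case by (auto dest!: CComp.IH)
next
  case (CPrec p q)
  have "rec_nat (bsem p t a)
      (\<lambda>m r. if r = 0 then 0 else bsem q t (pair a (pair m (r - 1)))) n = Suc y \<Longrightarrow>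
    rec_nat (sem p (\<lambda>_. 0) a)
        (\<lambda>m r. Option.bind r (\<lambda>v. sem q (\<lambda>_. 0) (pair a (pair m v)))) n = Some y" for a n y
  proof (induction n arbitrary: y)
    case 0
    then show ?case using CPrec.IH by simp
  next
    case (Suc n)
    show ?case
    proof (cases "rec_nat (bsem p t a)
      (\<lambda>m r. if r = 0 then 0 else bsem q t (pair a (pair m (r - 1)))) n")
      case 0
      with Suc.prems show ?thesis by simp
    next
      case (Suc u)
      with Suc.IH[OF this] Suc.prems CPrec.IH(2) show ?thesis by simp
    qed
  qed
  with CPrec.prems show ?case by (simp add: case_prod_beta)
next
  case (CMu p)
  define R where "R = rec_nat 0
      (\<lambda>m r. if r = 0 then
               if bsem p t (pair x m) = 0 then Suc 0
               else if bsem p t (pair x m) - 1 = 0 then Suc (Suc m) else 0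
             else r)"
  have R: "(R n = 0 \<longrightarrow> (\<forall>z<n. \<exists>v. bsem p t (pair x z) = Suc (Suc v))) \<and>
    (\<forall>y. R n = Suc (Suc y) \<longrightarrow> bsem p t (pair x y) = Suc 0 \<and>
      (\<forall>z<y. \<exists>v. bsem p t (pair x z) = Suc (Suc v)))" for n
  proof (induction n)
    case 0
    show ?case by (simp add: R_def)
  next
    case (Suc n)
    have "R (Suc n) = (if R n = 0 then
               if bsem p t (pair x n) = 0 then Suc 0
               else if bsem p t (pair x n) - 1 = 0 then Suc (Suc n) else 0
             else R n)"
      by (simp add: R_def)
    moreover have "bsem p t (pair x n) = 0 \<or> bsem p t (pair x n) = Suc 0 \<or>
        (\<exists>v. bsem p t (pair x n) = Suc (Suc v))"
      by (metis not0_implies_Suc)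
    ultimately show ?case using Suc by (auto simp: less_Suc_eq split: if_splits)
  qed
  have "R t = Suc (Suc y)" using CMu.prems by (simp add: R_def)
  with R have "bsem p t (pair x y) = Suc 0" "\<forall>z<y. \<exists>v. bsem p t (pair x z) = Suc (Suc v)"
    by blast+
  with CMu.IH have *: "sem p (\<lambda>_. 0) (pair x y) = Some 0"
    "\<forall>z<y. \<exists>v. sem p (\<lambda>_. 0) (pair x z) = Some (Suc v)"
    by blast+
  then have "(LEAST y. sem p (\<lambda>_. 0) (pair x y) = Some 0 \<and>
     (\<forall>z<y. \<exists>v. sem p (\<lambda>_. 0) (pair x z) = Some (Suc v))) = y"
    by (intro Least_equality) (auto simp: not_less[symmetric])
  with * show ?case by (auto simp: Let_def)
qed auto

lemma bsem_complete:
  "sem c (\<lambda>_. 0) x = Some y \<Longrightarrow> eventually (\<lambda>t. bsem c t x = Suc y) sequentially"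
proof (induction c arbitrary: x y)
  case (CPair p q)
  then obtain u v where uv: "sem p (\<lambda>_. 0) x = Some u" "sem q (\<lambda>_. 0) x = Some v" "y = pair u v"
    by (auto simp: bind_eq_Some_conv)
  show ?case using CPair.IH(1)[OF uv(1)] CPair.IH(2)[OF uv(2)]
    by eventually_elim (simp add: uv)
next
  case (CComp p q)
  then obtain u where u: "sem q (\<lambda>_. 0) x = Some u" "sem p (\<lambda>_. 0) u = Some y"
    by (auto simp: bind_eq_Some_conv)
  show ?case using CComp.IH(2)[OF u(1)] CComp.IH(1)[OF u(2)]
    by eventually_elim simp
next
  case (CPrec p q)
  have "rec_nat (sem p (\<lambda>_. 0) a)
        (\<lambda>m r. Option.bind r (\<lambda>v. sem q (\<lambda>_. 0) (pair a (pair m v)))) n = Some y \<Longrightarrow>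
    eventually (\<lambda>t. rec_nat (bsem p t a)
      (\<lambda>m r. if r = 0 then 0 else bsem q t (pair a (pair m (r - 1)))) n = Suc y) sequentially"
    for a n y
  proof (induction n arbitrary: y)
    case 0
    then show ?case using CPrec.IH(1) by simp
  next
    case (Suc n)
    then obtain u where u: "rec_nat (sem p (\<lambda>_. 0) a)
        (\<lambda>m r. Option.bind r (\<lambda>v. sem q (\<lambda>_. 0) (pair a (pair m v)))) n = Some u"
      "sem q (\<lambda>_. 0) (pair a (pair n u)) = Some y"
      by (auto simp: bind_eq_Some_conv)
    show ?case using Suc.IH[OF u(1)] CPrec.IH(2)[OF u(2)]
      by eventually_elim simp
  qed
  with CPrec.prems show ?case by (simp add: case_prod_beta)
next
  case (CMu p)
  let ?P = "\<lambda>y. sem p (\<lambda>_. 0) (pair x y) = Some 0 \<and>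
     (\<forall>z<y. \<exists>v. sem p (\<lambda>_. 0) (pair x z) = Some (Suc v))"
  have ex: "\<exists>y. ?P y" and y: "(LEAST y. ?P y) = y"
    using CMu.prems by (auto simp: Let_def split: if_splits)
  have P: "?P y" using LeastI_ex[OF ex] unfolding y .
  have "eventually (\<lambda>t. \<forall>z\<in>{..<y}. \<exists>v. bsem p t (pair x z) = Suc (Suc v)) sequentially"
  proof (rule eventually_ball_finite)
    show "\<forall>z\<in>{..<y}. eventually (\<lambda>t. \<exists>v. bsem p t (pair x z) = Suc (Suc v)) sequentially"
    proof
      fix z assume "z \<in> {..<y}"
      then obtain v where "sem p (\<lambda>_. 0) (pair x z) = Some (Suc v)" using P by blast
      from CMu.IH[OF this]
      show "eventually (\<lambda>t. \<exists>v. bsem p t (pair x z) = Suc (Suc v)) sequentially"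
        by (rule eventually_mono) blast
    qed
  qed simp
  moreover have "eventually (\<lambda>t. bsem p t (pair x y) = Suc 0) sequentially"
    using CMu.IH P by blast
  moreover have "eventually (\<lambda>t. Suc y \<le> t) sequentially" by (rule eventually_ge_at_top)
  ultimately show ?case
  proof eventually_elim
    case (elim t)
    define R where "R = rec_nat 0
      (\<lambda>m r. if r = 0 then
               if bsem p t (pair x m) = 0 then Suc 0
               else if bsem p t (pair x m) - 1 = 0 then Suc (Suc m) else 0
             else r)"
    have R: "R (Suc n) = (if R n = 0 then
               if bsem p t (pair x n) = 0 then Suc 0
               else if bsem p t (pair x n) - 1 = 0 then Suc (Suc n) else 0
             else R n)" for n
      by (simp add: R_def)
    have "n \<le> y \<Longrightarrow> R n = 0" for n
    proof (induction n)
      case 0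
      show ?case by (simp add: R_def)
    next
      case (Suc n)
      then obtain v where "bsem p t (pair x n) = Suc (Suc v)" using elim by force
      with Suc R show ?case by simp
    qed
    then have "R (Suc y) = Suc (Suc y)" using elim R by simp
    with elim(3) have "R t = Suc (Suc y)"
      by (induction t rule: dec_induct) (simp_all add: R)
    then show ?case by (simp add: R_def)
  qed
qed auto

text \<open>\<open>rotate_code n x\<close> moves \<open>n\<close> elements, one at a time, from the list coded by \<open>x\<close> to an
  initially empty one.\<close>

definition rotate_code :: "nat \<Rightarrow> nat \<Rightarrow> nat" where
  "rotate_code n x = rec_nat (pair x 0)
     (\<lambda>_ r. if pr1 r = 0 then r
            else pair (pr2 (pr1 r - 1)) (Suc (pair (pr1 (pr1 r - 1)) (pr2 r)))) n"

lemma rotate_code: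
  "rotate_code n (list_encode xs) = pair (list_encode (drop n xs)) (list_encode (rev (take n xs)))"
proof (induction n)
  case 0
  show ?case by (simp add: rotate_code_def)
next
  case (Suc n)
  have step: "rotate_code (Suc n) x = (let r = rotate_code n x in if pr1 r = 0 then r
            else pair (pr2 (pr1 r - 1)) (Suc (pair (pr1 (pr1 r - 1)) (pr2 r))))" for x
    by (simp add: rotate_code_def Let_def)
  show ?case
  proof (cases "n < length xs")
    case True
    then have "drop n xs = xs ! n # drop (Suc n) xs" "take (Suc n) xs = take n xs @ [xs ! n]"
      by (simp_all add: Cons_nth_drop_Suc take_Suc_conv_app_nth)
    then show ?thesis by (simp add: step Suc)
  qed (simp add: step Suc)
qed

definition take_code :: "nat \<Rightarrow> nat \<Rightarrow> nat" where
  "take_code n x = pr2 (rotate_code n (pr2 (rotate_code n x)))"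

lemma take_code: "take_code n (list_encode xs) = list_encode (take n xs)"
  by (simp add: take_code_def rotate_code)

lemma pr_rotate_code:
  assumes "prim_rec N" "prim_rec X" shows "prim_rec (\<lambda>x. rotate_code (N x) (X x))"
  unfolding rotate_code_def by (rule pr_rec) (intro pr_intros assms)+

lemma pr_take_code:
  assumes "prim_rec N" "prim_rec X" shows "prim_rec (\<lambda>x. take_code (N x) (X x))"
  unfolding take_code_def by (intro pr_intros pr_rotate_code assms)

lemma length_le_list_encode: "length xs \<le> list_encode xs"
  by (induction xs) (auto intro: order_trans[OF _ le_prod_encode_2])

theorem learner_universal:
  "\<exists>e. \<forall>f k. eventually (\<lambda>s. sem c (\<lambda>_. 0) (list_encode (f \<restriction> s)) = Some k) sequentially \<longrightarrow>
     (\<lambda>s. Psi e (f \<restriction> s)) \<longlonglongrightarrow> k"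
proof -
  define L where "L x = rec_nat 0
    (\<lambda>m r. if bsem c x (take_code m x) = 0 then r else bsem c x (take_code m x))" for x
  have "prim_rec (\<lambda>x. L x (Suc x) - 1)"
    unfolding L_def by (rule pr_pred, rule pr_rec) (intro pr_intros pr_bsem pr_take_code)+
  then obtain d where d: "primitive d" "\<And>g x. sem d g x = Some (L x (Suc x) - 1)"
    unfolding prim_rec_def by blast
  have Psi: "Psi (encode d) \<sigma> = L (list_encode \<sigma>) (Suc (list_encode \<sigma>)) - 1" for \<sigma>
    by (simp add: Psi_def decode_encode d)
  have "(\<lambda>s. Psi (encode d) (f \<restriction> s)) \<longlonglongrightarrow> k"
    if ev: "eventually (\<lambda>s. sem c (\<lambda>_. 0) (list_encode (f \<restriction> s)) = Some k) sequentially" for f k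
  proof -
    obtain S where S: "\<And>s. s \<ge> S \<Longrightarrow> sem c (\<lambda>_. 0) (list_encode (f \<restriction> s)) = Some k"
      using ev unfolding eventually_sequentially by blast
    obtain T where T: "\<And>t. t \<ge> T \<Longrightarrow> bsem c t (list_encode (f \<restriction> S)) = Suc k"
      using bsem_complete[OF S[of S]] unfolding eventually_sequentially by blast
    have "Psi (encode d) (f \<restriction> n) = k" if n: "n \<ge> S" "n \<ge> T" for n
    proof -
      define x where "x = list_encode (f \<restriction> n)"
      have x: "n \<le> x" using length_le_list_encode[of "f \<restriction> n"] by (simp add: x_def init_seg_def)
      have tk: "take_code m x = list_encode (f \<restriction> min m n)" for m
        by (simp add: x_def take_code init_seg_def take_map min_def)
      have L: "L x (Suc m) = (if bsem c x (take_code m x) = 0 then L x m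
          else bsem c x (take_code m x))" for m
        by (simp add: L_def)
      have "L x (Suc m) = Suc k" if "m \<ge> S" for m
        using that
      proof (induction m rule: dec_induct)
        case base
        show ?case using T[of x] n x by (simp add: L tk min_def)
      next
        case (step m)
        have "bsem c x (take_code (Suc m) x) = 0 \<or> bsem c x (take_code (Suc m) x) = Suc k"
        proof (cases "bsem c x (take_code (Suc m) x)")
          case (Suc y)
          have "sem c (\<lambda>_. 0) (take_code (Suc m) x) = Some k"
            unfolding tk using step n by (intro S) simp
          with bsem_sound[OF Suc] Suc show ?thesis by simp
        qed simp
        with step.IH show ?case by (subst L) auto
      qed
      from this[of x] n x show ?thesis by (simp add: Psi flip: x_def)
    qed
    then show ?thesis
      by (intro tendsto_eventually) (auto simp: eventually_sequentially intro!: exI[of _ "max S T"])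
  qed
  then show ?thesis by blast
qed

end

theory Submission
  imports Defs
begin

text \<open>
  Closure of the seven classes rests on a universal evaluator that is primitive recursive in an initial
  segment of the argument. A learner for \<open>\<Gamma> \<circ> \<Delta>\<close> feeds the part of \<open>\<Delta>(g)\<close> computed so far, according to
  the current hypothesis about \<open>\<Delta>\<close>, to the learner for \<open>\<Gamma>\<close>. If only finitely many mind changes or
  hypotheses are allowed, hypotheses are first replaced by their ranks, that is, by the number of
  preceding mind changes or by their order of first occurrence: a program can wait for the hypothesis of
  a given rank and run it, so that finitely many programs suffice. This also reduces all the remaining
  classes with unboundedly many learners to one of the seven.

  The other classes fail to be closed because of the functions that increase \<open>g(0)\<close> if \<open>g\<close> has a certain
  property, and leave \<open>g\<close> unchanged otherwise. With the properties \<open>\<exists>x\<ge>1. g(x) > j\<close>, the composition of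
  \<open>m\<close> such functions forces a single learner to use \<open>m + 1\<close> hypotheses, since every correct hypothesis
  refers to a finite part of \<open>g\<close> only. With properties obtained by diagonalization it defeats any given
  number of learners.
\<close>

section \<open>Primitive recursive functions and predicates\<close>

text \<open>Learners are primitive recursive, so every unbounded search has to move from the
  learners into the programs that they output; this is why the evaluator spends only as many steps
  as the given segment is long. The obstacle to closure is that bounds on mind changes and
  hypotheses hold only on the domain of a function, whereas the outer learner, as long as the inner
  hypothesis is wrong, reads data that may lie outside its domain. Ranks are therefore cut off at a
  constant, which bounds them everywhere and leaves the final rank intact. As a rank has finitely
  many values, the assignment of programs to ranks can be an arbitrary finite table. For the
  failures of closure two features of the definition are decisive. Fewer than b mind changes mean at
  most b hypotheses, so that one forcing argument treats both bounds. And the learner may be chosen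
  anew for each argument, so that a property obtained by diagonalization can occur in a factor
  without being computable.\<close>

definition prim_pred :: "(nat \<Rightarrow> bool) \<Rightarrow> bool" where
  "prim_pred P \<longleftrightarrow> prim_rec (\<lambda>x. if P x then 0 else 1)"

lemma pr_const: "prim_rec (\<lambda>x. k)"
  by (induction k) (simp_all add: pr_0 pr_Suc)

text \<open>This reduces to \<open>pr_if\<close>, which is the reason for coding truth by 0;
  \<open>CMu\<close> searches for 0 as well.\<close>

lemma pr_If:
  assumes "prim_pred P" "prim_rec a" "prim_rec b"
  shows "prim_rec (\<lambda>x. if P x then a x else b x)"
proof -
  have "(\<lambda>x. if (if P x then 0 else 1 :: nat) = 0 then a x else b x) = (\<lambda>x. if P x then a x else b x)"
    by auto
  with pr_if[OF assms(1)[unfolded prim_pred_def] assms(2,3)] show ?thesis by simp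
qed

lemma pp_comp: "prim_pred P \<Longrightarrow> prim_rec h \<Longrightarrow> prim_pred (\<lambda>x. P (h x))"
  unfolding prim_pred_def using pr_comp[of "\<lambda>x. if P x then 0 else 1" h] by simp

lemma pp_not:
  assumes "prim_pred P" shows "prim_pred (\<lambda>x. \<not> P x)"
proof -
  have "prim_rec (\<lambda>x. if P x then 1 else 0)" by (intro pr_If pr_const assms)
  also have "(\<lambda>x. if P x then 1 else 0) = (\<lambda>x. if \<not> P x then 0 else 1 :: nat)" by auto
  finally show ?thesis unfolding prim_pred_def .
qed

lemma pp_conj:
  assumes "prim_pred P" "prim_pred Q" shows "prim_pred (\<lambda>x. P x \<and> Q x)"
proof -
  have "prim_rec (\<lambda>x. if P x then (if Q x then 0 else 1) else 1)"
    by (intro pr_If pr_const assms)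
  also have "(\<lambda>x. if P x then (if Q x then 0 else 1) else 1)
      = (\<lambda>x. if P x \<and> Q x then 0 else 1 :: nat)" by auto
  finally show ?thesis unfolding prim_pred_def .
qed

lemma pp_disj:
  assumes "prim_pred P" "prim_pred Q" shows "prim_pred (\<lambda>x. P x \<or> Q x)"
  using pp_not[OF pp_conj[OF pp_not[OF assms(1)] pp_not[OF assms(2)]]] by simp

lemma pr_add:
  assumes "prim_rec f" "prim_rec h" shows "prim_rec (\<lambda>x. f x + h x)"
proof -
  have "prim_rec (\<lambda>x. rec_nat (f x) (\<lambda>_ r. Suc r) (h x))"
    by (rule pr_rec) (intro pr_intros assms)+
  moreover have "rec_nat (f x) (\<lambda>_ r. Suc r) n = f x + n" for x n by (induction n) auto
  ultimately show ?thesis by simp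
qed

lemma pr_diff:
  assumes "prim_rec f" "prim_rec h" shows "prim_rec (\<lambda>x. f x - h x)"
proof -
  have "prim_rec (\<lambda>x. rec_nat (f x) (\<lambda>_ r. r - 1) (h x))"
    by (rule pr_rec) (intro pr_intros assms)+
  moreover have "rec_nat (f x) (\<lambda>_ r. r - 1) n = f x - n" for x n by (induction n) auto
  ultimately show ?thesis by simp
qed

lemma pr_mult:
  assumes "prim_rec f" "prim_rec h" shows "prim_rec (\<lambda>x. f x * h x)"
proof -
  have "prim_rec (\<lambda>x. rec_nat 0 (\<lambda>_ r. r + f x) (h x))"
    by (rule pr_rec) (intro pr_intros pr_add pr_comp[OF assms(1)] assms(2))+
  moreover have "rec_nat 0 (\<lambda>_ r. r + f x) n = f x * n" for x n by (induction n) auto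
  ultimately show ?thesis by simp
qed

lemma pp_le:
  assumes "prim_rec f" "prim_rec h" shows "prim_pred (\<lambda>x. f x \<le> h x)"
proof -
  \<comment> \<open>With truncated subtraction the term is the sign of f x - h x.\<close>
  have "prim_rec (\<lambda>x. 1 - (1 - (f x - h x)))" by (intro pr_diff pr_const assms)
  moreover have "(\<lambda>x. 1 - (1 - (f x - h x))) = (\<lambda>x. if f x \<le> h x then 0 else 1)" by auto
  ultimately show ?thesis by (simp add: prim_pred_def)
qed

lemma pp_less:
  assumes "prim_rec f" "prim_rec h" shows "prim_pred (\<lambda>x. f x < h x)"
  using pp_not[OF pp_le[OF assms(2,1)]] by (simp add: not_le)

lemma pp_eq:
  assumes "prim_rec f" "prim_rec h" shows "prim_pred (\<lambda>x. f x = h x)"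
  using pp_conj[OF pp_le[OF assms] pp_le[OF assms(2,1)]] by (simp add: eq_iff)

lemma pp_bex:
  assumes P: "prim_pred (\<lambda>z. P (pr1 z) (pr2 z))" and n: "prim_rec n"
  shows "prim_pred (\<lambda>x. \<exists>j<n x. P x j)"
proof -
  \<comment> \<open>In \<open>pr_rec\<close> the step function receives parameter, counter and
    previous value as nested pairs.\<close>
  have P': "prim_pred (\<lambda>z. P (pr1 z) (pr1 (pr2 z)))"
    using pp_comp[OF P, of "\<lambda>z. pair (pr1 z) (pr1 (pr2 z))"] by (simp add: pr_intros)
  have "prim_rec (\<lambda>x. rec_nat 1 (\<lambda>j r. if P x j then 0 else r) (n x))"
    by (intro pr_rec pr_If P' pr_const pr_snd pr_id n)
  moreover have "rec_nat 1 (\<lambda>j r. if P x j then 0 else r) k = (if \<exists>j<k. P x j then 0 else 1 :: nat)" for x k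
    by (induction k) (auto simp: less_Suc_eq)
  ultimately show ?thesis by (simp only: prim_pred_def)
qed

lemma pp_ball:
  assumes P: "prim_pred (\<lambda>z. P (pr1 z) (pr2 z))" and n: "prim_rec n"
  shows "prim_pred (\<lambda>x. \<forall>j<n x. P x j)"
  using pp_not[OF pp_bex[OF pp_not[OF P] n]] by simp

text \<open>Counting takes the place of bounded minimization: lengths, computed values and ranks are
  all written as cardinalities of bounded sets.\<close>

lemma pr_count:
  assumes P: "prim_pred (\<lambda>z. P (pr1 z) (pr2 z))" and n: "prim_rec n"
  shows "prim_rec (\<lambda>x. card {j. j < n x \<and> P x j})"
proof -
  have P': "prim_pred (\<lambda>z. P (pr1 z) (pr1 (pr2 z)))"
    using pp_comp[OF P, of "\<lambda>z. pair (pr1 z) (pr1 (pr2 z))"] by (simp add: pr_intros)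
  have "prim_rec (\<lambda>x. rec_nat 0 (\<lambda>j r. if P x j then Suc r else r) (n x))"
    by (intro pr_rec pr_If P' pr_0 pr_Suc pr_snd pr_id n)
  moreover have "rec_nat 0 (\<lambda>j r. if P x j then Suc r else r) k = card {j. j < k \<and> P x j}" for x k
  proof (induction k)
    case (Suc k)
    have "{j. j < Suc k \<and> P x j} =
        (if P x k then insert k {j. j < k \<and> P x j} else {j. j < k \<and> P x j})"
      by (auto simp: less_Suc_eq)
    with Suc show ?case by simp
  qed simp
  ultimately show ?thesis by simp
qed

text \<open>Finitely many values can be built into a program, whatever p is. This makes learners out
  of arbitrary assignments of programs to ranks.\<close>

lemma pr_finite_table: "prim_rec (\<lambda>x. if x < B then p x else 0)"
proof (induction B)
  case (Suc B)
  have "prim_rec (\<lambda>x. if x = B then p B else if x < B then p x else 0)"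
    by (intro pr_If pp_eq pr_id pr_const Suc)
  moreover have "(\<lambda>x. if x = B then p B else if x < B then p x else 0)
      = (\<lambda>x. if x < Suc B then p x else 0)" by (auto simp: less_Suc_eq)
  ultimately show ?case by simp
qed (simp add: pr_0)

subsection \<open>Coded lists\<close>

lemma rotate_code':
  "rotate_code n x = pair (list_encode (drop n (list_decode x))) (list_encode (rev (take n (list_decode x))))"
  using rotate_code[of n "list_decode x"] by simp

lemma pr_drop:
  assumes "prim_rec N" "prim_rec X"
  shows "prim_rec (\<lambda>x. list_encode (drop (N x) (list_decode (X x))))"
  using pr_fst[OF pr_rotate_code[OF assms]] by (simp add: rotate_code')

lemma pr_take:
  assumes "prim_rec N" "prim_rec X"
  shows "prim_rec (\<lambda>x. list_encode (take (N x) (list_decode (X x))))"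
  using pr_take_code[OF assms] take_code[of _ "list_decode _"] by simp

lemma list_encode_eq_0: "list_encode xs = 0 \<longleftrightarrow> xs = []"
  by (cases xs) auto

lemma pr_length:
  assumes "prim_rec X" shows "prim_rec (\<lambda>x. length (list_decode (X x)))"
proof -
  \<comment> \<open>The empty list has code 0, so the n counted are those with a nonempty remainder;
    the code itself bounds the length.\<close>
  have "prim_rec (\<lambda>x. card {n. n < X x \<and> list_encode (drop n (list_decode (X x))) \<noteq> 0})"
    by (intro pr_count pp_not pp_eq pr_drop pr_intros pr_comp[OF assms] assms)
  moreover have "{n. n < X x \<and> list_encode (drop n (list_decode (X x))) \<noteq> 0} = {..<length (list_decode (X x))}"
    for x using length_le_list_encode[of "list_decode (X x)"] by (auto simp: list_encode_eq_0)
  ultimately show ?thesis by simp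
qed

definition nth0 :: "nat list \<Rightarrow> nat \<Rightarrow> nat" where
  "nth0 xs n = (if n < length xs then xs ! n else 0)"

lemma pr_nth0:
  assumes "prim_rec N" "prim_rec X" shows "prim_rec (\<lambda>x. nth0 (list_decode (X x)) (N x))"
proof -
  \<comment> \<open>A nonempty list has the code \<open>Suc (pair head tail)\<close>, hence the
    predecessor.\<close>
  have "prim_rec (\<lambda>x. if N x < length (list_decode (X x))
      then pr1 (list_encode (drop (N x) (list_decode (X x))) - 1) else 0)"
    by (intro pr_If pp_less pr_length pr_drop pr_intros assms)
  moreover have "pr1 (list_encode (drop n xs) - 1) = xs ! n" if "n < length xs" for n xs
    using that by (simp add: Cons_nth_drop_Suc[symmetric])
  ultimately show ?thesis by (simp add: nth0_def cong: if_cong)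
qed

lemma pp_member:
  assumes "prim_rec F" "prim_rec X" shows "prim_pred (\<lambda>x. F x \<in> set (list_decode (X x)))"
proof -
  have "prim_pred (\<lambda>x. \<exists>n<length (list_decode (X x)). nth0 (list_decode (X x)) n = F x)"
    by (intro pp_bex pp_eq pr_length pr_nth0 pr_comp[OF assms(1)] pr_comp[OF assms(2)] pr_intros)
  moreover have "(\<exists>n<length xs. nth0 xs n = y) \<longleftrightarrow> y \<in> set xs" for xs y
    by (auto simp: nth0_def in_set_conv_nth)
  ultimately show ?thesis by simp
qed

lemma pr_map_upt:
  assumes f: "prim_rec (\<lambda>z. f (pr1 z) (pr2 z))" and n: "prim_rec n"
  shows "prim_rec (\<lambda>x. list_encode (map (f x) [0..<n x]))"
proof -
  have f': "prim_rec (\<lambda>z. f (pr1 z) (pr1 (pr2 z)))"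
    using pr_comp[OF f, of "\<lambda>z. pair (pr1 z) (pr1 (pr2 z))"] by (simp add: pr_intros)
  have "prim_rec (\<lambda>x. rec_nat 0 (\<lambda>k r. Suc (pair (f x k) r)) (n x))"
    by (intro pr_rec pr_0 pr_Suc pr_pair f' pr_snd pr_id n)
  moreover have *: "rec_nat 0 (\<lambda>k r. Suc (pair (f x k) r)) m = list_encode (rev (map (f x) [0..<m]))"
    for x m by (induction m) auto
  ultimately have "prim_rec (\<lambda>x. list_encode (rev (map (f x) [0..<n x])))" by simp
  \<comment> \<open>The recursion conses and yields the reversed list; rotating all of it into the
    empty list reverses it again.\<close>
  from pr_snd[OF pr_rotate_code[OF n this]] show ?thesis by (simp add: rotate_code)
qed

lemma less_list_encode: "y \<in> set xs \<Longrightarrow> y < list_encode xs"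
proof (induction xs)
  case (Cons a xs)
  then show ?case
    using le_prod_encode_1[of a "list_encode xs"] le_prod_encode_2[of "list_encode xs" a] by fastforce
qed simp

lemmas prim_intros = pr_id pr_const pr_If pr_pred pr_pair pr_fst pr_snd pr_Suc pr_add pr_diff pr_mult
  pp_not pp_conj pp_disj pp_le pp_less pp_eq pp_bex pp_ball pr_count
  pr_drop pr_take pr_length pr_nth0 pp_member pr_map_upt

section \<open>Programs that search\<close>

abbreviation seg :: "(nat \<Rightarrow> nat) \<Rightarrow> nat \<Rightarrow> nat" where
  "seg g n \<equiv> list_encode (g \<restriction> n)"

lemma init_seg_Suc: "g \<restriction> Suc n = g \<restriction> n @ [g n]"
  by (simp add: init_seg_def)

lemma length_init_seg [simp]: "length (g \<restriction> n) = n"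
  by (simp add: init_seg_def)

lemma nth_init_seg [simp]: "k < n \<Longrightarrow> (g \<restriction> n) ! k = g k"
  by (simp add: init_seg_def)

lemma take_init_seg [simp]: "take k (g \<restriction> n) = g \<restriction> min k n"
  by (simp add: init_seg_def take_map min_def)

lemma init_seg_eq_iff: "g \<restriction> n = h \<restriction> n \<longleftrightarrow> (\<forall>k<n. g k = h k)"
  by (auto simp: init_seg_def)

text \<open>Recursion conses the newest oracle value in front, hence the reversal; a is the
  parameter that \<open>CPrec\<close> carries along.\<close>

lemma rev_seg_code: "\<exists>c. \<forall>g a n. sem c g (pair a n) = Some (list_encode (rev (g \<restriction> n)))"
proof -
  let ?q = "CComp CSucc (CPair (CComp COracle (CComp CFst CSnd)) (CComp CSnd CSnd))"
  have "rec_nat (Some 0) (\<lambda>m r. Option.bind r (\<lambda>v. sem ?q g (pair a (pair m v)))) n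
      = Some (list_encode (rev (g \<restriction> n)))" for g a n
    by (induction n) (simp_all add: init_seg_Suc, simp add: init_seg_def)
  then show ?thesis by (intro exI[of _ "CPrec CZero ?q"]) simp
qed

text \<open>The s-m-n theorem with one parameter. Since s is primitive recursive, a learner can
  output programs with parameters built in.\<close>

lemma smn: "\<exists>s. prim_rec s \<and> (\<forall>k g x. sem (decode (s k)) g x = sem c g (pair k x))"
proof -
  \<comment> \<open>\<open>K k\<close> is an index of the constant k: each step composes with
    \<open>CSucc\<close>, whose index is 1, and the summand 6 marks \<open>CComp\<close> in
    \<open>encode\<close>.\<close>
  define K where "K = rec_nat 0 (\<lambda>_ r. 4 * pair 1 r + 6)"
  define s where "s k = 4 * pair (encode c) (4 * pair (K k) (encode (CPair CFst CSnd)) + 5) + 6" for k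
  have K: "prim_rec (\<lambda>k. K k)"
    unfolding K_def by (rule pr_rec) (intro prim_intros)+
  have "prim_rec s"
    unfolding s_def by (intro prim_intros pr_comp[OF K])
  moreover have dK: "sem (decode (K k)) g x = Some k" for k g x
  proof (induction k)
    case (Suc k)
    have "decode (K (Suc k)) = CComp CSucc (decode (K k))"
      using decode_rec[of 1 "pair 1 (K k)"] by (simp add: K_def add.commute decode_base(2)[unfolded One_nat_def])
    with Suc show ?case by simp
  qed (simp add: K_def decode_base)
  have "sem (decode (s k)) g x = sem c g (pair k x)" for k g x
  proof -
    have "decode (s k) = CComp c (CPair (decode (K k)) (CPair CFst CSnd))"
      using decode_rec[of 1 "pair (encode c) (4 * pair (K k) (encode (CPair CFst CSnd)) + 5)"]
        decode_rec[of 0 "pair (K k) (encode (CPair CFst CSnd))"]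
      by (simp add: s_def add.commute decode_encode del: encode.simps)
    then show ?thesis by (simp add: dK)
  qed
  ultimately show ?thesis by blast
qed

lemma Phi_eq_Some: "Phi i g = Some f \<longleftrightarrow> (\<forall>x. sem (decode i) g x = Some (f x))"
proof
  show "\<forall>x. sem (decode i) g x = Some (f x)" if "Phi i g = Some f"
    using that unfolding Phi_def by (auto split: if_splits)
qed (simp add: Phi_def)

text \<open>All concrete programs below come from this lemma: P decides from an initial segment of
  the oracle whether y is accepted as the value at x, and the program searches for a pair of n and
  y. Since accepted values are unique, the order of the search is immaterial.\<close>

lemma search_program:
  assumes P: "prim_pred (\<lambda>z. P (pr1 z) (pr1 (pr2 z)) (pr1 (pr2 (pr2 z))) (pr2 (pr2 (pr2 z))))"
  obtains s where "prim_rec s"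
    and "\<And>k g f. (\<And>x. \<exists>n y. P (seg g n) k x y) \<Longrightarrow> (\<And>x n y. P (seg g n) k x y \<Longrightarrow> y = f x) \<Longrightarrow>
      Phi (s k) g = Some f"
proof -
  obtain r where r: "\<And>g a n. sem r g (pair a n) = Some (list_encode (rev (g \<restriction> n)))"
    using rev_seg_code by blast
  \<comment> \<open>The argument t is the pair of the reversed segment with
    \<open>pair (pair k x) (pair n y)\<close>, the last component being the one that
    \<open>CMu\<close> varies; rotating restores the order of the segment.\<close>
  define f where "f t = (if P (pr2 (rotate_code (pr1 (pr2 (pr2 t))) (pr1 t))) (pr1 (pr1 (pr2 t)))
    (pr2 (pr1 (pr2 t))) (pr2 (pr2 (pr2 t))) then 0 else 1 :: nat)" for t
  have "prim_pred (\<lambda>t. P (pr2 (rotate_code (pr1 (pr2 (pr2 t))) (pr1 t))) (pr1 (pr1 (pr2 t)))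
    (pr2 (pr1 (pr2 t))) (pr2 (pr2 (pr2 t))))"
    using pp_comp[OF P, of "\<lambda>t. pair (pr2 (rotate_code (pr1 (pr2 (pr2 t))) (pr1 t)))
      (pair (pr1 (pr1 (pr2 t))) (pair (pr2 (pr1 (pr2 t))) (pr2 (pr2 (pr2 t)))))"]
      pr_rotate_code[of "\<lambda>t. pr1 (pr2 (pr2 t))" "\<lambda>t. pr1 t"]
    by (simp add: pr_intros)
  then have "prim_rec f"
    unfolding prim_pred_def f_def .
  then obtain cf where cf: "\<And>g t. sem cf g t = Some (f t)"
    unfolding prim_rec_def by blast
  define q where "q = CComp cf (CPair (CComp r (CPair CZero (CComp CFst CSnd))) (CPair CFst CSnd))"
  have q: "sem q g (pair (pair k x) (pair n y)) = Some (if P (seg g n) k x y then 0 else 1)"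
    for g k x n y
  proof -
    have "rotate_code n (list_encode (rev (g \<restriction> n))) = pair 0 (seg g n)"
      using rotate_code[of n "rev (g \<restriction> n)"] by simp
    then show ?thesis by (simp add: q_def cf r f_def)
  qed
  define c where "c = CComp CSnd (CMu q)"
  obtain s where s: "prim_rec s" "\<And>k g x. sem (decode (s k)) g x = sem c g (pair k x)"
    using smn by metis
  have "Phi (s k) g = Some f"
    if ex: "\<And>x. \<exists>n y. P (seg g n) k x y" and un: "\<And>x n y. P (seg g n) k x y \<Longrightarrow> y = f x"
    for k g f
    unfolding Phi_eq_Some
  proof
    fix x
    let ?R = "\<lambda>z. sem q g (pair (pair k x) z) = Some 0 \<and>
      (\<forall>z'<z. \<exists>v. sem q g (pair (pair k x) z') = Some (Suc v))"
    have q': "sem q g (pair (pair k x) z) = Some (if P (seg g (pr1 z)) k x (pr2 z) then 0 else 1)"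
      for z using q[of g k x "pr1 z" "pr2 z"] by simp
    obtain n y where "P (seg g n) k x y" using ex by blast
    then have "\<exists>z. P (seg g (pr1 z)) k x (pr2 z)"
      by (metis fst_conv prod_encode_inverse snd_conv)
    then have "\<exists>z. P (seg g (pr1 z)) k x (pr2 z) \<and> (\<forall>z'<z. \<not> P (seg g (pr1 z')) k x (pr2 z'))"
      by (rule exists_least_iff[THEN iffD1])
    then have R: "\<exists>z. ?R z" by (auto simp: q')
    define z where "z = (LEAST z. ?R z)"
    have "?R z" using LeastI_ex[OF R] unfolding z_def .
    then have "pr2 z = f x" by (auto simp: q' intro: un split: if_splits)
    moreover have "sem (CMu q) g (pair k x) = Some z"
      using R by (simp add: z_def Let_def)
    ultimately show "sem (decode (s k)) g x = Some (f x)" by (simp add: s c_def)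
  qed
  with s(1) show thesis by (rule that)
qed

section \<open>A universal evaluator\<close>

text \<open>\<open>claim 0 i x y\<close> stands for \<open>\<Phi>\<^sub>i(g)(x) = y\<close>, and \<open>claim 1 i x y\<close> says that \<open>\<Phi>\<^sub>i(g)(pair x z)\<close> is
  defined and nonzero for all \<open>z < y\<close>.\<close>

definition claim :: "nat \<Rightarrow> nat \<Rightarrow> nat \<Rightarrow> nat \<Rightarrow> nat" where
  "claim t i x y = pair t (pair i (pair x y))"

text \<open>The clauses of \<open>sem\<close> as inference rules. The equations for i invert
  \<open>encode\<close>; m holds the indices of the subprograms and u an intermediate value. With
  both given explicitly, an instance of a rule is checked without any search.\<close>

definition derivable :: "nat list \<Rightarrow> nat set \<Rightarrow> nat \<Rightarrow> nat \<Rightarrow> nat \<Rightarrow> nat \<Rightarrow> nat \<Rightarrow> nat \<Rightarrow> bool" where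
  "derivable \<sigma> T t i x y m u \<longleftrightarrow>
    t = 0 \<and>
     (i = 0 \<and> y = 0 \<or> i = 1 \<and> y = Suc x \<or> i = 2 \<and> y = pr1 x \<or> i = 3 \<and> y = pr2 x
      \<or> i = 4 \<and> x < length \<sigma> \<and> y = nth0 \<sigma> x
      \<or> i = 4 * m + 5 \<and> claim 0 (pr1 m) x (pr1 y) \<in> T \<and> claim 0 (pr2 m) x (pr2 y) \<in> T
      \<or> i = 4 * m + 6 \<and> claim 0 (pr2 m) x u \<in> T \<and> claim 0 (pr1 m) u y \<in> T
      \<or> i = 4 * m + 7 \<and> pr2 x = 0 \<and> claim 0 (pr1 m) (pr1 x) y \<in> T
      \<or> i = 4 * m + 7 \<and> pr2 x \<noteq> 0 \<and> claim 0 i (pair (pr1 x) (pr2 x - 1)) u \<in> T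
          \<and> claim 0 (pr2 m) (pair (pr1 x) (pair (pr2 x - 1) u)) y \<in> T
      \<or> i = 4 * m + 8 \<and> claim 1 m x y \<in> T \<and> claim 0 m (pair x y) 0 \<in> T)
    \<or> t = 1 \<and> (y = 0 \<or> claim 1 i x (y - 1) \<in> T \<and> claim 0 i (pair x (y - 1)) (Suc u) \<in> T)"

lemma derivable_mono:
  assumes "derivable \<sigma> T t i x y m u" "T \<subseteq> T'"
  shows "derivable (\<sigma> @ \<tau>) T' t i x y m u"
proof -
  have "x < length \<sigma> \<Longrightarrow> nth0 (\<sigma> @ \<tau>) x = nth0 \<sigma> x"
    by (simp add: nth0_def nth_append)
  moreover have "\<And>f. f \<in> T \<Longrightarrow> f \<in> T'" using assms(2) by blast
  ultimately show ?thesis using assms(1) unfolding derivable_def by (elim disjE conjE) simp_all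
qed

definition applicable :: "nat list \<Rightarrow> nat set \<Rightarrow> nat \<Rightarrow> bool" where
  "applicable \<sigma> T r = (let f = pr1 r in
     derivable \<sigma> T (pr1 f) (pr1 (pr2 f)) (pr1 (pr2 (pr2 f))) (pr2 (pr2 (pr2 f))) (pr1 (pr2 r)) (pr2 (pr2 r)))"

lemma applicable_pair [simp]:
  "applicable \<sigma> T (pair (claim t i x y) (pair m u)) = derivable \<sigma> T t i x y m u"
  by (simp add: applicable_def claim_def)

text \<open>Step \<open>s\<close> tries the rule instance \<open>pr2 s\<close>, so that every instance is tried infinitely often.\<close>

primrec stage :: "nat list \<Rightarrow> nat \<Rightarrow> nat list" where
  "stage \<sigma> 0 = []"
| "stage \<sigma> (Suc s) =
    (if applicable \<sigma> (set (stage \<sigma> s)) (pr2 s) then pr1 (pr2 s) # stage \<sigma> s else stage \<sigma> s)"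

lemma pp_derivable:
  assumes "prim_rec w" "prim_rec T" "prim_rec t" "prim_rec i" "prim_rec x" "prim_rec y" "prim_rec m" "prim_rec u"
  shows "prim_pred (\<lambda>z. derivable (list_decode (w z)) (set (list_decode (T z))) (t z) (i z) (x z) (y z) (m z) (u z))"
  unfolding derivable_def claim_def by (intro prim_intros assms)

lemma pr_stage:
  assumes "prim_rec w" "prim_rec n"
  shows "prim_rec (\<lambda>z. list_encode (stage (list_decode (w z)) (n z)))"
proof -
  let ?R = "\<lambda>z. rec_nat 0 (\<lambda>s T. if applicable (list_decode (w z)) (set (list_decode T)) (pr2 s)
      then Suc (pair (pr1 (pr2 s)) T) else T)"
  have "prim_rec (\<lambda>z. ?R z (n z))"
    unfolding applicable_def Let_def
    by (rule pr_rec) (intro prim_intros pp_derivable pr_comp[OF assms(1)] assms(2))+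
  moreover have "?R z k = list_encode (stage (list_decode (w z)) k)" for z k
    by (induction k) auto
  ultimately show ?thesis by simp
qed

lemma stage_mono_time: "s \<le> s' \<Longrightarrow> set (stage \<sigma> s) \<subseteq> set (stage \<sigma> s')"
  by (induction s' rule: dec_induct) auto

lemma stage_mono_oracle: "set (stage \<sigma> s) \<subseteq> set (stage (\<sigma> @ \<tau>) s)"
proof (induction s)
  case (Suc s)
  have "applicable (\<sigma> @ \<tau>) (set (stage (\<sigma> @ \<tau>) s)) r" if "applicable \<sigma> (set (stage \<sigma> s)) r" for r
    using that derivable_mono[OF _ Suc] unfolding applicable_def Let_def by blast
  with Suc show ?case by auto
qed simp

definition true_claim :: "(nat \<Rightarrow> nat) \<Rightarrow> nat \<Rightarrow> bool" where
  "true_claim g f = (let t = pr1 f; i = pr1 (pr2 f); x = pr1 (pr2 (pr2 f)); y = pr2 (pr2 (pr2 f)) in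
    (t = 0 \<longrightarrow> sem (decode i) g x = Some y) \<and>
    (t = 1 \<longrightarrow> (\<forall>z<y. \<exists>v. sem (decode i) g (pair x z) = Some (Suc v))))"

lemma true_claim_0 [simp]: "true_claim g (claim 0 i x y) \<longleftrightarrow> sem (decode i) g x = Some y"
  by (simp add: true_claim_def claim_def)

lemma true_claim_1 [simp]:
  "true_claim g (claim 1 i x y) \<longleftrightarrow> (\<forall>z<y. \<exists>v. sem (decode i) g (pair x z) = Some (Suc v))"
  "true_claim g (claim (Suc 0) i x y) \<longleftrightarrow> (\<forall>z<y. \<exists>v. sem (decode i) g (pair x z) = Some (Suc v))"
  by (simp_all add: true_claim_def claim_def)

lemma decode_cases:
  "decode (4 * m + 5) = CPair (decode (pr1 m)) (decode (pr2 m))"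
  "decode (4 * m + 6) = CComp (decode (pr1 m)) (decode (pr2 m))"
  "decode (4 * m + 7) = CPrec (decode (pr1 m)) (decode (pr2 m))"
  "decode (4 * m + 8) = CMu (decode m)"
  using decode_rec[of 0 m] decode_rec[of 1 m] decode_rec[of 2 m] decode_rec[of 3 m]
  by (simp_all add: add.commute)

lemma sem_CMu:
  assumes "sem p g (pair x y) = Some 0" "\<forall>z<y. \<exists>v. sem p g (pair x z) = Some (Suc v)"
  shows "sem (CMu p) g x = Some y"
proof -
  have "(LEAST y. sem p g (pair x y) = Some 0 \<and> (\<forall>z<y. \<exists>v. sem p g (pair x z) = Some (Suc v))) = y"
    using assms by (intro Least_equality) (auto simp: not_less[symmetric])
  with assms show ?thesis by (auto simp: Let_def)
qed

lemma derivable_sound: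
  assumes "derivable (g \<restriction> n) T t i x y m u" and T: "\<And>f. f \<in> T \<Longrightarrow> true_claim g f"
  shows "true_claim g (claim t i x y)"
proof -
  have T0: "claim 0 i x y \<in> T \<Longrightarrow> sem (decode i) g x = Some y" for i x y
    using T[of "claim 0 i x y"] by simp
  have T1: "claim 1 i x y \<in> T \<Longrightarrow> \<forall>z<y. \<exists>v. sem (decode i) g (pair x z) = Some (Suc v)" for i x y
    using T[of "claim 1 i x y"] by simp
  have *: "t = 0 \<and> P0 \<or> t = 1 \<and> P1 \<Longrightarrow> (P0 \<Longrightarrow> sem (decode i) g x = Some y) \<Longrightarrow>
     (P1 \<Longrightarrow> \<forall>z<y. \<exists>v. sem (decode i) g (pair x z) = Some (Suc v)) \<Longrightarrow> ?thesis" for P0 P1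
    by auto
  show ?thesis
  proof (rule *[OF assms(1)[unfolded derivable_def]], goal_cases)
    case 1
    then show ?case
    \<comment> \<open>The cases follow the disjuncts of \<open>derivable\<close>: 5 is the oracle, 6
      pairing, 7 composition, 8 and 9 recursion, 10 minimization.\<close>
    proof (elim disjE conjE, goal_cases)
      case 5
      then show ?case by (simp add: decode_base nth0_def)
    next
      case 6
      with T0[OF 6(2)] T0[OF 6(3)] show ?case by (simp add: decode_cases)
    next
      case 7
      with T0[OF 7(2)] T0[OF 7(3)] show ?case by (simp add: decode_cases)
    next
      case 8
      with T0[OF 8(3)] show ?case by (simp add: decode_cases case_prod_beta)
    next
      case 9
      obtain n where n: "pr2 x = Suc n" using 9(2) by (cases "pr2 x") auto
      with 9 T0[OF 9(3)] T0[OF 9(4)] show ?case by (simp add: decode_cases case_prod_beta)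
    next
      case 10
      then show ?case using sem_CMu T0[OF 10(3)] T1[OF 10(2)] by (simp only: decode_cases)
    qed (simp_all add: decode_base decode_base(2)[unfolded One_nat_def])
  next
    case 2
    then show ?case
    proof
      assume "claim 1 i x (y - 1) \<in> T \<and> claim 0 i (pair x (y - 1)) (Suc u) \<in> T"
      then have "\<forall>z<y - 1. \<exists>v. sem (decode i) g (pair x z) = Some (Suc v)"
        "sem (decode i) g (pair x (y - 1)) = Some (Suc u)"
        using T0 T1 by blast+
      then show ?thesis by (metis less_Suc_eq Suc_pred' less_nat_zero_code neq0_conv)
    qed simp
  qed
qed

lemma stage_sound: "f \<in> set (stage (g \<restriction> n) s) \<Longrightarrow> true_claim g f"
proof (induction s arbitrary: f)
  case (Suc s)
  show ?case
  proof (cases "f \<in> set (stage (g \<restriction> n) s)")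
    case False
    with Suc.prems have f: "f = pr1 (pr2 s)" "applicable (g \<restriction> n) (set (stage (g \<restriction> n) s)) (pr2 s)"
      by (auto split: if_splits)
    from derivable_sound[OF f(2)[unfolded applicable_def Let_def] Suc.IH] show ?thesis
      by (simp add: f(1) claim_def)
  qed (rule Suc.IH)
qed simp

definition derived :: "(nat \<Rightarrow> nat) \<Rightarrow> nat set" where
  "derived g = (\<Union>n. set (stage (g \<restriction> n) n))"

lemma init_seg_append: "n \<le> m \<Longrightarrow> \<exists>\<tau>. g \<restriction> m = g \<restriction> n @ \<tau>"
  by (metis append_take_drop_id min.absorb1 take_init_seg)

lemma stage_mono:
  assumes "n \<le> m" shows "set (stage (g \<restriction> n) n) \<subseteq> set (stage (g \<restriction> m) m)"
  using init_seg_append[OF assms, of g] stage_mono_time[OF assms] stage_mono_oracle by fastforce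

text \<open>An instance has finitely many premises, so they are all present at some stage, and the
  instance is tried again after that.\<close>

lemma derived_closed:
  assumes "derivable (g \<restriction> n) (derived g) t i x y m u"
  shows "claim t i x y \<in> derived g"
proof -
  \<comment> \<open>All premises that a rule can have with these parameters.\<close>
  let ?F = "derived g \<inter> {claim 0 (pr1 m) x (pr1 y), claim 0 (pr2 m) x (pr2 y), claim 0 (pr2 m) x u,
    claim 0 (pr1 m) u y, claim 0 (pr1 m) (pr1 x) y, claim 0 i (pair (pr1 x) (pr2 x - 1)) u,
    claim 0 (pr2 m) (pair (pr1 x) (pair (pr2 x - 1) u)) y, claim 1 m x y, claim 0 m (pair x y) 0,
    claim 1 i x (y - 1), claim 0 i (pair x (y - 1)) (Suc u)}"
  have "\<forall>\<^sub>F k in sequentially. \<forall>f\<in>?F. f \<in> set (stage (g \<restriction> k) k)"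
  proof (rule eventually_ball_finite)
    show "\<forall>f\<in>?F. \<forall>\<^sub>F k in sequentially. f \<in> set (stage (g \<restriction> k) k)"
      using stage_mono unfolding derived_def eventually_sequentially by blast
  qed simp
  then obtain k where F: "?F \<subseteq> set (stage (g \<restriction> k) k)"
    unfolding eventually_sequentially by blast
  have "derivable (g \<restriction> n) ?F t i x y m u"
    using assms unfolding derivable_def by (elim disjE conjE) simp_all
  from derivable_mono[OF this F, of "[]"]
  have k: "derivable (g \<restriction> n) (set (stage (g \<restriction> k) k)) t i x y m u" by simp
  define r where "r = pair (claim t i x y) (pair m u)"
  \<comment> \<open>Step s tries r; the first component makes it late enough for the oracle values
    and for the premises.\<close>
  define s where "s = pair (max n k) r"
  have s: "n \<le> s" "k \<le> s"
    using le_prod_encode_1[of "max n k" r] unfolding s_def by simp_all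
  obtain \<tau> where \<tau>: "g \<restriction> Suc s = g \<restriction> n @ \<tau>" using init_seg_append[of n "Suc s" g] s by auto
  obtain \<tau>' where \<tau>': "g \<restriction> Suc s = g \<restriction> s @ \<tau>'" using init_seg_append[of s "Suc s" g] by auto
  have "set (stage (g \<restriction> k) k) \<subseteq> set (stage (g \<restriction> Suc s) s)"
    using stage_mono[OF s(2), of g] stage_mono_oracle[of "g \<restriction> s" s \<tau>'] \<tau>' by simp
  from derivable_mono[OF k this, of \<tau>, folded \<tau>]
  have "applicable (g \<restriction> Suc s) (set (stage (g \<restriction> Suc s) s)) r"
    unfolding r_def applicable_pair .
  moreover have "pr2 s = r" "pr1 r = claim t i x y" by (simp_all add: s_def r_def)
  ultimately have "claim t i x y \<in> set (stage (g \<restriction> Suc s) (Suc s))" by simp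
  then show ?thesis unfolding derived_def by blast
qed

text \<open>Completeness of the rules, by induction on the program; recursion and minimization need
  an inner induction on the number of iterations.\<close>

lemma sem_derived: "sem c g x = Some y \<Longrightarrow> claim 0 (encode c) x y \<in> derived g"
proof (induction c arbitrary: x y)
  case (CPair p q)
  then obtain u v where "sem p g x = Some u" "sem q g x = Some v" "y = pair u v"
    by (auto simp: bind_eq_Some_conv)
  with CPair.IH show ?case
    by (intro derived_closed[of g 0 0 _ _ _ "pair (encode p) (encode q)"]) (simp add: derivable_def)
next
  case (CComp p q)
  then obtain u where "sem q g x = Some u" "sem p g u = Some y"
    by (auto simp: bind_eq_Some_conv)
  with CComp.IH show ?case
    by (intro derived_closed[of g 0 0 _ _ _ "pair (encode p) (encode q)" u]) (simp add: derivable_def)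
next
  case (CPrec p q)
  let ?m = "pair (encode p) (encode q)"
  let ?r = "\<lambda>a. rec_nat (sem p g a)
        (\<lambda>m r. Option.bind r (\<lambda>v. sem q g (pair a (pair m v))))"
  have "?r a n = Some y \<Longrightarrow> claim 0 (encode (CPrec p q)) (pair a n) y \<in> derived g" for a n y
  proof (induction n arbitrary: y)
    case 0
    then show ?case using CPrec.IH(1)
      by (intro derived_closed[of g 0 0 _ _ _ ?m]) (simp add: derivable_def)
  next
    case (Suc n)
    then obtain v where "?r a n = Some v" "sem q g (pair a (pair n v)) = Some y"
      by (auto simp: bind_eq_Some_conv)
    with Suc.IH CPrec.IH(2) show ?case
      by (intro derived_closed[of g 0 0 _ _ _ ?m v]) (simp add: derivable_def)
  qed
  from this[of "pr1 x" "pr2 x" y] CPrec.prems show ?case by (simp add: case_prod_beta)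
next
  case (CMu p)
  let ?P = "\<lambda>y. sem p g (pair x y) = Some 0 \<and> (\<forall>z<y. \<exists>v. sem p g (pair x z) = Some (Suc v))"
  have ex: "\<exists>y. ?P y" and y: "(LEAST y. ?P y) = y"
    using CMu.prems by (auto simp: Let_def split: if_splits)
  have P: "?P y" using LeastI_ex[OF ex] unfolding y .
  \<comment> \<open>The claims of kind 1 accumulate one z at a time until the search stops at
    y.\<close>
  have "z \<le> y \<Longrightarrow> claim 1 (encode p) x z \<in> derived g" for z
  proof (induction z)
    case 0
    show ?case by (intro derived_closed[of g 0]) (simp add: derivable_def)
  next
    case (Suc z)
    then obtain v where "sem p g (pair x z) = Some (Suc v)"
      using P Suc_le_lessD[OF Suc.prems] by blast
    with Suc CMu.IH show ?case
      by (intro derived_closed[of g 0 1 _ _ _ _ v]) (simp add: derivable_def)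
  qed
  with P CMu.IH show ?case
    by (intro derived_closed[of g 0 0 _ _ _ "encode p"]) (simp add: derivable_def)
next
  case COracle
  then show ?case by (intro derived_closed[of g "Suc x"]) (simp add: derivable_def nth0_def)
qed (intro derived_closed[of g 0], simp add: derivable_def)+

text \<open>Completeness speaks of \<open>encode c\<close>, while learners output arbitrary numbers;
  every number is the index of a program.\<close>

lemma encode_decode: "encode (decode i) = i"
proof (induction i rule: less_induct)
  case (less i)
  show ?case
  proof (cases "i < 5")
    case True
    then have "i = 0 \<or> i = 1 \<or> i = 2 \<or> i = 3 \<or> i = 4" by linarith
    then show ?thesis by (elim disjE) (simp_all only: decode_base encode.simps)
  next
    case False
    define m where "m = (i - 5) div 4"
    have m: "m < i" "pr1 m < i" "pr2 m < i"
      using False prod_decode_le[of m] unfolding m_def by linarith+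
    have "(i - 5) mod 4 < 4" by simp
    then have "i = 4 * m + 5 \<or> i = 4 * m + 6 \<or> i = 4 * m + 7 \<or> i = 4 * m + 8"
      using False unfolding m_def by linarith
    then show ?thesis
      by (elim disjE) (simp_all only: decode_cases encode.simps less.IH[OF m(1)] less.IH[OF m(2)]
          less.IH[OF m(3)] prod.collapse prod_decode_inverse)
  qed
qed

text \<open>The length of \<sigma> bounds both the use of the oracle and the number of steps, so
  that evaluation is primitive recursive and monotone in the segment.\<close>

definition evaluates :: "nat list \<Rightarrow> nat \<Rightarrow> nat \<Rightarrow> nat \<Rightarrow> bool" where
  "evaluates \<sigma> i x y \<longleftrightarrow> claim 0 i x y \<in> set (stage \<sigma> (length \<sigma>))"

lemma evaluates_sound: "evaluates (g \<restriction> n) i x y \<Longrightarrow> sem (decode i) g x = Some y"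
  unfolding evaluates_def using stage_sound by fastforce

lemma evaluates_mono: "evaluates (g \<restriction> n) i x y \<Longrightarrow> n \<le> m \<Longrightarrow> evaluates (g \<restriction> m) i x y"
  unfolding evaluates_def using stage_mono by fastforce

lemma evaluates_complete: "sem (decode i) g x = Some y \<Longrightarrow> \<exists>n. evaluates (g \<restriction> n) i x y"
  using sem_derived[of "decode i" g x y] by (auto simp: evaluates_def derived_def encode_decode)

text \<open>The use principle: a value is derived from some initial segment of the oracle, hence
  equally for every oracle that extends it.\<close>

lemma sem_use:
  assumes "sem (decode i) g x = Some y"
  shows "\<exists>n. \<forall>h. h \<restriction> n = g \<restriction> n \<longrightarrow> sem (decode i) h x = Some y"
  using evaluates_complete[OF assms] evaluates_sound by metis

lemma pp_evaluates:
  assumes "prim_rec w" "prim_rec i" "prim_rec x" "prim_rec y"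
  shows "prim_pred (\<lambda>z. evaluates (list_decode (w z)) (i z) (x z) (y z))"
proof -
  have "prim_pred (\<lambda>z. claim 0 (i z) (x z) (y z) \<in>
      set (list_decode (list_encode (stage (list_decode (w z)) (length (list_decode (w z)))))))"
    unfolding claim_def by (intro pp_member pr_stage prim_intros assms)
  then show ?thesis by (simp add: evaluates_def)
qed

section \<open>Composition of functionals and of learners\<close>

text \<open>The code of the list of derived claims exceeds every value occurring in them and thus
  serves as a bound for searching values.\<close>

definition stage_bound :: "nat \<Rightarrow> nat" where
  "stage_bound w = list_encode (stage (list_decode w) (length (list_decode w)))"

lemma evaluates_less_bound: "evaluates (list_decode w) i x y \<Longrightarrow> y < stage_bound w"
proof -
  assume "evaluates (list_decode w) i x y"
  then have "claim 0 i x y < stage_bound w"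
    unfolding evaluates_def stage_bound_def by (rule less_list_encode)
  moreover have "y \<le> claim 0 i x y"
    unfolding claim_def by (meson le_prod_encode_2 order_trans)
  ultimately show ?thesis by simp
qed

text \<open>Minimization by counting: if there is a value, then the numbers counted are those below
  the least one.\<close>

definition out_val :: "nat \<Rightarrow> nat \<Rightarrow> nat \<Rightarrow> nat" where
  "out_val w i x = card {y. y < stage_bound w \<and> (\<forall>y'<Suc y. \<not> evaluates (list_decode w) i x y')}"

definition out_len :: "nat \<Rightarrow> nat \<Rightarrow> nat" where
  "out_len w i = card {k. k < length (list_decode w) \<and>
     (\<forall>x<Suc k. \<exists>y<stage_bound w. evaluates (list_decode w) i x y)}"

text \<open>The initial segment of \<open>\<Phi>\<^sub>i(g)\<close> that is computed from the initial segment of \<open>g\<close> coded by \<open>w\<close>.\<close>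

definition out :: "nat \<Rightarrow> nat \<Rightarrow> nat" where
  "out w i = list_encode (map (out_val w i) [0..<out_len w i])"

lemma pr_stage_bound: "prim_rec w \<Longrightarrow> prim_rec (\<lambda>z. stage_bound (w z))"
  unfolding stage_bound_def by (intro pr_stage prim_intros)

lemma pr_out:
  assumes "prim_rec w" "prim_rec i" shows "prim_rec (\<lambda>z. out (w z) (i z))"
proof -
  have "prim_rec (\<lambda>z. out (pr1 z) (pr2 z))"
    unfolding out_def out_val_def out_len_def
    by (intro prim_intros pp_evaluates pr_stage_bound)
  from pr_comp[OF this pr_pair[OF assms]] show ?thesis by simp
qed

text \<open>Even if \<open>Phi i g\<close> is undefined, the outputs for fixed i are growing
  segments of a single total F. This controls what the outer learner reads under a wrong inner
  hypothesis.\<close>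

lemma out_seg:
  obtains F L where "mono L" and "\<And>n. out (seg g n) i = seg F (L n)"
    and "\<And>h. Phi i g = Some h \<Longrightarrow> F = h \<and> (\<forall>N. \<exists>n. N \<le> L n)"
proof -
  define D where "D n x \<longleftrightarrow> (\<exists>y. evaluates (g \<restriction> n) i x y)" for n x
  \<comment> \<open>Where the program diverges F has an arbitrary value; L never passes the first
    such place.\<close>
  define F where "F x = the (sem (decode i) g x)" for x
  define S where "S n = {k. k < n \<and> (\<forall>x<Suc k. D n x)}" for n
  define L where "L n = card (S n)" for n
  have D_mono: "D n x \<Longrightarrow> n \<le> m \<Longrightarrow> D m x" for n m x
    unfolding D_def using evaluates_mono by blast
  have fin: "finite (S n)" for n unfolding S_def by simp
  have S: "S n = {..<L n}" for n
  proof -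
    have down: "k' \<in> S n" if "k \<in> S n" "k' \<le> k" for k k' using that by (auto simp: S_def)
    have "\<exists>N. S n = {..<N}"
    proof (cases "S n = {}")
      case False
      then have "Max (S n) \<in> S n" using fin by simp
      then have "x \<in> S n \<longleftrightarrow> x < Suc (Max (S n))" for x
        using down[of "Max (S n)" x] Max_ge[OF fin, of x n] unfolding less_Suc_eq_le by blast
      then have "S n = {..<Suc (Max (S n))}" by blast
      then show ?thesis by blast
    qed (auto intro: exI[of _ 0])
    then obtain N where "S n = {..<N}" by blast
    then show ?thesis by (simp add: L_def)
  qed
  have less_bound: "evaluates (g \<restriction> n) i x y \<Longrightarrow> y < stage_bound (seg g n)" for n x y
    using evaluates_less_bound[of "seg g n" i x y] by simp
  then have bound: "(\<exists>y<stage_bound (seg g n). evaluates (g \<restriction> n) i x y) \<longleftrightarrow> D n x" for n x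
    unfolding D_def by blast
  have len: "out_len (seg g n) i = L n" for n
    by (simp add: out_len_def L_def S_def bound)
  have val: "out_val (seg g n) i x = F x" if D: "D n x" for n x
  proof -
    obtain y where y: "evaluates (g \<restriction> n) i x y" using D unfolding D_def by blast
    have y': "evaluates (g \<restriction> n) i x y' \<longleftrightarrow> y' = y" for y'
      using y evaluates_sound[OF y] evaluates_sound[of g n i x y'] by auto
    have "z < stage_bound (seg g n) \<and> (\<forall>y'<Suc z. y' \<noteq> y) \<longleftrightarrow> z < y" for z
      using less_bound[OF y] by (metis less_Suc_eq less_trans not_less_eq)
    then have "{z. z < stage_bound (seg g n) \<and> (\<forall>y'<Suc z. \<not> evaluates (g \<restriction> n) i x y')} = {..<y}"
      unfolding y' by blast
    then show ?thesis
      using evaluates_sound[OF y] by (simp add: out_val_def F_def)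
  qed
  have "mono L"
  proof (rule monoI)
    fix n m :: nat assume "n \<le> m"
    then have "S n \<subseteq> S m" unfolding S_def using D_mono[of n _ m] by auto
    then show "L n \<le> L m" unfolding L_def by (rule card_mono[OF fin])
  qed
  moreover have "out (seg g n) i = seg F (L n)" for n
  proof -
    have "D n x" if "x < L n" for x
    proof -
      from that have "x \<in> S n" by (simp add: S)
      then show ?thesis unfolding S_def by blast
    qed
    then have "map (out_val (seg g n) i) [0..<L n] = map F [0..<L n]"
      by (auto simp: val)
    then show ?thesis by (simp only: out_def len init_seg_def[of F])
  qed
  moreover have "F = h \<and> (\<forall>N. \<exists>n. N \<le> L n)" if "Phi i g = Some h" for h
  proof
    have h: "sem (decode i) g x = Some (h x)" for x using that by (simp add: Phi_eq_Some)
    then show "F = h" by (auto simp: F_def)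
    show "\<forall>N. \<exists>n. N \<le> L n"
    proof
      fix N
      have "\<forall>\<^sub>F n in sequentially. \<forall>x\<in>{..<N}. D n x"
      proof (intro eventually_ball_finite ballI)
        fix x
        obtain n where "D n x" using evaluates_complete[OF h[of x]] unfolding D_def by blast
        then show "\<forall>\<^sub>F n in sequentially. D n x"
          unfolding eventually_sequentially using D_mono[of n x] by blast
      qed simp
      then have "\<forall>\<^sub>F n in sequentially. N \<le> L n"
        using eventually_ge_at_top[of N]
      proof eventually_elim
        case (elim n)
        then have "{..<N} \<subseteq> S n" by (auto simp: S_def)
        then show ?case by (simp add: S)
      qed
      then show "\<exists>n. N \<le> L n" unfolding eventually_sequentially by blast
    qed
  qed
  ultimately show thesis by (rule that)
qed

lemma out_seg_total:
  assumes "Phi i g = Some h"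
  obtains L where "mono L" and "\<And>n. out (seg g n) i = seg h (L n)" and "\<And>N. \<exists>n. N \<le> L n"
proof (rule out_seg[of g i])
  fix F L
  assume *: "mono L" "\<And>n. out (seg g n) i = seg F (L n)"
    "\<And>h. Phi i g = Some h \<Longrightarrow> F = h \<and> (\<forall>N. \<exists>n. N \<le> L n)"
  from *(3)[OF assms] *(1,2) that show thesis by blast
qed

text \<open>The program waits until the part of \<open>Phi j g\<close> computed so far is long
  enough for i to evaluate at x.\<close>

lemma comp_index:
  obtains c where "prim_rec c"
    and "\<And>i j g h f. Phi j g = Some h \<Longrightarrow> Phi i h = Some f \<Longrightarrow> Phi (c (pair i j)) g = Some f"
proof (rule search_program[of "\<lambda>w k x y. evaluates (list_decode (out w (pr2 k))) (pr1 k) x y"])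
  fix c
  assume c: "prim_rec c"
    "\<And>k g f. (\<And>x. \<exists>n y. evaluates (list_decode (out (seg g n) (pr2 k))) (pr1 k) x y) \<Longrightarrow>
      (\<And>x n y. evaluates (list_decode (out (seg g n) (pr2 k))) (pr1 k) x y \<Longrightarrow> y = f x) \<Longrightarrow>
      Phi (c k) g = Some f"
  have "Phi (c (pair i j)) g = Some f" if h: "Phi j g = Some h" and f: "Phi i h = Some f"
    for i j g h f
  proof (rule c(2))
    obtain L where L: "\<And>n. out (seg g n) j = seg h (L n)" "\<And>N. \<exists>n. N \<le> L n"
      using out_seg_total[OF h] by blast
    have f: "sem (decode i) h x = Some (f x)" for x using f by (simp add: Phi_eq_Some)
    show "\<exists>n y. evaluates (list_decode (out (seg g n) (pr2 (pair i j)))) (pr1 (pair i j)) x y" for x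
    proof -
      obtain N where "evaluates (h \<restriction> N) i x (f x)" using evaluates_complete[OF f] by blast
      moreover obtain n where "N \<le> L n" using L(2) by blast
      ultimately have "evaluates (h \<restriction> L n) i x (f x)" by (rule evaluates_mono)
      then show ?thesis by (auto simp: L(1))
    qed
    show "y = f x"
      if "evaluates (list_decode (out (seg g n) (pr2 (pair i j)))) (pr1 (pair i j)) x y" for x n y
      using evaluates_sound[of h "L n" i x y] f that by (simp add: L(1))
  qed
  with c(1) show thesis by (rule that)
qed (intro pp_evaluates pr_out prim_intros)

section \<open>Programs for constant functions, the identity and \<open>bump\<close>\<close>

lemma Phi_const: obtains c where "prim_rec c" and "\<And>k g. Phi (c k) g = Some (\<lambda>_. k)"
proof (rule search_program[of "\<lambda>w k x y. y = k"])
  fix s :: "nat \<Rightarrow> nat" assume s: "prim_rec s" "\<And>k g f. (\<And>x. \<exists>n y. y = k) \<Longrightarrow> (\<And>x n y. y = k \<Longrightarrow> y = f x) \<Longrightarrow> Phi (s k) g = Some f"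
  have "Phi (s k) g = Some (\<lambda>_. k)" for k g by (rule s(2)) auto
  with s(1) show thesis by (rule that)
qed (intro prim_intros)

lemma Phi_id: obtains i where "\<And>g. Phi i g = Some g"
proof (rule search_program[of "\<lambda>w k x y. x < length (list_decode w) \<and> y = nth0 (list_decode w) x"])
  fix s :: "nat \<Rightarrow> nat" assume s: "\<And>k g f. (\<And>x. \<exists>n y. x < length (list_decode (seg g n)) \<and> y = nth0 (list_decode (seg g n)) x) \<Longrightarrow>
      (\<And>x n y. x < length (list_decode (seg g n)) \<and> y = nth0 (list_decode (seg g n)) x \<Longrightarrow> y = f x) \<Longrightarrow>
      Phi (s k) g = Some f"
  have "Phi (s 0) g = Some g" for g
    by (rule s) (auto simp: nth0_def)
  then show thesis by (rule that)
qed (intro prim_intros)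

definition bump :: "(nat \<Rightarrow> nat) \<Rightarrow> nat \<Rightarrow> nat" where
  "bump g = g(0 := Suc (g 0))"

lemma Phi_bump: obtains i where "\<And>g. Phi i g = Some (bump g)"
proof (rule search_program[of "\<lambda>w k x y. x < length (list_decode w) \<and>
    y = nth0 (list_decode w) x + (if x = 0 then 1 else 0)"])
  fix s :: "nat \<Rightarrow> nat" assume s: "\<And>k g f. (\<And>x. \<exists>n y. x < length (list_decode (seg g n)) \<and>
      y = nth0 (list_decode (seg g n)) x + (if x = 0 then 1 else 0)) \<Longrightarrow>
      (\<And>x n y. x < length (list_decode (seg g n)) \<and>
        y = nth0 (list_decode (seg g n)) x + (if x = 0 then 1 else 0) \<Longrightarrow> y = f x) \<Longrightarrow>
      Phi (s k) g = Some f"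
  have "Phi (s 0) g = Some (bump g)" for g
    by (rule s) (auto simp: nth0_def bump_def)
  then show thesis by (rule that)
qed (intro prim_intros)

section \<open>Learners as primitive recursive functions, their limits and their composition\<close>

lemma Psi_prim_rec: obtains l where "prim_rec l" and "\<And>\<sigma>. Psi e \<sigma> = l (list_encode \<sigma>)"
proof (cases "primitive (decode e)")
  case True
  have "sem (decode e) g x = sem (decode e) (\<lambda>_. 0) x" for g x
  proof -
    \<comment> \<open>By definition primitive programs do not contain
      \<open>COracle\<close>.\<close>
    have "primitive c \<Longrightarrow> sem c g = sem c (\<lambda>_. 0)" for c
      by (induction c) (auto intro!: ext)
    with True show ?thesis by simp
  qed
  then have "sem (decode e) g x = Some (the (sem (decode e) (\<lambda>_. 0) x))" for g x
    using primitive_total[OF True, of "\<lambda>_. 0" x] by (metis option.sel)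
  with True have "prim_rec (\<lambda>x. the (sem (decode e) (\<lambda>_. 0) x))"
    unfolding prim_rec_def by blast
  then show thesis by (rule that) (simp add: Psi_def True)
next
  case False
  then show thesis using that[of "\<lambda>_. 0"] pr_0 by (simp add: Psi_def)
qed

lemma prim_rec_Psi:
  assumes "prim_rec l" obtains e where "\<And>\<sigma>. Psi e \<sigma> = l (list_encode \<sigma>)"
proof -
  obtain d where "primitive d" "\<And>g x. sem d g x = Some (l x)"
    using assms unfolding prim_rec_def by blast
  then show thesis by (intro that[of "encode d"]) (simp add: Psi_def decode_encode)
qed

definition settles :: "nat \<Rightarrow> (nat \<Rightarrow> nat) \<Rightarrow> nat \<Rightarrow> bool" where
  "settles e g i \<longleftrightarrow> (\<forall>\<^sub>F n in sequentially. Psi e (g \<restriction> n) = i)"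

lemma settles_unique: "settles e g i \<Longrightarrow> settles e g j \<Longrightarrow> i = j"
  unfolding settles_def eventually_sequentially by (metis nat_le_linear)

text \<open>Convergence in the discrete topology of the naturals is eventual constancy.\<close>

lemma settles_iff: "convergent (\<lambda>n. Psi e (g \<restriction> n)) \<and> lim (\<lambda>n. Psi e (g \<restriction> n)) = i \<longleftrightarrow> settles e g i"
  unfolding settles_def tendsto_discrete[symmetric]
  by (metis convergentI convergent_LIMSEQ_iff limI)

text \<open>Only limits are concerned here: once the inner hypothesis is final, the outer learner
  reads longer and longer segments of h, and whatever it said before is forgotten.\<close>

lemma compose_learners:
  obtains e where "\<And>g h f i j. settles e0 g j \<Longrightarrow> Phi j g = Some h \<Longrightarrow> settles e1 h i \<Longrightarrow>
    Phi i h = Some f \<Longrightarrow> \<exists>k. settles e g k \<and> Phi k g = Some f"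
proof -
  obtain l0 where l0: "prim_rec l0" "\<And>\<sigma>. Psi e0 \<sigma> = l0 (list_encode \<sigma>)"
    by (rule Psi_prim_rec[of e0]) blast
  obtain l1 where l1: "prim_rec l1" "\<And>\<sigma>. Psi e1 \<sigma> = l1 (list_encode \<sigma>)"
    by (rule Psi_prim_rec[of e1]) blast
  obtain c where c: "prim_rec c"
      "\<And>i j g h f. Phi j g = Some h \<Longrightarrow> Phi i h = Some f \<Longrightarrow> Phi (c (pair i j)) g = Some f"
    by (rule comp_index) blast
  have "prim_rec (\<lambda>w. c (pair (l1 (out w (l0 w))) (l0 w)))"
    by (intro pr_comp[OF c(1)] pr_comp[OF l1(1)] pr_comp[OF l0(1)] pr_out prim_intros)
  then obtain e where e: "\<And>\<sigma>. Psi e \<sigma> =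
      c (pair (l1 (out (list_encode \<sigma>) (l0 (list_encode \<sigma>)))) (l0 (list_encode \<sigma>)))"
    by (rule prim_rec_Psi) blast
  have "\<exists>k. settles e g k \<and> Phi k g = Some f"
    if j: "settles e0 g j" "Phi j g = Some h" and i: "settles e1 h i" "Phi i h = Some f" for g h f i j
  proof (intro exI conjI)
    obtain L where L: "mono L" "\<And>n. out (seg g n) j = seg h (L n)" "\<And>N. \<exists>n. N \<le> L n"
      using out_seg_total[OF j(2)] by blast
    obtain N where N: "\<And>n. N \<le> n \<Longrightarrow> Psi e1 (h \<restriction> n) = i"
      using i(1) unfolding settles_def eventually_sequentially by blast
    obtain M where "N \<le> L M" using L(3) by blast
    then have "\<forall>\<^sub>F n in sequentially. N \<le> L n"
      using monoD[OF L(1)] unfolding eventually_sequentially by (meson order_trans)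
    with j(1) show "settles e g (c (pair i j))" unfolding settles_def
    proof eventually_elim
      case (elim n)
      with N[of "L n"] show ?case by (simp add: e l0(2)[symmetric] L(2) l1(2))
    qed
    show "Phi (c (pair i j)) g = Some f" by (rule c(2)[OF j(2) i(2)])
  qed
  then show thesis by (rule that)
qed

section \<open>Learnability\<close>

definition learns :: "enat \<Rightarrow> enat \<Rightarrow> nat \<Rightarrow> ((nat \<Rightarrow> nat) \<rightharpoonup> (nat \<Rightarrow> nat)) \<Rightarrow> (nat \<Rightarrow> nat) \<Rightarrow> bool" where
  "learns b c e \<Gamma> g \<longleftrightarrow> (\<exists>i. settles e g i \<and> Phi i g = \<Gamma> g) \<and>
     ecard (mcl (Psi e) g) < b \<and> ecard (indx (Psi e) g) \<le> c"

lemma learnable_iff: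
  "learnable a b c \<Gamma> \<longleftrightarrow> (\<exists>I. ecard I = a \<and> (\<forall>g\<in>dom \<Gamma>. \<exists>e\<in>I. learns b c e \<Gamma> g))"
proof -
  have "learns b c e \<Gamma> g \<longleftrightarrow> convergent (\<lambda>n. Psi e (g \<restriction> n)) \<and>
      Phi (lim (\<lambda>n. Psi e (g \<restriction> n))) g = \<Gamma> g \<and>
      ecard (mcl (Psi e) g) < b \<and> ecard (indx (Psi e) g) \<le> c" for e g
    unfolding learns_def settles_iff[symmetric] by auto
  then show ?thesis by (simp add: learnable_def)
qed

lemma ecard_image_le: "ecard (f ` A) \<le> ecard A"
  by (auto simp: ecard_def card_image_le)

lemma ecard_mono: "A \<subseteq> B \<Longrightarrow> ecard A \<le> ecard B"
  by (auto simp: ecard_def card_mono dest: finite_subset)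

text \<open>The definition asks for exactly a learners; a smaller set is padded with arbitrary
  ones.\<close>

lemma learnableI:
  assumes "ecard I \<le> a" "\<And>g. g \<in> dom \<Gamma> \<Longrightarrow> \<exists>e\<in>I. learns b c e \<Gamma> g"
  shows "learnable a b c \<Gamma>"
proof -
  have "\<exists>J. I \<subseteq> J \<and> ecard J = a"
  proof (cases a)
    case (enat n)
    with assms(1) have I: "finite I" "card I \<le> n" by (auto simp: ecard_def split: if_splits)
    then obtain K where K: "finite K" "card K = n - card I" "K \<subseteq> UNIV - I"
      using infinite_arbitrarily_large[of "UNIV - I" "n - card I"] by auto
    then have "card (I \<union> K) = n" using I by (subst card_Un_disjoint) auto
    then show ?thesis using I K enat by (intro exI[of _ "I \<union> K"]) (simp add: ecard_def)
  qed (auto simp: ecard_def intro: exI[of _ UNIV])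
  with assms(2) show ?thesis unfolding learnable_iff by blast
qed

lemma learns_mono: "learns b c e \<Gamma> g \<Longrightarrow> b \<le> b' \<Longrightarrow> c \<le> c' \<Longrightarrow> learns b' c' e \<Gamma> g"
  unfolding learns_def by (meson order_trans order_less_le_trans)

lemma learnable_mono:
  assumes "learnable a b c \<Gamma>" "a \<le> a'" "b \<le> b'" "c \<le> c'" shows "learnable a' b' c' \<Gamma>"
proof -
  from assms(1) obtain I where I: "ecard I = a" "\<forall>g\<in>dom \<Gamma>. \<exists>e\<in>I. learns b c e \<Gamma> g"
    unfolding learnable_iff by blast
  show ?thesis
  proof (rule learnableI)
    show "ecard I \<le> a'" using I(1) assms(2) by simp
    show "\<exists>e\<in>I. learns b' c' e \<Gamma> g" if "g \<in> dom \<Gamma>" for g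
      using I(2) that learns_mono[OF _ assms(3,4)] by blast
  qed
qed

lemma settles_finite:
  assumes "settles e g i" shows "finite (mcl (Psi e) g)" "finite (indx (Psi e) g)"
proof -
  obtain N where N: "\<And>n. N \<le> n \<Longrightarrow> Psi e (g \<restriction> n) = i"
    using assms unfolding settles_def eventually_sequentially by blast
  have "mcl (Psi e) g \<subseteq> {..<N}"
    using N unfolding mcl_def by (auto simp: not_le[symmetric])
  then show "finite (mcl (Psi e) g)" by (rule finite_subset) simp
  have "indx (Psi e) g \<subseteq> insert i ((\<lambda>n. Psi e (g \<restriction> n)) ` {..<N})"
  proof
    fix x assume "x \<in> indx (Psi e) g"
    then obtain n where "x = Psi e (g \<restriction> n)" unfolding indx_def by blast
    then show "x \<in> insert i ((\<lambda>n. Psi e (g \<restriction> n)) ` {..<N})"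
      using N[of n] by (cases "N \<le> n") auto
  qed
  then show "finite (indx (Psi e) g)" by (rule finite_subset) simp
qed

lemma learns_limit: "learns \<infinity> \<infinity> e \<Gamma> g \<longleftrightarrow> (\<exists>i. settles e g i \<and> Phi i g = \<Gamma> g)"
  unfolding learns_def using settles_finite by (auto simp: ecard_def)

lemma learns_imp_limit: "learns b c e \<Gamma> g \<Longrightarrow> \<exists>i. settles e g i \<and> Phi i g = \<Gamma> g"
  unfolding learns_def by blast

text \<open>Every hypothesis other than the first one enters with a mind change.\<close>

lemma indx_le_mcl:
  assumes "finite (mcl \<Psi> g)" shows "finite (indx \<Psi> g) \<and> card (indx \<Psi> g) \<le> Suc (card (mcl \<Psi> g))"
proof -
  let ?A = "insert (\<Psi> []) ((\<lambda>n. \<Psi> (g \<restriction> (n + 1))) ` mcl \<Psi> g)"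
  have "\<Psi> (g \<restriction> n) \<in> ?A" for n
  proof (induction n)
    case (Suc n)
    show ?case by (cases "n \<in> mcl \<Psi> g") (use Suc in \<open>auto simp: mcl_def\<close>)
  qed (simp add: init_seg_def)
  then have "indx \<Psi> g \<subseteq> ?A" unfolding indx_def by blast
  moreover have "finite ?A" using assms by simp
  moreover have "card ?A \<le> Suc (card (mcl \<Psi> g))"
    using card_image_le[OF assms, of "\<lambda>n. \<Psi> (g \<restriction> (n + 1))"] assms by (simp add: card_insert_if)
  ultimately show ?thesis by (meson card_mono finite_subset order_trans)
qed

text \<open>The bound on mind changes is strict and the one on hypotheses is not, which absorbs the
  additional first hypothesis.\<close>

lemma learns_changes_indices: "learns (enat b) c e \<Gamma> g \<Longrightarrow> learns (enat b) (enat b) e \<Gamma> g"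
  unfolding learns_def using indx_le_mcl[of "Psi e" g] by (auto simp: ecard_def split: if_splits)

section \<open>Learners that never change their mind, and learners without bounds\<close>

lemma no_changes:
  assumes "ecard (mcl \<Psi> g) < 1 \<or> ecard (indx \<Psi> g) \<le> 1" shows "\<Psi> (g \<restriction> n) = \<Psi> []"
proof -
  have "mcl \<Psi> g = {}"
    using assms
  proof
    assume "ecard (mcl \<Psi> g) < 1"
    then show ?thesis by (auto simp: ecard_def one_enat_def split: if_splits)
  next
    assume "ecard (indx \<Psi> g) \<le> 1"
    then have "finite (indx \<Psi> g)" "card (indx \<Psi> g) \<le> Suc 0"
      by (auto simp: ecard_def one_enat_def split: if_splits)
    then have "x = y" if "x \<in> indx \<Psi> g" "y \<in> indx \<Psi> g" for x y
      using that by (meson card_le_Suc0_iff_eq)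
    then show ?thesis unfolding mcl_def indx_def by blast
  qed
  then have "\<Psi> (g \<restriction> Suc n) = \<Psi> (g \<restriction> n)" for n unfolding mcl_def by auto
  then show ?thesis by (induction n) (auto simp: init_seg_def)
qed

lemma constant_learner:
  obtains e where "\<And>\<sigma>. Psi e \<sigma> = i"
  using prim_rec_Psi[OF pr_const[of i]] by blast

lemma learns_constant:
  assumes "\<And>\<sigma>. Psi e \<sigma> = i" "Phi i g = \<Gamma> g" shows "learns 1 1 e \<Gamma> g"
  unfolding learns_def settles_def mcl_def indx_def using assms by (auto simp: ecard_def one_enat_def)

text \<open>Such a learner amounts to its first hypothesis \<open>Psi e []\<close>, so sets of
  learners turn into sets of programs.\<close>

lemma learnable_constant_iff:
  assumes "b = 1 \<and> 1 \<le> c \<or> c = 1 \<and> 1 \<le> b"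
  shows "learnable a b c \<Gamma> \<longleftrightarrow> (\<exists>J. ecard J \<le> a \<and> (\<forall>g\<in>dom \<Gamma>. \<exists>i\<in>J. Phi i g = \<Gamma> g))"
proof
  assume "learnable a b c \<Gamma>"
  then obtain I where I: "ecard I = a" "\<forall>g\<in>dom \<Gamma>. \<exists>e\<in>I. learns b c e \<Gamma> g"
    unfolding learnable_iff by blast
  have "Phi (Psi e []) g = \<Gamma> g" if e: "learns b c e \<Gamma> g" for e g
  proof -
    obtain i where i: "settles e g i" "Phi i g = \<Gamma> g" using e unfolding learns_def by blast
    have "Psi e (g \<restriction> n) = Psi e []" for n
      using e assms unfolding learns_def by (intro no_changes) auto
    then have "i = Psi e []" using i(1) unfolding settles_def by simp
    with i show ?thesis by simp
  qed
  then have "\<forall>g\<in>dom \<Gamma>. \<exists>i\<in>(\<lambda>e. Psi e []) ` I. Phi i g = \<Gamma> g" using I(2) by blast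
  moreover have "ecard ((\<lambda>e. Psi e []) ` I) \<le> a" using ecard_image_le I(1) by metis
  ultimately show "\<exists>J. ecard J \<le> a \<and> (\<forall>g\<in>dom \<Gamma>. \<exists>i\<in>J. Phi i g = \<Gamma> g)" by blast
next
  assume "\<exists>J. ecard J \<le> a \<and> (\<forall>g\<in>dom \<Gamma>. \<exists>i\<in>J. Phi i g = \<Gamma> g)"
  then obtain J where J: "ecard J \<le> a" "\<forall>g\<in>dom \<Gamma>. \<exists>i\<in>J. Phi i g = \<Gamma> g" by blast
  have "\<exists>e. \<forall>\<sigma>. Psi e \<sigma> = i" for i using constant_learner[of i] by blast
  then obtain k where k: "\<And>i \<sigma>. Psi (k i) \<sigma> = i" by metis
  show "learnable a b c \<Gamma>"
  proof (rule learnableI)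
    show "ecard (k ` J) \<le> a" using ecard_image_le J(1) order_trans by blast
    fix g assume "g \<in> dom \<Gamma>"
    then obtain i where "i \<in> J" "Phi i g = \<Gamma> g" using J(2) by blast
    with learns_constant[of "k i" i g \<Gamma>] k have "learns 1 1 (k i) \<Gamma> g" by blast
    then have "learns b c (k i) \<Gamma> g" using assms by (auto intro: learns_mono)
    with \<open>i \<in> J\<close> show "\<exists>e\<in>k ` J. learns b c e \<Gamma> g" by blast
  qed
qed

lemma learnable_limit_iff:
  "learnable a \<infinity> \<infinity> \<Gamma> \<longleftrightarrow>
    (\<exists>I. ecard I \<le> a \<and> (\<forall>g\<in>dom \<Gamma>. \<exists>e\<in>I. \<exists>i. settles e g i \<and> Phi i g = \<Gamma> g))"
proof
  assume "learnable a \<infinity> \<infinity> \<Gamma>"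
  then show "\<exists>I. ecard I \<le> a \<and> (\<forall>g\<in>dom \<Gamma>. \<exists>e\<in>I. \<exists>i. settles e g i \<and> Phi i g = \<Gamma> g)"
    unfolding learnable_iff learns_limit by blast
next
  assume "\<exists>I. ecard I \<le> a \<and> (\<forall>g\<in>dom \<Gamma>. \<exists>e\<in>I. \<exists>i. settles e g i \<and> Phi i g = \<Gamma> g)"
  then obtain I where "ecard I \<le> a" "\<forall>g\<in>dom \<Gamma>. \<exists>e\<in>I. \<exists>i. settles e g i \<and> Phi i g = \<Gamma> g" by blast
  then show "learnable a \<infinity> \<infinity> \<Gamma>"
    by (intro learnableI[of I]) (simp_all add: learns_limit)
qed

section \<open>Counting hypotheses\<close>

definition change_rank :: "(nat \<Rightarrow> nat) \<Rightarrow> nat \<Rightarrow> nat" where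
  "change_rank a n = card {j. j < n \<and> a (Suc j) \<noteq> a j}"

lemma change_rank_mono: "mono (change_rank a)"
  unfolding change_rank_def by (intro monoI card_mono) auto

text \<open>Equally many changes before n and before m leave none in between.\<close>

lemma change_rank_determines:
  assumes "change_rank a n = change_rank a m" shows "a n = a m"
proof -
  have *: "a n = a m" if "n \<le> m" "change_rank a n = change_rank a m" for n m
  proof -
    have eq: "{j. j < n \<and> a (Suc j) \<noteq> a j} = {j. j < m \<and> a (Suc j) \<noteq> a j}"
      using that unfolding change_rank_def by (intro card_subset_eq) auto
    have "a k = a n" if "n \<le> k" "k \<le> m" for k
      using that
    proof (induction k rule: dec_induct)
      case (step k)
      have "k \<notin> {j. j < n \<and> a (Suc j) \<noteq> a j}" using step by simp
      then have "k \<notin> {j. j < m \<and> a (Suc j) \<noteq> a j}" unfolding eq .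
      then have "a (Suc k) = a k" using step by simp
      with step show ?case by simp
    qed simp
    from this[of m] that(1) show ?thesis by simp
  qed
  show ?thesis
  proof (cases "n \<le> m")
    case True
    from *[OF this assms] show ?thesis .
  next
    case False
    from *[OF _ assms[symmetric]] False show ?thesis by simp
  qed
qed

lemma change_rank_settles:
  assumes "finite {j. a (Suc j) \<noteq> a j}"
  shows "\<forall>\<^sub>F n in sequentially. change_rank a n = card {j. a (Suc j) \<noteq> a j}"
proof -
  obtain N where "\<forall>j\<in>{j. a (Suc j) \<noteq> a j}. j < N"
    using assms finite_nat_set_iff_bounded by blast
  then have "{j. j < n \<and> a (Suc j) \<noteq> a j} = {j. a (Suc j) \<noteq> a j}" if "N \<le> n" for n
    using that by auto
  then have "\<forall>n\<ge>N. change_rank a n = card {j. a (Suc j) \<noteq> a j}"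
    unfolding change_rank_def by simp
  then show ?thesis unfolding eventually_sequentially by blast
qed

text \<open>A change of a is accompanied by a strict increase of k, which has only B values to run
  through.\<close>

lemma mono_factor_changes:
  assumes "mono k" "\<And>n. k n < B" "\<And>n. a n = p (k n)"
  shows "finite {j. a (Suc j) \<noteq> a j} \<and> card {j. a (Suc j) \<noteq> a j} < B"
proof -
  let ?M = "{j. a (Suc j) \<noteq> a j}"
  have less: "k j < k (Suc j)" if "j \<in> ?M" for j
  proof -
    have "k j \<noteq> k (Suc j)" using that assms(3)[of j] assms(3)[of "Suc j"] by auto
    then show ?thesis using monoD[OF assms(1), of j "Suc j"] by simp
  qed
  have "k (Suc i) < k (Suc j)" if "i \<in> ?M" "j \<in> ?M" "i < j" for i j
    using less[OF that(2)] monoD[OF assms(1), of "Suc i" j] that(3) by simp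
  then have inj: "inj_on (\<lambda>j. k (Suc j)) ?M"
    by (intro linorder_inj_onI less_imp_neq) auto
  \<comment> \<open>The value reached by an increase is positive; this gives the strict bound
    \<open>card ?M < B\<close>.\<close>
  have im: "(\<lambda>j. k (Suc j)) ` ?M \<subseteq> {1..<B}"
  proof (rule image_subsetI)
    fix j assume "j \<in> ?M"
    from less[OF this] assms(2)[of "Suc j"] show "k (Suc j) \<in> {1..<B}" by simp
  qed
  have "finite ?M" using finite_imageD[OF finite_subset[OF im] inj] by simp
  moreover have "card ?M \<le> card {1..<B}" using card_inj_on_le[OF inj im] by simp
  ultimately show ?thesis using assms(2)[of 0] by simp
qed

text \<open>The number of hypotheses that occurred before the current hypothesis occurred for the first time.\<close>

definition occurrence_rank :: "(nat \<Rightarrow> nat) \<Rightarrow> nat \<Rightarrow> nat" where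
  "occurrence_rank a n =
    card {j. j < n \<and> (\<forall>j'<Suc j. a j' \<noteq> a n) \<and> (\<forall>j'<j. a j' \<noteq> a j)}"

text \<open>The definition looks at times before n only, so that the rank is computable from the
  segment. This form shows that it depends on the hypothesis \<open>a n\<close> alone.\<close>

lemma occurrence_rank_first:
  "occurrence_rank a n = card {j. j < (LEAST j. a j = a n) \<and> (\<forall>j'<j. a j' \<noteq> a j)}"
proof -
  define f where "f = (LEAST j. a j = a n)"
  have f: "a f = a n" unfolding f_def by (rule LeastI[of _ n]) simp
  have "f \<le> n" unfolding f_def by (rule Least_le) simp
  moreover have "a j \<noteq> a n" if "j < f" for j using that unfolding f_def by (rule not_less_Least)
  ultimately have "j < n \<and> (\<forall>j'<Suc j. a j' \<noteq> a n) \<longleftrightarrow> j < f" for j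
    using f by (metis less_Suc_eq_le less_le_trans not_le order_trans)
  then have "{j. j < n \<and> (\<forall>j'<Suc j. a j' \<noteq> a n) \<and> (\<forall>j'<j. a j' \<noteq> a j)}
      = {j. j < f \<and> (\<forall>j'<j. a j' \<noteq> a j)}" by blast
  then show ?thesis by (simp only: occurrence_rank_def f_def)
qed

lemma occurrence_rank_determines:
  assumes "occurrence_rank a n = occurrence_rank a m" shows "a n = a m"
proof -
  define f where "f n = (LEAST j. a j = a n)" for n
  have f: "a (f n) = a n" for n unfolding f_def by (rule LeastI[of _ n]) simp
  have new: "a j \<noteq> a n" if "j < f n" for j n using that unfolding f_def by (rule not_less_Least)
  have less: "occurrence_rank a n < occurrence_rank a m" if "f n < f m" for n m
  proof -
    have "f n \<in> {j. j < f m \<and> (\<forall>j'<j. a j' \<noteq> a j)}" using that new f by simp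
    then have "{j. j < f n \<and> (\<forall>j'<j. a j' \<noteq> a j)} \<subset> {j. j < f m \<and> (\<forall>j'<j. a j' \<noteq> a j)}"
      using that by auto
    then show ?thesis
      unfolding occurrence_rank_first f_def[symmetric] by (intro psubset_card_mono) simp_all
  qed
  have "f n = f m" using less[of n m] less[of m n] assms by linarith
  then show ?thesis using f[of n] f[of m] by simp
qed

text \<open>The hypotheses counted are distinct and all differ from the current one.\<close>

lemma occurrence_rank_less:
  assumes "finite (range a)" shows "occurrence_rank a n < card (range a)"
proof -
  define f where "f = (LEAST j. a j = a n)"
  let ?A = "{j. j < f \<and> (\<forall>j'<j. a j' \<noteq> a j)}"
  have "a j \<noteq> a n" if "j < f" for j using that unfolding f_def by (rule not_less_Least)
  then have "a n \<notin> a ` ?A" by fastforce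
  then have "a ` ?A \<subset> range a" by blast
  then have "card (a ` ?A) < card (range a)" using assms by (rule psubset_card_mono[rotated])
  moreover have "inj_on a ?A"
  proof (rule linorder_inj_onI)
    show "a x \<noteq> a y" if "x < y" "x \<in> ?A" "y \<in> ?A" for x y
      using that by blast
  qed auto
  ultimately show ?thesis unfolding occurrence_rank_first f_def[symmetric] by (simp add: card_image)
qed

lemma occurrence_rank_settles:
  assumes "\<forall>\<^sub>F n in sequentially. a n = i"
  shows "\<exists>r. \<forall>\<^sub>F n in sequentially. occurrence_rank a n = r"
proof (intro exI)
  show "\<forall>\<^sub>F n in sequentially. occurrence_rank a n =
      card {j. j < (LEAST j. a j = i) \<and> (\<forall>j'<j. a j' \<noteq> a j)}"
    using assms by eventually_elim (simp add: occurrence_rank_first)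
qed

section \<open>Learners with finitely many hypotheses\<close>

text \<open>The bound on k is demanded for all segments, convergence only on the domain. The table p
  of programs is arbitrary.\<close>

definition ranked :: "(nat \<Rightarrow> nat) \<Rightarrow> nat \<Rightarrow> (nat \<Rightarrow> nat) \<Rightarrow> ((nat \<Rightarrow> nat) \<rightharpoonup> (nat \<Rightarrow> nat)) \<Rightarrow> bool" where
  "ranked k B p \<Gamma> \<longleftrightarrow> prim_rec k \<and> (\<forall>w. k w < B) \<and>
    (\<forall>g\<in>dom \<Gamma>. \<exists>r. (\<forall>\<^sub>F n in sequentially. k (seg g n) = r) \<and> Phi (p r) g = \<Gamma> g)"

definition monotone_rank :: "(nat \<Rightarrow> nat) \<Rightarrow> bool" where
  "monotone_rank k \<longleftrightarrow> (\<forall>g. mono (\<lambda>n. k (seg g n)))"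

lemma monotone_rankD: "monotone_rank k \<Longrightarrow> n \<le> m \<Longrightarrow> k (seg g n) \<le> k (seg g m)"
  unfolding monotone_rank_def mono_def by blast

text \<open>The program of rank \<open>r\<close> waits until the learner \<open>l\<close> utters a hypothesis of rank \<open>r\<close>, and runs it.\<close>

lemma rank_normal_form:
  assumes l: "prim_rec l" and \<rho>: "prim_rec \<rho>" and B: "0 < B"
    and det: "\<And>g n m. \<rho> (seg g n) = \<rho> (seg g m) \<Longrightarrow> l (seg g n) = l (seg g m)"
    and lim: "\<And>g. g \<in> dom \<Gamma> \<Longrightarrow> \<exists>i r. (\<forall>\<^sub>F n in sequentially. l (seg g n) = i) \<and> Phi i g = \<Gamma> g \<and>
        (\<forall>\<^sub>F n in sequentially. \<rho> (seg g n) = r) \<and> r < B"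
  shows "\<exists>p. ranked (\<lambda>w. min (\<rho> w) (B - 1)) B p \<Gamma>"
proof -
  \<comment> \<open>The witness j is a time of rank r; by \<open>det\<close> all such times carry
    the same hypothesis.\<close>
  define P where "P w r x y \<longleftrightarrow> (\<exists>j<Suc (length (list_decode w)). \<rho> (list_encode (take j (list_decode w))) = r \<and>
      evaluates (list_decode w) (l (list_encode (take j (list_decode w)))) x y)" for w r x y
  have P: "P (seg g n) r x y \<longleftrightarrow> (\<exists>j\<le>n. \<rho> (seg g j) = r \<and> evaluates (g \<restriction> n) (l (seg g j)) x y)" for g n r x y
    unfolding P_def by (auto simp: less_Suc_eq_le min_absorb1)
  have "prim_pred (\<lambda>z. P (pr1 z) (pr1 (pr2 z)) (pr1 (pr2 (pr2 z))) (pr2 (pr2 (pr2 z))))"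
    unfolding P_def by (intro pp_evaluates pr_comp[OF l] pr_comp[OF \<rho>] prim_intros)
  then obtain p where p: "\<And>k g f. (\<And>x. \<exists>n y. P (seg g n) k x y) \<Longrightarrow>
      (\<And>x n y. P (seg g n) k x y \<Longrightarrow> y = f x) \<Longrightarrow> Phi (p k) g = Some f"
    by (rule search_program) blast
  have "\<exists>r. (\<forall>\<^sub>F n in sequentially. min (\<rho> (seg g n)) (B - 1) = r) \<and> Phi (p r) g = \<Gamma> g"
    if g: "g \<in> dom \<Gamma>" for g
  proof -
    obtain i r where i: "\<forall>\<^sub>F n in sequentially. l (seg g n) = i" "Phi i g = \<Gamma> g"
      and r: "\<forall>\<^sub>F n in sequentially. \<rho> (seg g n) = r" "r < B" using lim[OF g] by blast
    obtain N where N: "l (seg g N) = i" "\<rho> (seg g N) = r"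
      using eventually_conj[OF i(1) r(1)] unfolding eventually_sequentially by blast
    obtain f where f: "\<Gamma> g = Some f" using g by blast
    have sem: "sem (decode i) g x = Some (f x)" for x using i(2) f by (simp add: Phi_eq_Some)
    have "Phi (p r) g = Some f"
    proof (rule p)
      fix x
      obtain n where "evaluates (g \<restriction> n) i x (f x)" using evaluates_complete[OF sem] by blast
      then have "evaluates (g \<restriction> max n N) (l (seg g N)) x (f x)"
        unfolding N by (rule evaluates_mono) simp
      then have "P (seg g (max n N)) r x (f x)" 
        unfolding P using N(2) by (intro exI[of _ N]) simp
      then show "\<exists>n y. P (seg g n) r x y" by blast
    next
      fix x n y assume "P (seg g n) r x y"
      then obtain j where j: "\<rho> (seg g j) = r" "evaluates (g \<restriction> n) (l (seg g j)) x y"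
        unfolding P by blast
      have "l (seg g j) = i" using det[of g j N] j(1) N by simp
      with evaluates_sound[OF j(2)] sem[of x] show "y = f x" by simp
    qed
    \<comment> \<open>The final rank is below B, so the cut-off does not change it.\<close>
    moreover have "\<forall>\<^sub>F n in sequentially. min (\<rho> (seg g n)) (B - 1) = r"
      using r(1) by eventually_elim (use r(2) in simp)
    ultimately show ?thesis using f by metis
  qed
  moreover have "prim_rec (\<lambda>w. min (\<rho> w) (B - 1))"
    unfolding min_def by (intro pr_comp[OF \<rho>] prim_intros)
  moreover have "min (\<rho> w) (B - 1) < B" for w using B by linarith
  ultimately show ?thesis unfolding ranked_def by blast
qed

text \<open>The restriction to arguments on which e succeeds prepares for several learners, each of
  which handles a part of the domain.\<close>

lemma learns_changes_ranked:
  "\<exists>k B p. ranked k B p (\<Gamma> |` {g. learns (enat b) c e \<Gamma> g}) \<and> monotone_rank k"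
proof -
  obtain l where l: "prim_rec l" "\<And>\<sigma>. Psi e \<sigma> = l (list_encode \<sigma>)"
    by (rule Psi_prim_rec[of e]) blast
  define \<rho> where "\<rho> w = card {j. j < length (list_decode w) \<and>
    l (list_encode (take (Suc j) (list_decode w))) \<noteq> l (list_encode (take j (list_decode w)))}" for w
  have \<rho>: "\<rho> (seg g n) = change_rank (\<lambda>n. l (seg g n)) n" for g n
    unfolding \<rho>_def change_rank_def by (intro arg_cong[of _ _ card]) auto
  have "prim_rec \<rho>" unfolding \<rho>_def by (intro pr_comp[OF l(1)] prim_intros)
  \<comment> \<open>The bound \<open>Suc b\<close> is positive also for b = 0.\<close>
  then have "\<exists>p. ranked (\<lambda>w. min (\<rho> w) (Suc b - 1)) (Suc b) p (\<Gamma> |` {g. learns (enat b) c e \<Gamma> g})"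
  proof (rule rank_normal_form[OF l(1)])
    show "l (seg g n) = l (seg g m)" if "\<rho> (seg g n) = \<rho> (seg g m)" for g n m
      by (rule change_rank_determines[OF that[unfolded \<rho>]])
    fix g assume "g \<in> dom (\<Gamma> |` {g. learns (enat b) c e \<Gamma> g})"
    then have g: "learns (enat b) c e \<Gamma> g" by (auto simp: restrict_map_def split: if_splits)
    then obtain i where i: "settles e g i" "Phi i g = \<Gamma> g" unfolding learns_def by blast
    let ?M = "{j. l (seg g (Suc j)) \<noteq> l (seg g j)}"
    have M: "mcl (Psi e) g = ?M" by (simp add: mcl_def l(2))
    then have "finite ?M" "card ?M < Suc b"
      using settles_finite(1)[OF i(1)] g by (auto simp: learns_def ecard_def)
    with i change_rank_settles[of "\<lambda>n. l (seg g n)"]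
    show "\<exists>i r. (\<forall>\<^sub>F n in sequentially. l (seg g n) = i) \<and>
        Phi i g = (\<Gamma> |` {g. learns (enat b) c e \<Gamma> g}) g \<and>
        (\<forall>\<^sub>F n in sequentially. \<rho> (seg g n) = r) \<and> r < Suc b"
      unfolding \<rho> settles_def l(2) using g by auto
  qed simp
  moreover have "monotone_rank (\<lambda>w. min (\<rho> w) (Suc b - 1))"
    unfolding monotone_rank_def
  proof (intro allI monoI)
    fix g and n m :: nat assume "n \<le> m"
    then have "\<rho> (seg g n) \<le> \<rho> (seg g m)" unfolding \<rho> by (rule monoD[OF change_rank_mono])
    then show "min (\<rho> (seg g n)) (Suc b - 1) \<le> min (\<rho> (seg g m)) (Suc b - 1)" by simp
  qed
  ultimately show ?thesis by blast
qed

text \<open>A learner with few hypotheses may return to earlier ones, so this rank can decrease, in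
  contrast to the number of mind changes.\<close>

lemma learns_indices_ranked:
  "\<exists>k B p. ranked k B p (\<Gamma> |` {g. learns b (enat c) e \<Gamma> g})"
proof -
  obtain l where l: "prim_rec l" "\<And>\<sigma>. Psi e \<sigma> = l (list_encode \<sigma>)"
    by (rule Psi_prim_rec[of e]) blast
  define \<rho> where "\<rho> w = card {j. j < length (list_decode w) \<and>
    (\<forall>j'<Suc j. l (list_encode (take j' (list_decode w))) \<noteq> l w) \<and>
    (\<forall>j'<j. l (list_encode (take j' (list_decode w))) \<noteq> l (list_encode (take j (list_decode w))))}" for w
  have \<rho>: "\<rho> (seg g n) = occurrence_rank (\<lambda>n. l (seg g n)) n" for g n
    unfolding \<rho>_def occurrence_rank_def by (intro arg_cong[of _ _ card]) (auto simp: min_def)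
  have "prim_rec \<rho>" unfolding \<rho>_def by (intro pr_comp[OF l(1)] prim_intros)
  then have "\<exists>p. ranked (\<lambda>w. min (\<rho> w) (Suc c - 1)) (Suc c) p (\<Gamma> |` {g. learns b (enat c) e \<Gamma> g})"
  proof (rule rank_normal_form[OF l(1)])
    show "l (seg g n) = l (seg g m)" if "\<rho> (seg g n) = \<rho> (seg g m)" for g n m
      by (rule occurrence_rank_determines[OF that[unfolded \<rho>]])
    fix g assume "g \<in> dom (\<Gamma> |` {g. learns b (enat c) e \<Gamma> g})"
    then have g: "learns b (enat c) e \<Gamma> g" by (auto simp: restrict_map_def split: if_splits)
    then obtain i where i: "settles e g i" "Phi i g = \<Gamma> g" unfolding learns_def by blast
    have ev: "\<forall>\<^sub>F n in sequentially. l (seg g n) = i" using i(1) unfolding settles_def l(2) .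
    then obtain r where r: "\<forall>\<^sub>F n in sequentially. occurrence_rank (\<lambda>n. l (seg g n)) n = r"
      using occurrence_rank_settles[OF ev] by blast
    have indx: "indx (Psi e) g = range (\<lambda>n. l (seg g n))" unfolding indx_def l(2) by blast
    have fin: "finite (range (\<lambda>n. l (seg g n)))" using settles_finite(2)[OF i(1)] unfolding indx .
    moreover have "card (range (\<lambda>n. l (seg g n))) \<le> c"
      using g fin unfolding learns_def indx by (simp add: ecard_def)
    moreover obtain n where "occurrence_rank (\<lambda>n. l (seg g n)) n = r"
      using r unfolding eventually_sequentially by blast
    ultimately have "r < Suc c" using occurrence_rank_less[of "\<lambda>n. l (seg g n)" n] by simp
    then show "\<exists>i r. (\<forall>\<^sub>F n in sequentially. l (seg g n) = i) \<and>
        Phi i g = (\<Gamma> |` {g. learns b (enat c) e \<Gamma> g}) g \<and>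
        (\<forall>\<^sub>F n in sequentially. \<rho> (seg g n) = r) \<and> r < Suc c"
      unfolding \<rho> using g ev i(2) r by auto
  qed simp
  then show ?thesis by blast
qed

lemma ranked_programs:
  "ranked k B p \<Gamma> \<Longrightarrow> g \<in> dom \<Gamma> \<Longrightarrow> \<exists>i\<in>p ` {..<B}. Phi i g = \<Gamma> g"
proof -
  assume k: "ranked k B p \<Gamma>" and g: "g \<in> dom \<Gamma>"
  then obtain r where r: "\<forall>\<^sub>F n in sequentially. k (seg g n) = r" "Phi (p r) g = \<Gamma> g"
    unfolding ranked_def by blast
  obtain n where "k (seg g n) = r" using r(1) unfolding eventually_sequentially by blast
  then have "r < B" using k unfolding ranked_def by blast
  with r(2) show ?thesis by blast
qed

lemma ranked_learner:
  assumes k: "ranked k B p \<Gamma>"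
  shows "\<exists>e. (\<forall>g\<in>dom \<Gamma>. learns \<infinity> (enat B) e \<Gamma> g) \<and>
    (monotone_rank k \<longrightarrow> (\<forall>g\<in>dom \<Gamma>. learns (enat B) \<infinity> e \<Gamma> g))"
proof -
  have k': "prim_rec k" "\<And>w. k w < B" using k unfolding ranked_def by blast+
  \<comment> \<open>Only the values of p below B enter, hence a finite table.\<close>
  have "prim_rec (\<lambda>w. if k w < B then p (k w) else 0)"
    using pr_comp[OF pr_finite_table[of B p] k'(1)] .
  then have "prim_rec (\<lambda>w. p (k w))" using k'(2) by simp
  then obtain e where e: "\<And>\<sigma>. Psi e \<sigma> = p (k (list_encode \<sigma>))"
    by (rule prim_rec_Psi) blast
  have lim: "learns \<infinity> \<infinity> e \<Gamma> g" if g: "g \<in> dom \<Gamma>" for g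
  proof -
    obtain r where r: "\<forall>\<^sub>F n in sequentially. k (seg g n) = r" "Phi (p r) g = \<Gamma> g"
      using k g unfolding ranked_def by blast
    from r(1) have "settles e g (p r)" unfolding settles_def by eventually_elim (simp add: e)
    with r(2) show ?thesis unfolding learns_limit by blast
  qed
  have "learns \<infinity> (enat B) e \<Gamma> g" if "g \<in> dom \<Gamma>" for g
  proof -
    have "indx (Psi e) g \<subseteq> p ` {..<B}" unfolding indx_def e using k'(2) by blast
    then have "ecard (indx (Psi e) g) \<le> ecard (p ` {..<B})" by (rule ecard_mono)
    also have "\<dots> \<le> ecard {..<B}" by (rule ecard_image_le)
    also have "\<dots> = enat B" by (simp add: ecard_def)
    finally show ?thesis using lim[OF that] unfolding learns_def by blast
  qed
  moreover have "learns (enat B) \<infinity> e \<Gamma> g" if "monotone_rank k" "g \<in> dom \<Gamma>" for g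
  proof -
    have "mono (\<lambda>n. k (seg g n))" using that(1) unfolding monotone_rank_def by blast
    from mono_factor_changes[OF this, of B "\<lambda>n. Psi e (g \<restriction> n)" p] k'(2) e
    have "finite (mcl (Psi e) g) \<and> card (mcl (Psi e) g) < B" by (simp add: mcl_def)
    then have "ecard (mcl (Psi e) g) < enat B" by (simp add: ecard_def)
    with lim[OF that(2)] show ?thesis unfolding learns_def by blast
  qed
  ultimately show ?thesis by blast
qed

text \<open>The ranks of the composition are ordered lexicographically, with the rank of the inner
  function first.\<close>

lemma ranked_compose:
  assumes 1: "ranked k1 B1 p1 \<Gamma>1" and 0: "ranked k0 B0 p0 \<Gamma>0"
  shows "\<exists>k p. ranked k (B0 * B1) p (\<Gamma>1 \<circ>\<^sub>m \<Gamma>0) \<and>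
    (monotone_rank k1 \<longrightarrow> monotone_rank k0 \<longrightarrow> monotone_rank k)"
proof -
  have k1: "prim_rec k1" "\<And>w. k1 w < B1" and k0: "prim_rec k0" "\<And>w. k0 w < B0"
    using 1 0 unfolding ranked_def by blast+
  obtain c where c: "\<And>i j g h f. Phi j g = Some h \<Longrightarrow> Phi i h = Some f \<Longrightarrow> Phi (c (pair i j)) g = Some f"
    by (rule comp_index) blast
  have "prim_rec (\<lambda>w. if k0 w < B0 then p0 (k0 w) else 0)"
    using pr_comp[OF pr_finite_table[of B0 p0] k0(1)] .
  then have p0: "prim_rec (\<lambda>w. p0 (k0 w))" using k0(2) by simp
  \<comment> \<open>A two-digit number with leading digit \<open>k0 w\<close>. The second digit
    stays below B1 even on outputs of a wrong inner program, since ranks are bounded on all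
    inputs.\<close>
  define k where "k w = k0 w * B1 + k1 (out w (p0 (k0 w)))" for w
  define p where "p r = c (pair (p1 (r mod B1)) (p0 (r div B1)))" for r
  have p: "p (r0 * B1 + r1) = c (pair (p1 r1) (p0 r0))" if "r1 < B1" for r0 r1
    using that by (simp add: p_def)
  have lex: "r0 * B1 + r1 < r0' * B1 + r1'" if "r1 < B1" "r0 < r0'" for r0 r1 r0' r1'
  proof -
    have "r0 * B1 + r1 < Suc r0 * B1" using that(1) by simp
    also have "\<dots> \<le> r0' * B1" using that(2) by (intro mult_le_mono1) simp
    finally show ?thesis by simp
  qed
  have "prim_rec k"
    unfolding k_def by (intro pr_comp[OF k1(1)] pr_comp[OF k0(1)] pr_out p0 prim_intros)
  moreover have "k w < B0 * B1" for w
    using lex[OF k1(2) k0(2), of w "out w (p0 (k0 w))" 0] by (simp add: k_def)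
  moreover have "\<exists>r. (\<forall>\<^sub>F n in sequentially. k (seg g n) = r) \<and> Phi (p r) g = (\<Gamma>1 \<circ>\<^sub>m \<Gamma>0) g"
    if g: "g \<in> dom (\<Gamma>1 \<circ>\<^sub>m \<Gamma>0)" for g
  proof -
    obtain h f where h: "\<Gamma>0 g = Some h" "\<Gamma>1 h = Some f" "(\<Gamma>1 \<circ>\<^sub>m \<Gamma>0) g = Some f"
      using g by (auto simp: map_comp_def split: option.splits)
    obtain r0 where r0: "\<forall>\<^sub>F n in sequentially. k0 (seg g n) = r0" "Phi (p0 r0) g = Some h"
      using 0 h unfolding ranked_def by (metis domI)
    obtain r1 where r1: "\<forall>\<^sub>F n in sequentially. k1 (seg h n) = r1" "Phi (p1 r1) h = Some f"
      using 1 h unfolding ranked_def by (metis domI)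
    obtain L where L: "mono L" "\<And>n. out (seg g n) (p0 r0) = seg h (L n)" "\<And>N. \<exists>n. N \<le> L n"
      using out_seg_total[OF r0(2)] by blast
    obtain N where N: "\<And>n. N \<le> n \<Longrightarrow> k1 (seg h n) = r1"
      using r1(1) unfolding eventually_sequentially by blast
    obtain M where "N \<le> L M" using L(3) by blast
    then have "\<forall>\<^sub>F n in sequentially. N \<le> L n"
      using monoD[OF L(1)] unfolding eventually_sequentially by (meson order_trans)
    with r0(1) have "\<forall>\<^sub>F n in sequentially. k (seg g n) = r0 * B1 + r1"
    proof eventually_elim
      case (elim n)
      with N[of "L n"] show ?case by (simp add: k_def L(2))
    qed
    moreover have "r1 < B1" using N[of N] k1(2)[of "seg h N"] by simp
    then have "Phi (p (r0 * B1 + r1)) g = Some f" using c[OF r0(2) r1(2)] by (simp add: p)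
    ultimately show ?thesis using h(3) by metis
  qed
  ultimately have "ranked k (B0 * B1) p (\<Gamma>1 \<circ>\<^sub>m \<Gamma>0)" unfolding ranked_def by blast
  moreover have "monotone_rank k" if m: "monotone_rank k1" "monotone_rank k0"
    unfolding monotone_rank_def
  proof (intro allI monoI)
    fix g and n m :: nat assume nm: "n \<le> m"
    have "k0 (seg g n) \<le> k0 (seg g m)" using m(2) nm by (rule monotone_rankD)
    then consider "k0 (seg g n) < k0 (seg g m)" | "k0 (seg g n) = k0 (seg g m)" by linarith
    then show "k (seg g n) \<le> k (seg g m)"
    proof cases
      case 1
      from lex[OF k1(2) this] show ?thesis by (simp add: k_def less_imp_le)
    next
      case 2
      \<comment> \<open>As long as the inner rank does not move, the outer learner reads segments of
        one sequence F, so the second digit cannot decrease.\<close>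
      obtain F L where L: "mono L" "\<And>n. out (seg g n) (p0 (k0 (seg g m))) = seg F (L n)"
        by (rule out_seg) blast
      have "k1 (seg F (L n)) \<le> k1 (seg F (L m))"
        using m(1) monoD[OF L(1) nm] by (rule monotone_rankD)
      then show ?thesis unfolding k_def 2 L(2) by simp
    qed
  qed
  ultimately show ?thesis by blast
qed

section \<open>Forcing new hypotheses\<close>

text \<open>A correct value \<open>\<Phi>\<^sub>i(g)(0)\<close> depends on finitely many values of \<open>g\<close>, so it can be made wrong by
  a change of \<open>g\<close> beyond these.\<close>

lemma forcing:
  assumes base: "Q 0 g0"
    and step: "\<And>j g s. j < m \<Longrightarrow> Q j g \<Longrightarrow> \<exists>h. Q (Suc j) h \<and> h \<restriction> s = g \<restriction> s"
    and hyp: "\<And>j g N. j \<le> m \<Longrightarrow> Q j g \<Longrightarrow>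
      \<exists>n\<ge>N. \<exists>i. H (g \<restriction> n) i \<and> sem (decode i) g 0 = Some (v j)"
  shows "\<exists>g t I. Q m g \<and> (\<forall>j<m. t j < t (Suc j)) \<and>
    (\<forall>j\<le>m. H (g \<restriction> t j) (I j) \<and> sem (decode (I j)) g 0 = Some (v j))"
proof -
  \<comment> \<open>The induction maintains a length s such that all values and hypotheses obtained
    so far survive any change of g beyond s.\<close>
  have "\<exists>g t I s. Q k g \<and> (\<forall>j<k. t j < t (Suc j)) \<and> (\<forall>j\<le>k. t j \<le> s \<and>
      (\<forall>h. h \<restriction> s = g \<restriction> s \<longrightarrow> H (h \<restriction> t j) (I j) \<and> sem (decode (I j)) h 0 = Some (v j)))"
    if "k \<le> m" for k
    using that
  proof (induction k)
    case 0
    obtain n i where n: "H (g0 \<restriction> n) i" "sem (decode i) g0 0 = Some (v 0)"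
      using hyp[of 0 g0 0] base by blast
    obtain u where u: "\<And>h. h \<restriction> u = g0 \<restriction> u \<Longrightarrow> sem (decode i) h 0 = Some (v 0)"
      using sem_use[OF n(2)] by blast
    have "H (h \<restriction> n) i \<and> sem (decode i) h 0 = Some (v 0)" if "h \<restriction> max n u = g0 \<restriction> max n u" for h
    proof -
      have "h \<restriction> n = g0 \<restriction> n" "h \<restriction> u = g0 \<restriction> u" using that by (simp_all add: init_seg_eq_iff)
      with n(1) u show ?thesis by simp
    qed
    with base show ?case
      by (intro exI[of _ g0] exI[of _ "\<lambda>_. n"] exI[of _ "\<lambda>_. i"] exI[of _ "max n u"]) simp
  next
    case (Suc k)
    from Suc.IH[OF Suc_leD[OF Suc.prems]] obtain g t I s where g: "Q k g" "\<forall>j<k. t j < t (Suc j)"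
      and *: "\<forall>j\<le>k. t j \<le> s \<and>
        (\<forall>h. h \<restriction> s = g \<restriction> s \<longrightarrow> H (h \<restriction> t j) (I j) \<and> sem (decode (I j)) h 0 = Some (v j))"
      by blast
    have I: "t j \<le> s"
        "h \<restriction> s = g \<restriction> s \<Longrightarrow> H (h \<restriction> t j) (I j) \<and> sem (decode (I j)) h 0 = Some (v j)"
      if "j \<le> k" for j h
      using * that by blast+
    obtain h where h: "Q (Suc k) h" "h \<restriction> s = g \<restriction> s" using step[of k g s] g(1) Suc.prems by auto
    \<comment> \<open>Starting after s puts the new time behind all earlier ones.\<close>
    obtain n i where n: "Suc s \<le> n" "H (h \<restriction> n) i" "sem (decode i) h 0 = Some (v (Suc k))"
      using hyp[of "Suc k" h "Suc s"] h(1) Suc.prems by blast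
    obtain u where u: "\<And>h'. h' \<restriction> u = h \<restriction> u \<Longrightarrow> sem (decode i) h' 0 = Some (v (Suc k))"
      using sem_use[OF n(3)] by blast
    define t' where "t' = t(Suc k := n)"
    define I' where "I' = I(Suc k := i)"
    have A: "t' j < t' (Suc j)" if "j < Suc k" for j
      using that g(2) I(1)[of k] n(1) by (auto simp: t'_def less_Suc_eq)
    have C: "t' j \<le> max n u \<and> (\<forall>h'. h' \<restriction> max n u = h \<restriction> max n u \<longrightarrow>
        H (h' \<restriction> t' j) (I' j) \<and> sem (decode (I' j)) h' 0 = Some (v j))" if j: "j \<le> Suc k" for j
    proof (cases "j = Suc k")
      case True
      have "H (h' \<restriction> n) i \<and> sem (decode i) h' 0 = Some (v (Suc k))"
        if "h' \<restriction> max n u = h \<restriction> max n u" for h'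
      proof -
        have "h' \<restriction> n = h \<restriction> n" "h' \<restriction> u = h \<restriction> u" using that by (simp_all add: init_seg_eq_iff)
        with u[of h'] n(2) show ?thesis by simp
      qed
      then show ?thesis by (simp add: True t'_def I'_def)
    next
      case False
      then have j: "j \<le> k" using j by simp
      have "h' \<restriction> s = g \<restriction> s" if "h' \<restriction> max n u = h \<restriction> max n u" for h'
        using that n(1) h(2) by (simp add: init_seg_eq_iff)
      moreover have "t j \<le> max n u" using I(1)[OF j] n(1) by simp
      ultimately show ?thesis using I(2)[OF j] False by (simp add: t'_def I'_def)
    qed
    have "\<forall>j<Suc k. t' j < t' (Suc j)" using A by blast
    moreover have "\<forall>j\<le>Suc k. t' j \<le> max n u \<and> (\<forall>h'. h' \<restriction> max n u = h \<restriction> max n u \<longrightarrow>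
        H (h' \<restriction> t' j) (I' j) \<and> sem (decode (I' j)) h' 0 = Some (v j))" using C by blast
    ultimately show ?case
      by (intro exI[of _ h] exI[of _ t'] exI[of _ I'] exI[of _ "max n u"] conjI h(1))
  qed
  from this[OF order_refl] obtain g t I s where g: "Q m g" "\<forall>j<m. t j < t (Suc j)"
    "\<forall>j\<le>m. t j \<le> s \<and>
      (\<forall>h. h \<restriction> s = g \<restriction> s \<longrightarrow> H (h \<restriction> t j) (I j) \<and> sem (decode (I j)) h 0 = Some (v j))"
    by blast
  have "\<forall>j\<le>m. H (g \<restriction> t j) (I j) \<and> sem (decode (I j)) g 0 = Some (v j)"
  proof (intro allI impI)
    fix j assume "j \<le> m"
    with g(3) have "\<forall>h. h \<restriction> s = g \<restriction> s \<longrightarrow> H (h \<restriction> t j) (I j) \<and> sem (decode (I j)) h 0 = Some (v j)"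
      by blast
    from this[rule_format, of g] show "H (g \<restriction> t j) (I j) \<and> sem (decode (I j)) g 0 = Some (v j)" by simp
  qed
  with g(1,2) show ?thesis by (intro exI[of _ g] exI[of _ t] exI[of _ I] conjI)
qed

text \<open>Here H says that i is the hypothesis of e after the given segment.\<close>

lemma forced_indices:
  assumes "Q 0 g0"
    and "\<And>j g s. j < m \<Longrightarrow> Q j g \<Longrightarrow> \<exists>h. Q (Suc j) h \<and> h \<restriction> s = g \<restriction> s"
    and val: "\<And>j g. j \<le> m \<Longrightarrow> Q j g \<Longrightarrow> \<exists>f. \<Gamma> g = Some f \<and> f 0 = v j"
    and e: "\<And>g. g \<in> dom \<Gamma> \<Longrightarrow> learns b c e \<Gamma> g"
  shows "\<exists>g t. Q m g \<and> (\<forall>j<m. t j < t (Suc j)) \<and>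
    (\<forall>j\<le>m. sem (decode (Psi e (g \<restriction> t j))) g 0 = Some (v j))"
proof -
  have "\<exists>g t I. Q m g \<and> (\<forall>j<m. t j < t (Suc j)) \<and>
    (\<forall>j\<le>m. I j = Psi e (g \<restriction> t j) \<and> sem (decode (I j)) g 0 = Some (v j))"
  proof (rule forcing[of Q g0 m "\<lambda>\<sigma> i. i = Psi e \<sigma>" v])
    fix j g and N :: nat assume "j \<le> m" "Q j g"
    then obtain f where f: "\<Gamma> g = Some f" "f 0 = v j" using val by blast
    then obtain i where i: "settles e g i" "Phi i g = Some f" using learns_imp_limit[OF e, of g] by auto
    obtain n where "N \<le> n" "Psi e (g \<restriction> n) = i"
      using eventually_conj[OF i(1)[unfolded settles_def] eventually_ge_at_top[of N]]
      unfolding eventually_sequentially by blast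
    with i(2) f(2) show "\<exists>n\<ge>N. \<exists>i. i = Psi e (g \<restriction> n) \<and> sem (decode i) g 0 = Some (v j)"
      by (auto simp: Phi_eq_Some)
  qed (use assms in simp_all)
  then obtain g t I where g: "Q m g" "\<forall>j<m. t j < t (Suc j)"
    "\<forall>j\<le>m. I j = Psi e (g \<restriction> t j) \<and> sem (decode (I j)) g 0 = Some (v j)" by blast
  then have "\<forall>j\<le>m. sem (decode (Psi e (g \<restriction> t j))) g 0 = Some (v j)" by metis
  with g(1,2) show ?thesis by (intro exI[of _ g] exI[of _ t] conjI)
qed

text \<open>All forced hypotheses are evaluated on the same final g, where the values 0 to m require
  m + 1 programs.\<close>

lemma forced_many_indices:
  assumes "Q 0 g0"
    and "\<And>j g s. j < m \<Longrightarrow> Q j g \<Longrightarrow> \<exists>h. Q (Suc j) h \<and> h \<restriction> s = g \<restriction> s"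
    and val: "\<And>j g. j \<le> m \<Longrightarrow> Q j g \<Longrightarrow> \<exists>f. \<Gamma> g = Some f \<and> f 0 = j"
  shows "\<not> learnable 1 b (enat m) \<Gamma>"
proof
  assume "learnable 1 b (enat m) \<Gamma>"
  then obtain I where I: "ecard I = 1" "\<forall>g\<in>dom \<Gamma>. \<exists>e\<in>I. learns b (enat m) e \<Gamma> g"
    unfolding learnable_iff by blast
  then obtain e where "I = {e}"
    by (auto simp: ecard_def one_enat_def card_1_singleton_iff split: if_splits)
  with I have e: "\<And>g. g \<in> dom \<Gamma> \<Longrightarrow> learns b (enat m) e \<Gamma> g" by blast
  from forced_indices[of Q g0 m \<Gamma> "\<lambda>j. j" b "enat m" e, OF assms(1,2) val e]
  obtain g t where g: "Q m g" "\<And>j. j \<le> m \<Longrightarrow> sem (decode (Psi e (g \<restriction> t j))) g 0 = Some j"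
    by blast
  have g_dom: "g \<in> dom \<Gamma>" using val[OF order_refl g(1)] by blast
  have "inj_on (\<lambda>j. Psi e (g \<restriction> t j)) {..m}"
  proof (rule inj_onI)
    fix x y assume "x \<in> {..m}" "y \<in> {..m}" "Psi e (g \<restriction> t x) = Psi e (g \<restriction> t y)"
    with g(2)[of x] g(2)[of y] show "x = y" by (metis atMost_iff option.inject)
  qed
  then have "card ((\<lambda>j. Psi e (g \<restriction> t j)) ` {..m}) = Suc m" by (simp add: card_image)
  moreover have "(\<lambda>j. Psi e (g \<restriction> t j)) ` {..m} \<subseteq> indx (Psi e) g" unfolding indx_def by blast
  moreover have "finite (indx (Psi e) g)" "card (indx (Psi e) g) \<le> m"
    using e[OF g_dom] by (auto simp: learns_def ecard_def split: if_splits)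
  ultimately show False using card_mono by (metis not_less_eq_eq)
qed

text \<open>Successive values differ, so each of the m disjoint intervals between forced times
  contains a mind change.\<close>

lemma forced_many_changes:
  assumes "Q 0 g0"
    and "\<And>j g s. j < m \<Longrightarrow> Q j g \<Longrightarrow> \<exists>h. Q (Suc j) h \<and> h \<restriction> s = g \<restriction> s"
    and val: "\<And>j g. j \<le> m \<Longrightarrow> Q j g \<Longrightarrow> \<exists>f. \<Gamma> g = Some f \<and> f 0 = v j"
    and v: "\<And>j. v j \<noteq> v (Suc j)"
  shows "\<not> learnable 1 (enat m) c \<Gamma>"
proof
  assume "learnable 1 (enat m) c \<Gamma>"
  then obtain I where I: "ecard I = 1" "\<forall>g\<in>dom \<Gamma>. \<exists>e\<in>I. learns (enat m) c e \<Gamma> g"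
    unfolding learnable_iff by blast
  then obtain e where "I = {e}"
    by (auto simp: ecard_def one_enat_def card_1_singleton_iff split: if_splits)
  with I have e: "\<And>g. g \<in> dom \<Gamma> \<Longrightarrow> learns (enat m) c e \<Gamma> g" by blast
  from forced_indices[of Q g0 m \<Gamma> v "enat m" c e, OF assms(1,2) val e]
  obtain g t where g: "Q m g" "\<And>j. j < m \<Longrightarrow> t j < t (Suc j)"
    "\<And>j. j \<le> m \<Longrightarrow> sem (decode (Psi e (g \<restriction> t j))) g 0 = Some (v j)"
    by blast
  have g_dom: "g \<in> dom \<Gamma>" using val[OF order_refl g(1)] by blast
  have "\<exists>n\<in>mcl (Psi e) g. t j \<le> n \<and> n < t (Suc j)" if j: "j < m" for j
  proof (rule ccontr)
    assume "\<not> (\<exists>n\<in>mcl (Psi e) g. t j \<le> n \<and> n < t (Suc j))"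
    then have const: "Psi e (g \<restriction> Suc n) = Psi e (g \<restriction> n)" if "t j \<le> n" "n < t (Suc j)" for n
      using that by (auto simp: mcl_def)
    have "Psi e (g \<restriction> n) = Psi e (g \<restriction> t j)" if "t j \<le> n" "n \<le> t (Suc j)" for n
      using that
    proof (induction n rule: dec_induct)
      case (step n)
      then show ?case using const[of n] by simp
    qed simp
    from this[of "t (Suc j)"] g(2)[OF j] have "Psi e (g \<restriction> t (Suc j)) = Psi e (g \<restriction> t j)" by simp
    with g(3)[of j] g(3)[of "Suc j"] j have "Some (v j) = Some (v (Suc j))" by (metis Suc_leI less_imp_le)
    with v[of j] show False by simp
  qed
  then obtain n where n: "\<And>j. j < m \<Longrightarrow> n j \<in> mcl (Psi e) g \<and> t j \<le> n j \<and> n j < t (Suc j)"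
    by metis
  have tmono: "i < j \<Longrightarrow> j < m \<Longrightarrow> t (Suc i) \<le> t j" for i j
  proof (induction j)
    case (Suc j)
    then show ?case using g(2)[of j] by (cases "i = j") auto
  qed simp
  have "inj_on n {..<m}"
  proof (rule linorder_inj_onI)
    fix x y assume "x < y" "x \<in> {..<m}" "y \<in> {..<m}"
    then have "n x < n y" using n[of x] n[of y] tmono[of x y] by auto
    then show "n x \<noteq> n y" by simp
  qed auto
  then have "card (n ` {..<m}) = m" by (simp add: card_image)
  moreover have "n ` {..<m} \<subseteq> mcl (Psi e) g" using n by blast
  moreover have "finite (mcl (Psi e) g)" "card (mcl (Psi e) g) < m"
    using e[OF g_dom] by (auto simp: learns_def ecard_def split: if_splits)
  ultimately show False using card_mono by (metis not_le)
qed

text \<open>Now H merely says that i belongs to J; \<open>card J + 1\<close> different values on one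
  g exceed the supply of programs.\<close>

lemma forced_many_programs:
  assumes "finite J" and "Q 0 g0"
    and "\<And>j g s. Q j g \<Longrightarrow> \<exists>h. Q (Suc j) h \<and> h \<restriction> s = g \<restriction> s"
    and val: "\<And>j g. Q j g \<Longrightarrow> \<exists>f. \<Gamma> g = Some f \<and> f 0 = j"
    and J: "\<And>g. g \<in> dom \<Gamma> \<Longrightarrow> \<exists>i\<in>J. Phi i g = \<Gamma> g"
  shows False
proof -
  let ?m = "card J"
  have "\<exists>g (t :: nat \<Rightarrow> nat) I. Q ?m g \<and> (\<forall>j<?m. t j < t (Suc j)) \<and>
    (\<forall>j\<le>?m. I j \<in> J \<and> sem (decode (I j)) g 0 = Some j)"
  proof (rule forcing[of Q g0 ?m "\<lambda>\<sigma> i. i \<in> J" "\<lambda>j. j"])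
    fix j g and N :: nat assume "j \<le> ?m" "Q j g"
    then obtain f where f: "\<Gamma> g = Some f" "f 0 = j" using val by blast
    then obtain i where "i \<in> J" "Phi i g = Some f" using J[of g] by auto
    with f(2) show "\<exists>n\<ge>N. \<exists>i. i \<in> J \<and> sem (decode i) g 0 = Some j"
      by (intro exI[of _ N] conjI exI[of _ i]) (auto simp: Phi_eq_Some)
  qed (use assms in simp_all)
  then obtain g I where I: "\<forall>j\<le>?m. I j \<in> J \<and> sem (decode (I j)) g 0 = Some j" by blast
  have "inj_on I {..?m}"
  proof (rule inj_onI)
    fix x y assume "x \<in> {..?m}" "y \<in> {..?m}" "I x = I y"
    with I show "x = y" by (metis atMost_iff option.inject)
  qed
  moreover have "I ` {..?m} \<subseteq> J" using I by auto
  ultimately have "card {..?m} \<le> card J" using assms(1) by (rule card_inj_on_le)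
  then show False by simp
qed

section \<open>Separating functions\<close>

definition bump_if :: "((nat \<Rightarrow> nat) \<Rightarrow> bool) \<Rightarrow> (nat \<Rightarrow> nat) \<rightharpoonup> (nat \<Rightarrow> nat)" where
  "bump_if A g = Some (if A g then bump g else g)"

definition bump_count :: "nat \<Rightarrow> (nat \<Rightarrow> (nat \<Rightarrow> nat) \<Rightarrow> bool) \<Rightarrow> (nat \<Rightarrow> nat) \<rightharpoonup> (nat \<Rightarrow> nat)" where
  "bump_count m A g = Some (g(0 := g 0 + card {j. j < m \<and> A j g}))"

text \<open>The properties ignore g(0), so the increments made by the inner factors do not affect
  them and simply add up.\<close>

lemma bump_count_in_closed:
  assumes "Some \<in> C" "\<And>\<Gamma> \<Delta>. \<Gamma> \<in> C \<Longrightarrow> \<Delta> \<in> C \<Longrightarrow> \<Gamma> \<circ>\<^sub>m \<Delta> \<in> C"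
    and "\<And>j. bump_if (A j) \<in> C" and tail: "\<And>j g x. A j (g(0 := x)) \<longleftrightarrow> A j g"
  shows "bump_count m A \<in> C"
proof (induction m)
  case 0
  have "bump_count 0 A = Some" by (auto simp: bump_count_def)
  with assms(1) show ?case by simp
next
  case (Suc m)
  have "bump_count (Suc m) A = bump_if (A m) \<circ>\<^sub>m bump_count m A"
  proof
    fix g
    have "{j. j < Suc m \<and> A j g} = (if A m g then insert m {j. j < m \<and> A j g} else {j. j < m \<and> A j g})"
      by (auto simp: less_Suc_eq)
    then show "bump_count (Suc m) A g = (bump_if (A m) \<circ>\<^sub>m bump_count m A) g"
      by (simp add: bump_count_def bump_if_def bump_def map_comp_def tail)
  qed
  with assms(2,3) Suc show ?case by simp
qed

text \<open>Two programs serve all properties at once, computable or not: only the choice between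
  them depends on A.\<close>

lemma bump_if_programs: obtains J where "finite J" "card J \<le> 2" "\<And>A g. \<exists>i\<in>J. Phi i g = bump_if A g"
proof -
  obtain i where i: "\<And>g. Phi i g = Some g" by (rule Phi_id) blast
  obtain j where j: "\<And>g. Phi j g = Some (bump g)" by (rule Phi_bump) blast
  show thesis
  proof (rule that)
    show "card {i, j} \<le> 2" by (simp add: card_insert_if)
    show "\<exists>k\<in>{i, j}. Phi k g = bump_if A g" for A g by (simp add: bump_if_def i j)
  qed simp
qed

section \<open>Semidecidable properties that defeat any bound on hypotheses\<close>

definition exceeds :: "nat \<Rightarrow> (nat \<Rightarrow> nat) \<Rightarrow> bool" where
  "exceeds j g \<longleftrightarrow> (\<exists>x\<ge>1. j < g x)"

lemma exceeds_tail: "exceeds j (g(0 := x)) \<longleftrightarrow> exceeds j g"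
  unfolding exceeds_def by (intro ex_cong1 conj_cong refl) simp

text \<open>The learner proposes the identity until a large entry appears and \<open>bump\<close>
  afterwards.\<close>

lemma bump_if_exceeds_learnable: "learnable 1 2 2 (bump_if (exceeds j))"
proof -
  obtain i0 where i0: "\<And>g. Phi i0 g = Some g" by (rule Phi_id) blast
  obtain i1 where i1: "\<And>g. Phi i1 g = Some (bump g)" by (rule Phi_bump) blast
  define E where "E w \<longleftrightarrow> (\<exists>x<length (list_decode w). 1 \<le> x \<and> j < nth0 (list_decode w) x)" for w
  define k where "k w = (if E w then 1 else 0 :: nat)" for w
  define p where "p r = (if r = 0 then i0 else i1)" for r :: nat
  have E: "E (seg g n) \<longleftrightarrow> (\<exists>x<n. 1 \<le> x \<and> j < g x)" for g n
    unfolding E_def by (auto simp: nth0_def)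
  have "prim_rec k" unfolding k_def E_def by (intro prim_intros)
  moreover have "k w < 2" for w by (simp add: k_def)
  moreover have "\<exists>r. (\<forall>\<^sub>F n in sequentially. k (seg g n) = r) \<and> Phi (p r) g = bump_if (exceeds j) g" for g
  proof (cases "exceeds j g")
    case True
    then obtain x where "1 \<le> x" "j < g x" unfolding exceeds_def by blast
    then have "k (seg g n) = 1" if "Suc x \<le> n" for n
      using that unfolding k_def E by (metis Suc_le_lessD)
    then have "\<forall>\<^sub>F n in sequentially. k (seg g n) = 1" unfolding eventually_sequentially by blast
    then show ?thesis using True by (intro exI[of _ 1]) (simp add: p_def i1 bump_if_def)
  next
    case False
    then have "k (seg g n) = 0" for n unfolding k_def E exceeds_def by auto
    then show ?thesis using False by (intro exI[of _ 0]) (simp add: p_def i0 bump_if_def)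
  qed
  ultimately have k: "ranked k 2 p (bump_if (exceeds j))" unfolding ranked_def by blast
  have "monotone_rank k" unfolding monotone_rank_def
  proof (intro allI monoI)
    fix g and n m :: nat assume "n \<le> m"
    then have "E (seg g n) \<longrightarrow> E (seg g m)" unfolding E by (meson less_le_trans)
    then show "k (seg g n) \<le> k (seg g m)" by (simp add: k_def)
  qed
  with ranked_learner[OF k] obtain e where
    e: "\<forall>g\<in>dom (bump_if (exceeds j)). learns (enat 2) \<infinity> e (bump_if (exceeds j)) g" by blast
  show ?thesis
  proof (rule learnableI)
    show "ecard {e} \<le> 1" by (simp add: ecard_def one_enat_def)
    show "\<exists>e\<in>{e}. learns 2 2 e (bump_if (exceeds j)) g" if "g \<in> dom (bump_if (exceeds j))" for g
      using learns_changes_indices[OF e[rule_format, OF that]] by (simp add: numeral_eq_enat)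
  qed
qed

section \<open>Eventually constant sequences and functions of their final value\<close>

definition ends_in :: "(nat \<Rightarrow> nat) \<Rightarrow> nat \<Rightarrow> bool" where
  "ends_in g l \<longleftrightarrow> (\<forall>\<^sub>F n in sequentially. g n = l)"

lemma ends_in_unique: "ends_in g l \<Longrightarrow> ends_in g l' \<Longrightarrow> l = l'"
  unfolding ends_in_def eventually_sequentially by (metis nat_le_linear)

lemma ends_in_const: "ends_in (\<lambda>_. l) l"
  by (simp add: ends_in_def)

lemma ends_in_extend: "ends_in (\<lambda>n. if n < s then g n else l) l"
  unfolding ends_in_def eventually_sequentially by (rule exI[of _ s]) simp

lemma init_seg_extend: "(\<lambda>n. if n < s then g n else l) \<restriction> s = g \<restriction> s"
  by (simp add: init_seg_eq_iff)

text \<open>A sequence with entries at most j and final value j satisfies \<open>exceeds i\<close>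
  exactly for i < j, so the count is j.\<close>

lemma bump_count_exceeds_not_learnable:
  "\<not> learnable 1 b (enat m) (bump_count m exceeds)"
proof -
  let ?Q = "\<lambda>j g. g 0 = 0 \<and> (\<forall>x. g x \<le> j) \<and> ends_in g j"
  show ?thesis
  proof (rule forced_many_indices[of ?Q "\<lambda>_. 0"])
    show "?Q 0 (\<lambda>_. 0)" by (simp add: ends_in_const)
    show "\<exists>h. ?Q (Suc j) h \<and> h \<restriction> s = g \<restriction> s" if "?Q j g" for j g s
    proof (intro exI)
      \<comment> \<open>The maximum with 1 protects the entry at 0.\<close>
      let ?h = "\<lambda>n. if n < max s 1 then g n else Suc j"
      have "?h x \<le> Suc j" for x using that by (simp add: le_SucI)
      moreover have "ends_in ?h (Suc j)" by (rule ends_in_extend)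
      moreover have "?h \<restriction> s = g \<restriction> s" by (simp add: init_seg_eq_iff)
      ultimately show "?Q (Suc j) ?h \<and> ?h \<restriction> s = g \<restriction> s" using that by simp
    qed
    fix j g assume j: "j \<le> m" and Q: "?Q j g"
    have eq: "exceeds i g \<longleftrightarrow> i < j" for i
    proof
      assume "exceeds i g"
      then obtain x where "i < g x" unfolding exceeds_def by blast
      also have "g x \<le> j" using Q by blast
      finally show "i < j" .
    next
      assume "i < j"
      obtain N where "\<And>n. N \<le> n \<Longrightarrow> g n = j" using Q unfolding ends_in_def eventually_sequentially by blast
      then have "g (max N 1) = j" by simp
      with \<open>i < j\<close> show "exceeds i g" unfolding exceeds_def by (intro exI[of _ "max N 1"]) simp
    qed
    have "i < m \<and> exceeds i g \<longleftrightarrow> i < j" for i unfolding eq using j by linarith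
    then have "{i. i < m \<and> exceeds i g} = {..<j}" by (simp only: lessThan_def)
    then show "\<exists>f. bump_count m exceeds g = Some f \<and> f 0 = j" using Q by (simp add: bump_count_def)
  qed
qed

definition final_value :: "nat set \<Rightarrow> (nat \<Rightarrow> nat) \<rightharpoonup> (nat \<Rightarrow> nat)" where
  "final_value S g = (if \<exists>l\<in>S. ends_in g l then Some (\<lambda>_. THE l. ends_in g l) else None)"

lemma final_value_eq: "ends_in g l \<Longrightarrow> l \<in> S \<Longrightarrow> final_value S g = Some (\<lambda>_. l)"
  unfolding final_value_def using ends_in_unique by (auto intro!: ext the_equality)

lemma final_value_dom: "g \<in> dom (final_value S) \<Longrightarrow> \<exists>l\<in>S. ends_in g l"
  unfolding final_value_def by (auto split: if_splits)

definition last_entry :: "nat \<Rightarrow> nat" where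
  "last_entry w = nth0 (list_decode w) (length (list_decode w) - 1)"

lemma pr_last_entry: "prim_rec last_entry"
  unfolding last_entry_def by (intro prim_intros)

lemma last_entry_settles:
  assumes "ends_in g l" shows "\<forall>\<^sub>F n in sequentially. last_entry (seg g n) = l"
proof -
  obtain N where N: "\<And>n. N \<le> n \<Longrightarrow> g n = l"
    using assms unfolding ends_in_def eventually_sequentially by blast
  have "last_entry (seg g n) = l" if "Suc N \<le> n" for n
    using that N[of "n - 1"] by (simp add: last_entry_def nth0_def)
  then show ?thesis unfolding eventually_sequentially by blast
qed

text \<open>The hypothesis is always the constant program for the last entry seen.\<close>

lemma final_value_learnable: "learnable 1 \<infinity> \<infinity> (final_value UNIV)"
proof -
  obtain c where c: "prim_rec c" "\<And>k g. Phi (c k) g = Some (\<lambda>_. k)" by (rule Phi_const) blast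
  obtain e where e: "\<And>\<sigma>. Psi e \<sigma> = c (last_entry (list_encode \<sigma>))"
    by (rule prim_rec_Psi[OF pr_comp[OF c(1) pr_last_entry]]) blast
  have "\<exists>i. settles e g i \<and> Phi i g = final_value UNIV g" if g: "g \<in> dom (final_value UNIV)" for g
  proof -
    obtain l where l: "ends_in g l" using final_value_dom[OF g] by blast
    have "settles e g (c l)" unfolding settles_def
      using last_entry_settles[OF l] by eventually_elim (simp add: e)
    with final_value_eq[OF l] c(2) show ?thesis by (intro exI[of _ "c l"]) simp
  qed
  then show ?thesis unfolding learnable_limit_iff
    by (intro exI[of _ "{e}"]) (simp add: ecard_def one_enat_def)
qed

lemma final_value_programs:
  assumes "finite J" shows "\<not> (\<forall>g\<in>dom (final_value UNIV). \<exists>i\<in>J. Phi i g = final_value UNIV g)"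
proof
  assume J: "\<forall>g\<in>dom (final_value UNIV). \<exists>i\<in>J. Phi i g = final_value UNIV g"
  show False
  proof (rule forced_many_programs[OF assms, of "\<lambda>j g. ends_in g j" "\<lambda>_. 0" "final_value UNIV"])
    show "\<exists>h. ends_in h (Suc j) \<and> h \<restriction> s = g \<restriction> s" for j g s
      using ends_in_extend init_seg_extend by blast
    show "\<exists>f. final_value UNIV g = Some f \<and> f 0 = j" if "ends_in g j" for j g
      using final_value_eq[OF that] by simp
  qed (use J ends_in_const in blast)+
qed

lemma final_bit_ranked: "\<exists>k p. ranked k 2 p (final_value {0, 1})"
proof -
  obtain c where c: "\<And>k g. Phi (c k) g = Some (\<lambda>_. k)" by (rule Phi_const) blast
  let ?k = "\<lambda>w. if last_entry w = 0 then 0 else 1"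
  have "prim_rec ?k" by (intro prim_intros pr_comp[OF pr_last_entry])
  moreover have "\<exists>r. (\<forall>\<^sub>F n in sequentially. ?k (seg g n) = r) \<and> Phi (c r) g = final_value {0, 1} g"
    if g: "g \<in> dom (final_value {0, 1})" for g
  proof -
    obtain l where l: "l \<in> {0, 1}" "ends_in g l" using final_value_dom[OF g] by blast
    have "\<forall>\<^sub>F n in sequentially. ?k (seg g n) = l"
      using last_entry_settles[OF l(2)] by eventually_elim (use l(1) in auto)
    with final_value_eq[OF l(2,1)] c show ?thesis by (intro exI[of _ l]) simp
  qed
  ultimately have "ranked ?k 2 c (final_value {0, 1})" unfolding ranked_def by simp
  then show ?thesis by blast
qed

text \<open>Alternating final bits force arbitrarily many mind changes although two hypotheses
  suffice.\<close>

lemma final_bit_not_learnable: "\<not> learnable 1 (enat m) c (final_value {0, 1})"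
proof -
  let ?Q = "\<lambda>j g. ends_in g (j mod 2)"
  show ?thesis
  proof (rule forced_many_changes[of ?Q "\<lambda>_. 0" _ _ "\<lambda>j. j mod 2"])
    show "?Q 0 (\<lambda>_. 0)" by (simp add: ends_in_const)
    show "\<exists>h. ?Q (Suc j) h \<and> h \<restriction> s = g \<restriction> s" for j g s
      using ends_in_extend init_seg_extend by blast
    show "\<exists>f. final_value {0, 1} g = Some f \<and> f 0 = j mod 2" if "?Q j g" for j g
      using final_value_eq[OF that, of "{0, 1}"] by (cases "even j") (auto simp: even_iff_mod_2_eq_zero odd_iff_mod_2_eq_one)
    show "j mod 2 \<noteq> Suc j mod 2" for j :: nat by presburger
  qed
qed

section \<open>Diagonalization against finite sets of learners\<close>

definition spike :: "nat \<Rightarrow> nat \<Rightarrow> nat" where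
  "spike N = (\<lambda>_. N)(0 := 0)"

definition evades :: "(nat \<Rightarrow> nat) \<Rightarrow> bool" where
  "evades v \<longleftrightarrow> (\<forall>N e i f. e \<in> set_decode N \<longrightarrow> settles e (spike N) i \<longrightarrow>
     Phi i (spike N) = Some f \<longrightarrow> f 0 \<noteq> v N)"

text \<open>The argument \<open>spike N\<close> is reserved for the finite set of learners \<open>set_decode N\<close>; each of them
  yields at most one value there, so that one of \<open>0, \<dots>, card (set_decode N)\<close> is not among these values.\<close>

lemma diagonal: "\<exists>v. evades v \<and> (\<forall>N. v N \<le> card (set_decode N))"
proof -
  have "\<exists>v\<le>card (set_decode N). \<forall>e i f. e \<in> set_decode N \<longrightarrow> settles e (spike N) i \<longrightarrow>
      Phi i (spike N) = Some f \<longrightarrow> f 0 \<noteq> v" for N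
  proof -
    let ?I = "set_decode N"
    \<comment> \<open>Limits are unique, so each learner excludes one value at most;
      \<open>F e\<close> is arbitrary if there is no limit. A candidate then remains by the
      pigeonhole principle.\<close>
    define F where "F e = the (Phi (THE i. settles e (spike N) i) (spike N)) 0" for e
    have F: "f 0 = F e" if "settles e (spike N) i" "Phi i (spike N) = Some f" for e i f
    proof -
      have "(THE i. settles e (spike N) i) = i"
        using that(1) settles_unique by (intro the_equality) blast+
      with that(2) show ?thesis by (simp add: F_def)
    qed
    have "card (F ` ?I) \<le> card ?I" by (intro card_image_le finite_set_decode)
    then have "\<not> {..card ?I} \<subseteq> F ` ?I"
      using card_mono[of "F ` ?I" "{..card ?I}"] finite_set_decode[of N] by auto
    then obtain v where "v \<le> card ?I" "v \<notin> F ` ?I" by blast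
    with F show ?thesis by blast
  qed
  then obtain v where "\<And>N. v N \<le> card (set_decode N) \<and> (\<forall>e i f. e \<in> set_decode N \<longrightarrow>
      settles e (spike N) i \<longrightarrow> Phi i (spike N) = Some f \<longrightarrow> f 0 \<noteq> v N)" by metis
  then show ?thesis unfolding evades_def by (intro exI[of _ v]) blast
qed

text \<open>A supposed set of a learners equals \<open>set_decode N\<close> for its code N, and all
  its members fail on the argument reserved for N.\<close>

lemma diagonal_not_learnable:
  assumes v: "evades v"
    and \<Gamma>: "\<And>N. card (set_decode N) = a \<Longrightarrow> \<exists>f. \<Gamma> (spike N) = Some f \<and> f 0 = v N"
  shows "\<not> learnable (enat a) b c \<Gamma>"
proof
  assume "learnable (enat a) b c \<Gamma>"
  then obtain I where I: "ecard I = enat a" "\<forall>g\<in>dom \<Gamma>. \<exists>e\<in>I. learns b c e \<Gamma> g"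
    unfolding learnable_iff by blast
  then have "finite I" "card I = a" by (auto simp: ecard_def split: if_splits)
  then have N: "set_decode (set_encode I) = I" by simp
  obtain f where f: "\<Gamma> (spike (set_encode I)) = Some f" "f 0 = v (set_encode I)"
    using \<Gamma>[of "set_encode I"] \<open>card I = a\<close> N by auto
  then obtain e where "e \<in> I" "learns b c e \<Gamma> (spike (set_encode I))" using I(2) by blast
  then obtain i where "settles e (spike (set_encode I)) i" "Phi i (spike (set_encode I)) = Some f"
    using learns_imp_limit f(1) by metis
  from v[unfolded evades_def, rule_format, OF _ this] \<open>e \<in> I\<close> N f(2) show False by simp
qed

section \<open>The classes\<close>

definition bound_le :: "bound \<Rightarrow> bound \<Rightarrow> bool" where
  "bound_le x y \<longleftrightarrow> (\<forall>a\<in>bound_values x. \<exists>b\<in>bound_values y. a \<le> b)"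

lemma bound_le_simps [simp]:
  "bound_le x x" "bound_le x Omega" "bound_le (Fin m) (Fin n) \<longleftrightarrow> m \<le> n" "bound_le (Fin m) LessOmega"
  unfolding bound_le_def by (auto simp: bound_le_def)

lemma bound_le_Fin:
  "x \<noteq> Fin 0 \<Longrightarrow> bound_le (Fin 1) x" "x \<noteq> Fin 0 \<Longrightarrow> x \<noteq> Fin 1 \<Longrightarrow> bound_le (Fin 2) x"
  by (cases x; auto)+

lemma CT_mono: "bound_le \<alpha> \<alpha>' \<Longrightarrow> bound_le \<beta> \<beta>' \<Longrightarrow> bound_le \<gamma> \<gamma>' \<Longrightarrow> CT \<alpha> \<beta> \<gamma> \<subseteq> CT \<alpha>' \<beta>' \<gamma>'"
  unfolding CT_def bound_le_def using learnable_mono by blast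

section \<open>Description of the classes by programs, limits and ranks\<close>

abbreviation covers :: "nat set \<Rightarrow> ((nat \<Rightarrow> nat) \<rightharpoonup> (nat \<Rightarrow> nat)) \<Rightarrow> bool" where
  "covers J \<Gamma> \<equiv> \<forall>g\<in>dom \<Gamma>. \<exists>i\<in>J. Phi i g = \<Gamma> g"

text \<open>The right-hand sides agree, so unfolding these equations exchanges one form of the
  bounds for another.\<close>

lemma CT_constant:
  "CT \<alpha> (Fin 1) Omega = {\<Gamma>. \<exists>a\<in>bound_values \<alpha>. \<exists>J. ecard J \<le> a \<and> covers J \<Gamma>}"
  "CT \<alpha> Omega (Fin 1) = {\<Gamma>. \<exists>a\<in>bound_values \<alpha>. \<exists>J. ecard J \<le> a \<and> covers J \<Gamma>}"
  "CT \<alpha> (Fin 1) (Fin 1) = {\<Gamma>. \<exists>a\<in>bound_values \<alpha>. \<exists>J. ecard J \<le> a \<and> covers J \<Gamma>}"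
  using learnable_constant_iff[of 1 \<infinity>] learnable_constant_iff[of \<infinity> 1] learnable_constant_iff[of 1 1]
  by (simp_all add: CT_def one_enat_def)

lemma CT_no_changes:
  assumes "\<beta> = Fin 1 \<or> \<gamma> = Fin 1" "\<beta> \<noteq> Fin 0" "\<gamma> \<noteq> Fin 0"
  shows "CT \<alpha> \<beta> \<gamma> = CT2 \<alpha> (Fin 1)"
proof
  show "CT \<alpha> \<beta> \<gamma> \<subseteq> CT2 \<alpha> (Fin 1)"
    using assms(1)
  proof
    assume "\<gamma> = Fin 1"
    then have "CT \<alpha> \<beta> \<gamma> \<subseteq> CT \<alpha> Omega (Fin 1)"
      using CT_mono[of \<alpha> \<alpha> \<beta> Omega \<gamma> "Fin 1"] by simp
    then show ?thesis unfolding CT_constant .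
  qed (simp add: CT_mono)
  have "CT \<alpha> (Fin 1) (Fin 1) \<subseteq> CT \<alpha> \<beta> \<gamma>"
    using assms(2,3) by (intro CT_mono bound_le_Fin) simp_all
  then show "CT2 \<alpha> (Fin 1) \<subseteq> CT \<alpha> \<beta> \<gamma>" unfolding CT_constant .
qed

lemma in_CT_1_1: "\<Gamma> \<in> CT2 (Fin 1) (Fin 1) \<longleftrightarrow> (\<exists>i. \<forall>g\<in>dom \<Gamma>. Phi i g = \<Gamma> g)"
proof
  assume "\<Gamma> \<in> CT2 (Fin 1) (Fin 1)"
  then obtain J where J: "ecard J \<le> 1" "covers J \<Gamma>" unfolding CT_constant by (auto simp: one_enat_def)
  then have "finite J" "card J \<le> 1" by (auto simp: ecard_def one_enat_def split: if_splits)
  then obtain i where "J \<subseteq> {i}" by (metis One_nat_def card_le_Suc0_iff_eq insertCI subsetI)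
  with J(2) show "\<exists>i. \<forall>g\<in>dom \<Gamma>. Phi i g = \<Gamma> g" by blast
next
  assume "\<exists>i. \<forall>g\<in>dom \<Gamma>. Phi i g = \<Gamma> g"
  then obtain i where "covers {i} \<Gamma>" by blast
  moreover have "ecard {i} \<le> enat 1" by (simp add: ecard_def)
  ultimately show "\<Gamma> \<in> CT2 (Fin 1) (Fin 1)" unfolding CT_constant by auto
qed

lemma in_CT_finite_1: "\<Gamma> \<in> CT2 LessOmega (Fin 1) \<longleftrightarrow> (\<exists>J. finite J \<and> covers J \<Gamma>)"
  unfolding CT_constant by (auto simp: ecard_def split: if_splits)

lemma in_CT_omega_1: "\<Gamma> \<in> CT2 Omega (Fin 1) \<longleftrightarrow> (\<forall>g\<in>dom \<Gamma>. \<exists>i. Phi i g = \<Gamma> g)"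
proof -
  have "(\<exists>J. covers J \<Gamma>) \<longleftrightarrow> (\<forall>g\<in>dom \<Gamma>. \<exists>i. Phi i g = \<Gamma> g)"
    by (metis UNIV_I)
  then show ?thesis unfolding CT_constant by simp
qed

abbreviation identified :: "nat \<Rightarrow> ((nat \<Rightarrow> nat) \<rightharpoonup> (nat \<Rightarrow> nat)) \<Rightarrow> (nat \<Rightarrow> nat) \<Rightarrow> bool" where
  "identified e \<Gamma> g \<equiv> \<exists>i. settles e g i \<and> Phi i g = \<Gamma> g"

lemma in_CT_1_omega: "\<Gamma> \<in> CT2 (Fin 1) Omega \<longleftrightarrow> (\<exists>e. \<forall>g\<in>dom \<Gamma>. identified e \<Gamma> g)"
proof
  assume "\<Gamma> \<in> CT2 (Fin 1) Omega"
  then obtain I where I: "ecard I \<le> 1" "\<forall>g\<in>dom \<Gamma>. \<exists>e\<in>I. identified e \<Gamma> g"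
    by (auto simp: CT_def learnable_limit_iff one_enat_def)
  then have "finite I" "card I \<le> 1" by (auto simp: ecard_def one_enat_def split: if_splits)
  then obtain e where "I \<subseteq> {e}" by (metis One_nat_def card_le_Suc0_iff_eq insertCI subsetI)
  with I(2) show "\<exists>e. \<forall>g\<in>dom \<Gamma>. identified e \<Gamma> g" by blast
next
  assume "\<exists>e. \<forall>g\<in>dom \<Gamma>. identified e \<Gamma> g"
  then obtain e where "\<forall>g\<in>dom \<Gamma>. \<exists>e\<in>{e}. identified e \<Gamma> g" by blast
  moreover have "ecard {e} \<le> enat 1" by (simp add: ecard_def)
  ultimately show "\<Gamma> \<in> CT2 (Fin 1) Omega" unfolding CT_def by (simp add: learnable_limit_iff) blast
qed

lemma in_CT_finite_omega:
  "\<Gamma> \<in> CT2 LessOmega Omega \<longleftrightarrow> (\<exists>I. finite I \<and> (\<forall>g\<in>dom \<Gamma>. \<exists>e\<in>I. identified e \<Gamma> g))"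
  unfolding CT_def learnable_limit_iff mem_Collect_eq bound_values.simps
  by (auto simp: ecard_def learnable_limit_iff split: if_splits)

lemma restrict_map_dom: "dom \<Gamma> \<subseteq> D \<Longrightarrow> \<Gamma> |` D = \<Gamma>"
  by (intro ext) (metis domIff restrict_in restrict_out subsetD)

lemma learnable_1_iff: "learnable 1 b c \<Gamma> \<longleftrightarrow> (\<exists>e. \<forall>g\<in>dom \<Gamma>. learns b c e \<Gamma> g)"
proof
  assume "learnable 1 b c \<Gamma>"
  then obtain I where I: "ecard I = 1" "\<forall>g\<in>dom \<Gamma>. \<exists>e\<in>I. learns b c e \<Gamma> g"
    unfolding learnable_iff by blast
  then obtain e where "I = {e}"
    by (auto simp: ecard_def one_enat_def card_1_singleton_iff split: if_splits)
  with I show "\<exists>e. \<forall>g\<in>dom \<Gamma>. learns b c e \<Gamma> g" by blast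
next
  assume "\<exists>e. \<forall>g\<in>dom \<Gamma>. learns b c e \<Gamma> g"
  then obtain e where e: "\<forall>g\<in>dom \<Gamma>. learns b c e \<Gamma> g" by blast
  show "learnable 1 b c \<Gamma>"
    by (rule learnableI[of "{e}"]) (use e in \<open>auto simp: ecard_def one_enat_def\<close>)
qed

text \<open>In this form closure under composition is \<open>ranked_compose\<close>; the same holds
  for \<open>in_CT_1_omega_finite\<close>.\<close>

lemma in_CT_1_finite:
  "\<Gamma> \<in> CT2 (Fin 1) LessOmega \<longleftrightarrow> (\<exists>k B p. ranked k B p \<Gamma> \<and> monotone_rank k)"
proof
  assume "\<Gamma> \<in> CT2 (Fin 1) LessOmega"
  then obtain b where "learnable 1 (enat b) \<infinity> \<Gamma>" by (auto simp: CT_def one_enat_def)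
  then obtain e where "dom \<Gamma> \<subseteq> {g. learns (enat b) \<infinity> e \<Gamma> g}" unfolding learnable_1_iff by blast
  from learns_changes_ranked[of \<Gamma> b \<infinity> e, unfolded restrict_map_dom[OF this]]
  show "\<exists>k B p. ranked k B p \<Gamma> \<and> monotone_rank k" .
next
  assume "\<exists>k B p. ranked k B p \<Gamma> \<and> monotone_rank k"
  then obtain k B p where "ranked k B p \<Gamma>" "monotone_rank k" by blast
  then have "learnable 1 (enat B) \<infinity> \<Gamma>" unfolding learnable_1_iff using ranked_learner by blast
  then show "\<Gamma> \<in> CT2 (Fin 1) LessOmega" by (auto simp: CT_def one_enat_def)
qed

lemma in_CT_1_omega_finite: "\<Gamma> \<in> CT (Fin 1) Omega LessOmega \<longleftrightarrow> (\<exists>k B p. ranked k B p \<Gamma>)"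
proof
  assume "\<Gamma> \<in> CT (Fin 1) Omega LessOmega"
  then obtain c where "learnable 1 \<infinity> (enat c) \<Gamma>" by (auto simp: CT_def one_enat_def)
  then obtain e where "dom \<Gamma> \<subseteq> {g. learns \<infinity> (enat c) e \<Gamma> g}" unfolding learnable_1_iff by blast
  from learns_indices_ranked[of \<Gamma> \<infinity> c e, unfolded restrict_map_dom[OF this]]
  show "\<exists>k B p. ranked k B p \<Gamma>" .
next
  assume "\<exists>k B p. ranked k B p \<Gamma>"
  then obtain k B p where "ranked k B p \<Gamma>" by blast
  then have "learnable 1 \<infinity> (enat B) \<Gamma>" unfolding learnable_1_iff using ranked_learner by blast
  then show "\<Gamma> \<in> CT (Fin 1) Omega LessOmega" by (auto simp: CT_def one_enat_def)
qed

lemma CT_changes_indices: "CT \<alpha> LessOmega Omega \<subseteq> CT \<alpha> LessOmega LessOmega"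
  "CT \<alpha> (Fin b) Omega \<subseteq> CT \<alpha> (Fin b) (Fin b)"
proof -
  have *: "learnable a (enat b) (enat b) \<Gamma>" if "learnable a (enat b) \<infinity> \<Gamma>" for a b \<Gamma>
    using that learns_changes_indices unfolding learnable_iff by blast
  show "CT \<alpha> LessOmega Omega \<subseteq> CT \<alpha> LessOmega LessOmega"
    unfolding CT_def using * by (simp add: subset_iff) blast
  show "CT \<alpha> (Fin b) Omega \<subseteq> CT \<alpha> (Fin b) (Fin b)"
    unfolding CT_def using * by (simp add: subset_iff) blast
qed

text \<open>Each learner with a finite bound of either kind contributes one program for each rank,
  and there are finitely many learners.\<close>

lemma CT_finite_programs:
  assumes "\<beta> \<noteq> Omega \<or> \<gamma> \<noteq> Omega" shows "CT LessOmega \<beta> \<gamma> \<subseteq> CT2 LessOmega (Fin 1)"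
proof
  fix \<Gamma> assume "\<Gamma> \<in> CT LessOmega \<beta> \<gamma>"
  then obtain a b c where abc: "b \<in> bound_values \<beta>" "c \<in> bound_values \<gamma>" "learnable (enat a) b c \<Gamma>"
    unfolding CT_def by auto
  then have "b \<noteq> \<infinity> \<or> c \<noteq> \<infinity>" using assms by (cases \<beta>; cases \<gamma>) auto
  then have "\<exists>k B p. ranked k B p (\<Gamma> |` {g. learns b c e \<Gamma> g})" for e
    using learns_changes_ranked[of \<Gamma> _ c e] learns_indices_ranked[of \<Gamma> b _ e]
    by (metis enat.exhaust)
  then have "\<exists>J. finite J \<and> (\<forall>g\<in>dom \<Gamma>. learns b c e \<Gamma> g \<longrightarrow> (\<exists>i\<in>J. Phi i g = \<Gamma> g))" for e
  proof -
    obtain k B p where "ranked k B p (\<Gamma> |` {g. learns b c e \<Gamma> g})"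
      using \<open>\<And>e. \<exists>k B p. ranked k B p (\<Gamma> |` {g. learns b c e \<Gamma> g})\<close> by blast
    from ranked_programs[OF this]
    have "\<exists>i\<in>p ` {..<B}. Phi i g = \<Gamma> g" if "g \<in> dom \<Gamma>" "learns b c e \<Gamma> g" for g
      using that by (simp add: domIff)
    then show ?thesis by (intro exI[of _ "p ` {..<B}"]) blast
  qed
  then obtain J where J: "\<And>e. finite (J e)"
    "\<And>e g. g \<in> dom \<Gamma> \<Longrightarrow> learns b c e \<Gamma> g \<Longrightarrow> \<exists>i\<in>J e. Phi i g = \<Gamma> g" by metis
  obtain I where I: "ecard I = enat a" "\<forall>g\<in>dom \<Gamma>. \<exists>e\<in>I. learns b c e \<Gamma> g"
    using abc(3) unfolding learnable_iff by blast
  then have "finite (\<Union>e\<in>I. J e)" using J(1) by (auto simp: ecard_def split: if_splits)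
  moreover have "covers (\<Union>e\<in>I. J e) \<Gamma>" using I(2) J(2) by blast
  ultimately show "\<Gamma> \<in> CT2 LessOmega (Fin 1)" unfolding in_CT_finite_1 by blast
qed

text \<open>With infinitely many learners there is room for a constant learner for every program, so
  changing hypotheses adds nothing.\<close>

lemma CT_omega:
  assumes "\<beta> \<noteq> Fin 0" "\<gamma> \<noteq> Fin 0" shows "CT Omega \<beta> \<gamma> = CT2 Omega (Fin 1)"
proof
  have "CT Omega \<beta> \<gamma> \<subseteq> CT Omega Omega Omega" by (intro CT_mono) simp_all
  also have "\<dots> \<subseteq> CT2 Omega (Fin 1)"
    unfolding in_CT_omega_1 subset_iff by (auto simp: CT_def learnable_limit_iff)
  finally show "CT Omega \<beta> \<gamma> \<subseteq> CT2 Omega (Fin 1)" .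
  have "CT Omega (Fin 1) (Fin 1) \<subseteq> CT Omega \<beta> \<gamma>"
    using assms by (intro CT_mono bound_le_Fin) simp_all
  then show "CT2 Omega (Fin 1) \<subseteq> CT Omega \<beta> \<gamma>" unfolding CT_constant .
qed

section \<open>The monoids\<close>

definition comp_closed :: "((nat \<Rightarrow> nat) \<rightharpoonup> (nat \<Rightarrow> nat)) set \<Rightarrow> bool" where
  "comp_closed C \<longleftrightarrow> (\<forall>\<Gamma>\<in>C. \<forall>\<Delta>\<in>C. \<Gamma> \<circ>\<^sub>m \<Delta> \<in> C)"

text \<open>Associativity and the unit laws hold for all partial functions, so only membership is at
  stake.\<close>

lemma monoid_iff: "monoid (composition_monoid C) \<longleftrightarrow> Some \<in> C \<and> comp_closed C"
proof
  assume "monoid (composition_monoid C)"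
  then interpret monoid "composition_monoid C" .
  show "Some \<in> C \<and> comp_closed C"
    using one_closed m_closed by (simp add: composition_monoid_def comp_closed_def)
next
  assume "Some \<in> C \<and> comp_closed C"
  then show "monoid (composition_monoid C)"
    by (intro monoidI) (auto simp: composition_monoid_def comp_closed_def map_comp_def fun_eq_iff
        split: option.splits)
qed

lemma Some_in_CT:
  assumes "\<alpha> \<noteq> Fin 0" "\<beta> \<noteq> Fin 0" "\<gamma> \<noteq> Fin 0" shows "Some \<in> CT \<alpha> \<beta> \<gamma>"
proof -
  obtain i where "\<And>g. Phi i g = Some g" by (rule Phi_id) blast
  then have "Some \<in> CT2 (Fin 1) (Fin 1)" unfolding in_CT_1_1 by blast
  then have "Some \<in> CT (Fin 1) (Fin 1) (Fin 1)" unfolding CT_constant .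
  moreover have "CT (Fin 1) (Fin 1) (Fin 1) \<subseteq> CT \<alpha> \<beta> \<gamma>"
    using assms by (intro CT_mono bound_le_Fin)
  ultimately show ?thesis by blast
qed

text \<open>On any argument in the domain there is at least one learner, and it has at least its
  first hypothesis.\<close>

lemma Some_not_in_CT:
  assumes "\<alpha> = Fin 0 \<or> \<beta> = Fin 0 \<or> \<gamma> = Fin 0" shows "Some \<notin> CT \<alpha> \<beta> \<gamma>"
proof
  assume "Some \<in> CT \<alpha> \<beta> \<gamma>"
  then obtain a b c where abc: "a \<in> bound_values \<alpha>" "b \<in> bound_values \<beta>" "c \<in> bound_values \<gamma>"
    "learnable a b c Some" unfolding CT_def by blast
  then obtain I e where I: "ecard I = a" "e \<in> I" "learns b c e Some (\<lambda>_. 0)"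
    unfolding learnable_iff by (metis domI)
  have "Psi e [] \<in> indx (Psi e) (\<lambda>_. 0)" unfolding indx_def by (auto simp: init_seg_def intro: exI[of _ 0])
  then have "c \<noteq> 0" using I(3) unfolding learns_def
    by (auto simp: ecard_def zero_enat_def split: if_splits)
  moreover have "b \<noteq> 0" using I(3) unfolding learns_def by auto
  moreover have "a \<noteq> 0" using I(1,2) by (auto simp: ecard_def zero_enat_def split: if_splits)
  ultimately show False using assms abc by (auto simp: zero_enat_def)
qed

section \<open>Closure of the seven classes under composition\<close>

lemma map_comp_dom:
  assumes "g \<in> dom (\<Gamma> \<circ>\<^sub>m \<Delta>)"
  obtains h f where "\<Delta> g = Some h" "\<Gamma> h = Some f" "(\<Gamma> \<circ>\<^sub>m \<Delta>) g = Some f"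
  using assms by (auto simp: map_comp_def split: option.splits)

lemma covers_comp:
  assumes J: "covers J \<Gamma>" and K: "covers K \<Delta>"
  shows "\<exists>c. covers (c ` (J \<times> K)) (\<Gamma> \<circ>\<^sub>m \<Delta>)"
proof (rule comp_index, intro exI ballI)
  fix c :: "nat \<Rightarrow> nat"
  assume c: "\<And>i j g h f. Phi j g = Some h \<Longrightarrow> Phi i h = Some f \<Longrightarrow> Phi (c (pair i j)) g = Some f"
  fix g assume "g \<in> dom (\<Gamma> \<circ>\<^sub>m \<Delta>)"
  then obtain h f where h: "\<Delta> g = Some h" "\<Gamma> h = Some f" "(\<Gamma> \<circ>\<^sub>m \<Delta>) g = Some f"
    by (rule map_comp_dom)
  obtain j where j: "j \<in> K" "Phi j g = Some h" using K h(1) by (metis domI)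
  obtain i where i: "i \<in> J" "Phi i h = Some f" using J h(2) by (metis domI)
  from c[OF j(2) i(2)] i(1) j(1) h(3)
  show "\<exists>k\<in>(\<lambda>(i, j). c (pair i j)) ` (J \<times> K). Phi k g = (\<Gamma> \<circ>\<^sub>m \<Delta>) g" by force
qed

lemma closed_1_1: "comp_closed (CT2 (Fin 1) (Fin 1))"
  unfolding comp_closed_def in_CT_1_1
proof (intro ballI, unfold in_CT_1_1)
  fix \<Gamma> \<Delta> assume "\<exists>i. \<forall>g\<in>dom \<Gamma>. Phi i g = \<Gamma> g" "\<exists>i. \<forall>g\<in>dom \<Delta>. Phi i g = \<Delta> g"
  then obtain i j where ij: "covers {i} \<Gamma>" "covers {j} \<Delta>" by blast
  from covers_comp[OF ij]
  show "\<exists>i. \<forall>g\<in>dom (\<Gamma> \<circ>\<^sub>m \<Delta>). Phi i g = (\<Gamma> \<circ>\<^sub>m \<Delta>) g" by auto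
qed

lemma closed_finite_1: "comp_closed (CT2 LessOmega (Fin 1))"
  unfolding comp_closed_def
proof (intro ballI, unfold in_CT_finite_1)
  fix \<Gamma> \<Delta> assume "\<exists>J. finite J \<and> covers J \<Gamma>" "\<exists>J. finite J \<and> covers J \<Delta>"
  then obtain J K where JK: "finite J" "finite K" "covers J \<Gamma>" "covers K \<Delta>" by blast
  from covers_comp[OF JK(3,4)] obtain c where "covers (c ` (J \<times> K)) (\<Gamma> \<circ>\<^sub>m \<Delta>)" by blast
  moreover have "finite (c ` (J \<times> K))" using JK(1,2) by simp
  ultimately show "\<exists>J. finite J \<and> covers J (\<Gamma> \<circ>\<^sub>m \<Delta>)" by blast
qed

lemma closed_omega_1: "comp_closed (CT2 Omega (Fin 1))"
  unfolding comp_closed_def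
proof (intro ballI, unfold in_CT_omega_1)
  fix \<Gamma> \<Delta> assume "\<forall>g\<in>dom \<Gamma>. \<exists>i. Phi i g = \<Gamma> g" "\<forall>g\<in>dom \<Delta>. \<exists>i. Phi i g = \<Delta> g"
  then have JK: "covers UNIV \<Gamma>" "covers UNIV \<Delta>" by blast+
  from covers_comp[OF JK] show "\<forall>g\<in>dom (\<Gamma> \<circ>\<^sub>m \<Delta>). \<exists>i. Phi i g = (\<Gamma> \<circ>\<^sub>m \<Delta>) g" by blast
qed

lemma closed_1_finite: "comp_closed (CT2 (Fin 1) LessOmega)"
  unfolding comp_closed_def
proof (intro ballI, unfold in_CT_1_finite)
  fix \<Gamma> \<Delta> assume "\<exists>k B p. ranked k B p \<Gamma> \<and> monotone_rank k" "\<exists>k B p. ranked k B p \<Delta> \<and> monotone_rank k"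
  then obtain k B p k' B' p' where "ranked k B p \<Gamma>" "ranked k' B' p' \<Delta>" "monotone_rank k" "monotone_rank k'"
    by blast
  then show "\<exists>k B p. ranked k B p (\<Gamma> \<circ>\<^sub>m \<Delta>) \<and> monotone_rank k"
    using ranked_compose[of k B p \<Gamma> k' B' p' \<Delta>] by blast
qed

lemma closed_1_omega_finite: "comp_closed (CT (Fin 1) Omega LessOmega)"
  unfolding comp_closed_def
proof (intro ballI, unfold in_CT_1_omega_finite)
  fix \<Gamma> \<Delta> assume "\<exists>k B p. ranked k B p \<Gamma>" "\<exists>k B p. ranked k B p \<Delta>"
  then obtain k B p k' B' p' where "ranked k B p \<Gamma>" "ranked k' B' p' \<Delta>" by blast
  then show "\<exists>k B p. ranked k B p (\<Gamma> \<circ>\<^sub>m \<Delta>)"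
    using ranked_compose[of k B p \<Gamma> k' B' p' \<Delta>] by blast
qed

text \<open>The order of quantifiers matters: e depends on the two learners only, so finite sets of
  learners compose to a finite set.\<close>

lemma identified_compose:
  "\<exists>e. \<forall>\<Gamma> \<Delta> g h. \<Delta> g = Some h \<longrightarrow> h \<in> dom \<Gamma> \<longrightarrow> identified e0 \<Delta> g \<longrightarrow> identified e1 \<Gamma> h \<longrightarrow> identified e (\<Gamma> \<circ>\<^sub>m \<Delta>) g"
proof (rule compose_learners[of e0 e1])
  fix e
  assume e: "\<And>g h f i j. settles e0 g j \<Longrightarrow> Phi j g = Some h \<Longrightarrow> settles e1 h i \<Longrightarrow>
    Phi i h = Some f \<Longrightarrow> \<exists>k. settles e g k \<and> Phi k g = Some f"
  show ?thesis
  proof (rule exI[of _ e], intro allI impI)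
    fix \<Gamma> \<Delta> g h
    assume h: "\<Delta> g = Some h" "h \<in> dom \<Gamma>" and j: "identified e0 \<Delta> g" and i: "identified e1 \<Gamma> h"
    obtain f where f: "\<Gamma> h = Some f" using h(2) by blast
    obtain j where j: "settles e0 g j" "Phi j g = Some h" using j h(1) by auto
    obtain i where i: "settles e1 h i" "Phi i h = Some f" using i f by auto
    have "(\<Gamma> \<circ>\<^sub>m \<Delta>) g = Some f" using h(1) f by (simp add: map_comp_def)
    with e[OF j i] show "identified e (\<Gamma> \<circ>\<^sub>m \<Delta>) g" by simp
  qed
qed

lemma closed_1_omega: "comp_closed (CT2 (Fin 1) Omega)"
  unfolding comp_closed_def
proof (intro ballI, unfold in_CT_1_omega)
  fix \<Gamma> \<Delta> assume "\<exists>e. \<forall>g\<in>dom \<Gamma>. identified e \<Gamma> g" "\<exists>e. \<forall>g\<in>dom \<Delta>. identified e \<Delta> g"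
  then obtain e1 e0 where e1: "\<forall>g\<in>dom \<Gamma>. identified e1 \<Gamma> g" and e0: "\<forall>g\<in>dom \<Delta>. identified e0 \<Delta> g"
    by blast
  obtain e where e: "\<forall>\<Gamma> \<Delta> g h. \<Delta> g = Some h \<longrightarrow> h \<in> dom \<Gamma> \<longrightarrow> identified e0 \<Delta> g \<longrightarrow>
      identified e1 \<Gamma> h \<longrightarrow> identified e (\<Gamma> \<circ>\<^sub>m \<Delta>) g"
    using identified_compose[of e0 e1] by (rule exE)
  have "identified e (\<Gamma> \<circ>\<^sub>m \<Delta>) g" if g: "g \<in> dom (\<Gamma> \<circ>\<^sub>m \<Delta>)" for g
  proof -
    obtain h f where h: "\<Delta> g = Some h" "\<Gamma> h = Some f" by (rule map_comp_dom[OF g])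
    have "identified e0 \<Delta> g" using e0 domI[of \<Delta>, OF h(1)] by (rule bspec)
    moreover have "identified e1 \<Gamma> h" using e1 domI[of \<Gamma>, OF h(2)] by (rule bspec)
    ultimately show ?thesis by (rule e[rule_format, of \<Delta> g h \<Gamma>, OF h(1) domI[of \<Gamma>, OF h(2)]])
  qed
  then show "\<exists>e. \<forall>g\<in>dom (\<Gamma> \<circ>\<^sub>m \<Delta>). identified e (\<Gamma> \<circ>\<^sub>m \<Delta>) g" by blast
qed

lemma closed_finite_omega: "comp_closed (CT2 LessOmega Omega)"
  unfolding comp_closed_def
proof (intro ballI, unfold in_CT_finite_omega)
  fix \<Gamma> \<Delta>
  assume "\<exists>I. finite I \<and> (\<forall>g\<in>dom \<Gamma>. \<exists>e\<in>I. identified e \<Gamma> g)"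
    "\<exists>I. finite I \<and> (\<forall>g\<in>dom \<Delta>. \<exists>e\<in>I. identified e \<Delta> g)"
  then obtain I1 I0 where fin: "finite I1" "finite I0"
    and I1: "\<forall>g\<in>dom \<Gamma>. \<exists>e\<in>I1. identified e \<Gamma> g" and I0: "\<forall>g\<in>dom \<Delta>. \<exists>e\<in>I0. identified e \<Delta> g"
    by blast
  define c where "c e1 e0 = (SOME e. \<forall>\<Gamma> \<Delta> g h. \<Delta> g = Some h \<longrightarrow> h \<in> dom \<Gamma> \<longrightarrow>
      identified e0 \<Delta> g \<longrightarrow> identified e1 \<Gamma> h \<longrightarrow> identified e (\<Gamma> \<circ>\<^sub>m \<Delta>) g)" for e1 e0
  have c: "\<forall>\<Gamma> \<Delta> g h. \<Delta> g = Some h \<longrightarrow> h \<in> dom \<Gamma> \<longrightarrow> identified e0 \<Delta> g \<longrightarrow>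
      identified e1 \<Gamma> h \<longrightarrow> identified (c e1 e0) (\<Gamma> \<circ>\<^sub>m \<Delta>) g" for e0 e1
    unfolding c_def by (rule someI_ex[OF identified_compose])
  let ?I = "(\<lambda>(e1, e0). c e1 e0) ` (I1 \<times> I0)"
  have "\<exists>e\<in>?I. identified e (\<Gamma> \<circ>\<^sub>m \<Delta>) g" if g: "g \<in> dom (\<Gamma> \<circ>\<^sub>m \<Delta>)" for g
  proof -
    obtain h f where h: "\<Delta> g = Some h" "\<Gamma> h = Some f" by (rule map_comp_dom[OF g])
    obtain e0 where e0: "e0 \<in> I0" "identified e0 \<Delta> g"
      using bspec[OF I0 domI[of \<Delta>, OF h(1)]] by (rule bexE)
    obtain e1 where e1: "e1 \<in> I1" "identified e1 \<Gamma> h"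
      using bspec[OF I1 domI[of \<Gamma>, OF h(2)]] by (rule bexE)
    have "identified (c e1 e0) (\<Gamma> \<circ>\<^sub>m \<Delta>) g"
      by (rule c[rule_format, of \<Delta> g h \<Gamma>, OF h(1) domI[of \<Gamma>, OF h(2)] e0(2) e1(2)])
    moreover have "c e1 e0 \<in> ?I" using e0(1) e1(1) by force
    ultimately show ?thesis by blast
  qed
  moreover have "finite ?I" using fin by simp
  ultimately show "\<exists>I. finite I \<and> (\<forall>g\<in>dom (\<Gamma> \<circ>\<^sub>m \<Delta>). \<exists>e\<in>I. identified e (\<Gamma> \<circ>\<^sub>m \<Delta>) g)" by blast
qed

section \<open>The classes that are not monoids\<close>

text \<open>Factors learnable with two hypotheses lie in C, but a product of m of them requires m +
  1.\<close>

lemma not_closed_one_learner: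
  assumes "CT (Fin 1) (Fin 2) (Fin 2) \<subseteq> C" "C \<subseteq> CT (Fin 1) Omega (Fin m)" "Some \<in> C"
  shows "\<not> comp_closed C"
proof
  assume C: "comp_closed C"
  have "bump_if (exceeds j) \<in> CT (Fin 1) (Fin 2) (Fin 2)" for j
    using bump_if_exceeds_learnable[of j] by (simp add: CT_def one_enat_def numeral_eq_enat)
  then have "bump_if (exceeds j) \<in> C" for j using assms(1) by blast
  then have "bump_count m exceeds \<in> C"
    using assms(3) C by (intro bump_count_in_closed exceeds_tail) (auto simp: comp_closed_def)
  then have "bump_count m exceeds \<in> CT (Fin 1) Omega (Fin m)" using assms(2) by blast
  then have "learnable 1 \<infinity> (enat m) (bump_count m exceeds)" by (simp add: CT_def one_enat_def)
  then show False using bump_count_exceeds_not_learnable by blast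
qed

text \<open>Each factor requires two programs only, while the product of a factors takes the
  diagonal value v N \<le> a at the argument reserved for a set of a learners.\<close>

lemma not_closed_finitely_many_learners:
  assumes "CT (Fin 2) (Fin 1) (Fin 1) \<subseteq> C" "C \<subseteq> CT2 (Fin a) Omega" "Some \<in> C"
  shows "\<not> comp_closed C"
proof
  assume C: "comp_closed C"
  obtain v where v: "evades v" "\<And>N. v N \<le> card (set_decode N)" using diagonal by blast
  \<comment> \<open>At \<open>spike N\<close> the entry at 1 is N, and \<open>bump\<close> leaves it
    alone.\<close>
  define A where "A j g \<longleftrightarrow> j < v (g 1)" for j and g :: "nat \<Rightarrow> nat"
  obtain J where J: "finite J" "card J \<le> 2" "\<And>A g. \<exists>i\<in>J. Phi i g = bump_if A g"
    by (rule bump_if_programs) blast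
  have "ecard J \<le> enat 2" using J(1,2) by (simp add: ecard_def)
  then have "bump_if (A j) \<in> CT (Fin 2) (Fin 1) (Fin 1)" for j
    unfolding CT_constant using J(3) by auto
  then have "bump_if (A j) \<in> C" for j using assms(1) by blast
  then have "bump_count a A \<in> C"
    using assms(3) C by (intro bump_count_in_closed) (auto simp: comp_closed_def A_def)
  then have "bump_count a A \<in> CT2 (Fin a) Omega" using assms(2) by blast
  then have "learnable (enat a) \<infinity> \<infinity> (bump_count a A)" by (simp add: CT_def)
  moreover have "\<not> learnable (enat a) \<infinity> \<infinity> (bump_count a A)"
  proof (rule diagonal_not_learnable[OF v(1)])
    fix N assume "card (set_decode N) = a"
    then have "v N \<le> a" using v(2)[of N] by simp
    then have "j < a \<and> A j (spike N) \<longleftrightarrow> j < v N" for j by (auto simp: A_def spike_def)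
    then have "{j. j < a \<and> A j (spike N)} = {..<v N}" by (simp only: lessThan_def)
    then show "\<exists>f. bump_count a A (spike N) = Some f \<and> f 0 = v N"
      by (simp add: bump_count_def) (simp add: spike_def)
  qed
  ultimately show False by blast
qed

text \<open>For each single g the diagonal value is output by a constant program, but finitely many
  learners cannot find it for all g.\<close>

lemma CT_omega_not_subset: "\<not> CT2 Omega (Fin 1) \<subseteq> CT2 LessOmega Omega"
proof
  assume sub: "CT2 Omega (Fin 1) \<subseteq> CT2 LessOmega Omega"
  obtain v where v: "evades v" using diagonal by blast
  obtain c where c: "\<And>k g. Phi (c k) g = Some (\<lambda>_. k)" by (rule Phi_const) blast
  let ?\<Gamma> = "\<lambda>g. Some (\<lambda>_. v (g 1)) :: (nat \<Rightarrow> nat) option"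
  have "?\<Gamma> \<in> CT2 Omega (Fin 1)" unfolding in_CT_omega_1 using c by blast
  then have "?\<Gamma> \<in> CT2 LessOmega Omega" using sub by blast
  then obtain a where "learnable (enat a) \<infinity> \<infinity> ?\<Gamma>" by (auto simp: CT_def)
  moreover have "\<not> learnable (enat a) \<infinity> \<infinity> ?\<Gamma>"
    by (rule diagonal_not_learnable[OF v]) (simp_all add: spike_def)
  ultimately show False by blast
qed

section \<open>Inclusions and separations among the seven classes\<close>

lemma CT_chain:
  "CT2 (Fin 1) (Fin 1) \<subseteq> CT2 (Fin 1) LessOmega"
  "CT2 (Fin 1) LessOmega \<subseteq> CT (Fin 1) Omega LessOmega"
  "CT (Fin 1) Omega LessOmega \<subseteq> CT2 LessOmega (Fin 1)"
  "CT (Fin 1) Omega LessOmega \<subseteq> CT2 (Fin 1) Omega"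
  "CT2 LessOmega (Fin 1) \<subseteq> CT2 LessOmega Omega"
  "CT2 (Fin 1) Omega \<subseteq> CT2 LessOmega Omega"
  "CT2 LessOmega Omega \<subseteq> CT2 Omega (Fin 1)"
proof -
  have "CT2 (Fin 1) LessOmega \<subseteq> CT (Fin 1) LessOmega LessOmega" by (rule CT_changes_indices)
  also have "\<dots> \<subseteq> CT (Fin 1) Omega LessOmega" by (simp add: CT_mono)
  finally show "CT2 (Fin 1) LessOmega \<subseteq> CT (Fin 1) Omega LessOmega" .
  have "CT (Fin 1) Omega LessOmega \<subseteq> CT LessOmega Omega LessOmega" by (simp add: CT_mono)
  also have "\<dots> \<subseteq> CT2 LessOmega (Fin 1)" by (rule CT_finite_programs) simp
  finally show "CT (Fin 1) Omega LessOmega \<subseteq> CT2 LessOmega (Fin 1)" .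
  have "CT2 LessOmega Omega \<subseteq> CT2 Omega Omega"
    by (intro CT_mono) (auto simp: bound_le_def)
  also have "\<dots> = CT2 Omega (Fin 1)" by (rule CT_omega) simp_all
  finally show "CT2 LessOmega Omega \<subseteq> CT2 Omega (Fin 1)" .
qed (simp_all add: CT_mono)

text \<open>In the first and the third case the inclusion would place a class known to be closed
  between the bounds of a lemma that denies closure. The other two use final values.\<close>

lemma CT_separations:
  "\<not> CT2 (Fin 1) LessOmega \<subseteq> CT2 (Fin 1) (Fin 1)"
  "\<not> CT (Fin 1) Omega LessOmega \<subseteq> CT2 (Fin 1) LessOmega"
  "\<not> CT2 LessOmega (Fin 1) \<subseteq> CT2 (Fin 1) Omega"
  "\<not> CT2 (Fin 1) Omega \<subseteq> CT2 LessOmega (Fin 1)"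
proof -
  show "\<not> CT2 (Fin 1) LessOmega \<subseteq> CT2 (Fin 1) (Fin 1)"
  proof
    assume "CT2 (Fin 1) LessOmega \<subseteq> CT2 (Fin 1) (Fin 1)"
    moreover have "CT (Fin 1) (Fin 2) (Fin 2) \<subseteq> CT2 (Fin 1) LessOmega" by (simp add: CT_mono)
    moreover have "CT2 (Fin 1) (Fin 1) \<subseteq> CT (Fin 1) Omega (Fin 1)" unfolding CT_constant ..
    ultimately have "\<not> comp_closed (CT2 (Fin 1) (Fin 1))"
      by (intro not_closed_one_learner Some_in_CT) (blast | simp)+
    then show False using closed_1_1 by blast
  qed
  show "\<not> CT (Fin 1) Omega LessOmega \<subseteq> CT2 (Fin 1) LessOmega"
  proof
    assume sub: "CT (Fin 1) Omega LessOmega \<subseteq> CT2 (Fin 1) LessOmega"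
    have "final_value {0, 1} \<in> CT (Fin 1) Omega LessOmega"
      unfolding in_CT_1_omega_finite using final_bit_ranked by blast
    then have "final_value {0, 1} \<in> CT2 (Fin 1) LessOmega" using sub by blast
    then obtain b where "learnable 1 (enat b) \<infinity> (final_value {0, 1})"
      unfolding CT_def one_enat_def by auto
    then show False using final_bit_not_learnable by blast
  qed
  show "\<not> CT2 LessOmega (Fin 1) \<subseteq> CT2 (Fin 1) Omega"
  proof
    assume "CT2 LessOmega (Fin 1) \<subseteq> CT2 (Fin 1) Omega"
    moreover have "CT (Fin 2) (Fin 1) (Fin 1) \<subseteq> CT2 LessOmega (Fin 1)" by (simp add: CT_mono)
    ultimately have "\<not> comp_closed (CT2 LessOmega (Fin 1))"
      by (intro not_closed_finitely_many_learners Some_in_CT) (blast | simp)+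
    then show False using closed_finite_1 by blast
  qed
  show "\<not> CT2 (Fin 1) Omega \<subseteq> CT2 LessOmega (Fin 1)"
  proof
    assume sub: "CT2 (Fin 1) Omega \<subseteq> CT2 LessOmega (Fin 1)"
    have "final_value UNIV \<in> CT2 (Fin 1) Omega"
      using final_value_learnable by (simp add: CT_def one_enat_def)
    then have "final_value UNIV \<in> CT2 LessOmega (Fin 1)" using sub by blast
    then show False unfolding in_CT_finite_1 using final_value_programs by blast
  qed
qed

text \<open>The diagram is a chain except for the incomparable pair D, E, so these twelve facts
  yield all 21 inequalities.\<close>

lemma card_seven:
  fixes A B C D E F G :: "'a set"
  assumes "A \<subseteq> B" "B \<subseteq> C" "C \<subseteq> D" "C \<subseteq> E" "D \<subseteq> F" "E \<subseteq> F" "F \<subseteq> G"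
    and "\<not> B \<subseteq> A" "\<not> C \<subseteq> B" "\<not> D \<subseteq> E" "\<not> E \<subseteq> D" "\<not> G \<subseteq> F"
  shows "card {A, B, C, D, E, F, G} = 7"
proof -
  have "A \<noteq> B" "A \<noteq> C" "A \<noteq> D" "A \<noteq> E" "A \<noteq> F" "A \<noteq> G" using assms by order+
  moreover have "B \<noteq> C" "B \<noteq> D" "B \<noteq> E" "B \<noteq> F" "B \<noteq> G" using assms by order+
  moreover have "C \<noteq> D" "C \<noteq> E" "C \<noteq> F" "C \<noteq> G" using assms by order+
  moreover have "D \<noteq> E" "D \<noteq> F" "D \<noteq> G" "E \<noteq> F" "E \<noteq> G" "F \<noteq> G" using assms by order+
  ultimately show ?thesis by simp
qed

text \<open>If \<alpha> is \<open>Omega\<close> or \<open>LessOmega\<close>, every class with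
  nonzero bounds is among the seven; closure is used only if \<alpha> is a fixed number.\<close>

lemma closed_CT_cases:
  assumes closed: "comp_closed (CT \<alpha> \<beta> \<gamma>)" and nz: "\<alpha> \<noteq> Fin 0" "\<beta> \<noteq> Fin 0" "\<gamma> \<noteq> Fin 0"
  shows "CT \<alpha> \<beta> \<gamma> \<in> {CT2 (Fin 1) (Fin 1), CT2 (Fin 1) LessOmega, CT (Fin 1) Omega LessOmega,
    CT2 LessOmega (Fin 1), CT2 (Fin 1) Omega, CT2 LessOmega Omega, CT2 Omega (Fin 1)}"
proof -
  have one: "Some \<in> CT \<alpha> \<beta> \<gamma>" using nz by (rule Some_in_CT)
  consider "\<alpha> = Omega" | "\<alpha> = LessOmega" | "\<alpha> = Fin 1" | n where "\<alpha> = Fin n" "2 \<le> n"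
    using nz(1) by (cases \<alpha>) (auto, metis One_nat_def Suc_leI le_neq_implies_less neq0_conv numeral_2_eq_2)
  then show ?thesis
  proof cases
    case 1
    then show ?thesis using CT_omega[OF nz(2,3)] by simp
  next
    case 2
    show ?thesis
    proof (cases "\<beta> = Omega \<and> \<gamma> = Omega")
      case False
      have "CT LessOmega (Fin 1) (Fin 1) \<subseteq> CT LessOmega \<beta> \<gamma>"
        using nz(2,3) by (intro CT_mono bound_le_Fin) simp_all
      then have "CT2 LessOmega (Fin 1) \<subseteq> CT LessOmega \<beta> \<gamma>" unfolding CT_constant .
      with CT_finite_programs[of \<beta> \<gamma>] False have "CT LessOmega \<beta> \<gamma> = CT2 LessOmega (Fin 1)" by blast
      then show ?thesis by (simp add: 2)
    qed (simp add: 2)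
  next
    case 3
    show ?thesis
    proof (cases "\<beta> = Fin 1 \<or> \<gamma> = Fin 1")
      case True
      from CT_no_changes[OF this nz(2,3)] show ?thesis by (simp add: 3)
    next
      case False
      then have lower: "CT (Fin 1) (Fin 2) (Fin 2) \<subseteq> CT \<alpha> \<beta> \<gamma>"
        unfolding 3 using nz(2,3) by (intro CT_mono bound_le_Fin) simp_all
      \<comment> \<open>Closure rules out every fixed bound on hypotheses, and with
        \<open>CT_changes_indices\<close> every fixed bound on mind changes too.\<close>
      have upper: "\<not> CT \<alpha> \<beta> \<gamma> \<subseteq> CT (Fin 1) Omega (Fin m)" for m
        using not_closed_one_learner[OF lower _ one] closed by blast
      have \<gamma>: "\<gamma> = LessOmega \<or> \<gamma> = Omega"
      proof (cases \<gamma>)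
        case (Fin c)
        then have "CT \<alpha> \<beta> \<gamma> \<subseteq> CT (Fin 1) Omega (Fin c)" unfolding 3 by (simp add: CT_mono)
        with upper show ?thesis by blast
      qed simp_all
      have "\<beta> = LessOmega \<or> \<beta> = Omega"
      proof (cases \<beta>)
        case (Fin b)
        then have "CT \<alpha> \<beta> \<gamma> \<subseteq> CT (Fin 1) (Fin b) Omega" unfolding 3 by (simp add: CT_mono)
        also have "\<dots> \<subseteq> CT (Fin 1) (Fin b) (Fin b)" by (rule CT_changes_indices)
        also have "\<dots> \<subseteq> CT (Fin 1) Omega (Fin b)" by (simp add: CT_mono)
        finally show ?thesis using upper by blast
      qed simp_all
      moreover have "CT (Fin 1) LessOmega LessOmega = CT2 (Fin 1) LessOmega"
        by (intro equalityI CT_mono CT_changes_indices) simp_all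
      ultimately show ?thesis using \<gamma> 3 by auto
    qed
  next
    case 4
    have "CT (Fin 2) (Fin 1) (Fin 1) \<subseteq> CT \<alpha> \<beta> \<gamma>"
      unfolding 4(1) using nz(2,3) 4(2) by (intro CT_mono bound_le_Fin) simp_all
    moreover have "CT \<alpha> \<beta> \<gamma> \<subseteq> CT2 (Fin n) Omega" unfolding 4(1) by (simp add: CT_mono)
    ultimately have "\<not> comp_closed (CT \<alpha> \<beta> \<gamma>)" using one by (rule not_closed_finitely_many_learners)
    with closed show ?thesis by blast
  qed
qed

theorem theorem2p1:
  shows "{C. (\<exists>\<alpha> \<beta> \<gamma>. C = CT \<alpha> \<beta> \<gamma>) \<and> monoid (composition_monoid C)} =
          {CT2 (Fin 1) (Fin 1),
           CT2 (Fin 1) LessOmega,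
           CT (Fin 1) Omega LessOmega,
           CT2 LessOmega (Fin 1),
           CT2 (Fin 1) Omega,
           CT2 LessOmega Omega,
           CT2 Omega (Fin 1)}
    \<and> card {C. (\<exists>\<alpha> \<beta> \<gamma>. C = CT \<alpha> \<beta> \<gamma>) \<and> monoid (composition_monoid C)} = 7"
proof -
  let ?S = "{C. (\<exists>\<alpha> \<beta> \<gamma>. C = CT \<alpha> \<beta> \<gamma>) \<and> monoid (composition_monoid C)}"
  let ?T = "{CT2 (Fin 1) (Fin 1), CT2 (Fin 1) LessOmega, CT (Fin 1) Omega LessOmega,
    CT2 LessOmega (Fin 1), CT2 (Fin 1) Omega, CT2 LessOmega Omega, CT2 Omega (Fin 1)}"
  have S_T: "C \<in> ?T" if "C \<in> ?S" for C
  proof -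
    from that obtain \<alpha> \<beta> \<gamma> where C: "C = CT \<alpha> \<beta> \<gamma>" "Some \<in> CT \<alpha> \<beta> \<gamma>" "comp_closed (CT \<alpha> \<beta> \<gamma>)"
      by (auto simp: monoid_iff)
    then have "\<alpha> \<noteq> Fin 0" "\<beta> \<noteq> Fin 0" "\<gamma> \<noteq> Fin 0" using Some_not_in_CT by blast+
    from closed_CT_cases[OF C(3) this] show ?thesis unfolding C(1) .
  qed
  have T_S: "C \<in> ?S" if "C \<in> ?T" for C
  proof -
    from that have "comp_closed C"
      using closed_1_1 closed_1_finite closed_1_omega_finite closed_finite_1 closed_1_omega
        closed_finite_omega closed_omega_1 by blast
    moreover have "Some \<in> C" using that by (auto intro!: Some_in_CT)
    moreover have "\<exists>\<alpha> \<beta> \<gamma>. C = CT \<alpha> \<beta> \<gamma>" using that by blast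
    ultimately show ?thesis by (intro CollectI conjI monoid_iff[THEN iffD2])
  qed
  have "?S = ?T" by (intro subset_antisym subsetI) (rule S_T, assumption, rule T_S, assumption)
  moreover have "card ?T = 7"
    by (rule card_seven) (rule CT_chain CT_separations CT_omega_not_subset)+
  ultimately show ?thesis by (simp only:)
qed

end
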